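(* Let $T>0$ and let $(V,d,\pi,\kappa)$ and $(\phi,\psi^*,\alpha)$ satisfy the standing assumptions listed in the context. Assume that for every $\varphi\in\mathcal X_2$ there exists a sequence $(\varphi_n)_n\subset\mathrm{Lip}_b(V)$ such that, as $n\to\infty$, $\varphi_n\to\varphi$ in $L^1(V;\pi)$ and $\overline\nabla\varphi_n\to\overline\nabla\varphi$ in $L^2(E;\vartheta_\kappa)$. Suppose also that the Fisher information functional $\mathscr D:\{\mathscr E<\infty\}\to[0,\infty]$ is convex. Then any Dissipative solution $(\rho,j)$ with $u=\frac{\mathrm d\rho}{\mathrm d\pi}\in L^\infty(0,T;L^\infty(V;\pi))$ is a Reflecting solution.
   Context: **Setting.** $(V,d)$ is a separable metric space, $\pi$ a finite positive Borel measure on $V$, $E:=V\times V$, $E':=E\setminus\{(x,x):x\in V\}$, $\mathcal M^+(V)$ is the set of finite positive Borel measures on $V$. The jump kernel $\kappa=(\kappa(x,\cdot))_{x\in V}$ is a family of positive $\sigma$-finite Borel measures on $V$ with $\kappa(x,\{x\})=0$, such that $x\mapsto\int_V f(y)(1\wedge d^2(x,y))\,\kappa(x,\mathrm dy)$ is Borel for every bounded Borel $f:V\to\mathbb R$, and $\sup_{x\in V}\int_V(1\wedge d^2(x,y))\,\kappa(x,\mathrm dy)<\infty$. The $\sigma$-finite measure $\vartheta_\kappa(\mathrm dx\,\mathrm dy):=\pi(\mathrm dx)\,\kappa(x,\mathrm dy)$ on $E$ is invariant under $(x,y)\mapsto(y,x)$ (detailed balance). Write $\overline\nabla\varphi(x,y):=\varphi(y)-\varphi(x)$.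 $\mathrm{Lip}_b(V)$ is the space of bounded $d$-Lipschitz functions and $\mathcal X_2:=\{\varphi\in L^\infty(V;\pi):\iint_{E'}|\overline\nabla\varphi|^2\,\mathrm d\vartheta_\kappa<\infty\}$. **Fluxes.** For a separable metric space $Y$, $\mathcal M_\sigma(Y)$ is the set of pairs $\mu=(\mu^+,\mu^-)$ of mutually singular $\sigma$-finite positive Borel measures on $Y$; $|\mu|:=\mu^++\mu^-$ and $\int f\,\mathrm d\mu:=\int f\,\mathrm d\mu^+-\int f\,\mathrm d\mu^-$ for $f\in L^1(|\mu|)$. A family $(j_t)_{t\in[0,T]}\subset\mathcal M_\sigma(E)$ is measurable if $t\mapsto j_t^\pm(B)$ is Borel for every Borel $B$. If $|\mu|\ll\gamma$ with $\gamma$ positive $\sigma$-finite, $\frac{\mathrm d\mu}{\mathrm d\gamma}:=\frac{\mathrm d\mu^+}{\mathrm d\gamma}-\frac{\mathrm d\mu^-}{\mathrm d\gamma}$. **Densities.** $\phi\in C([0,\infty))\cap C^1((0,\infty))$ is convex, $\min\phi=0$, $\lim_{r\to\infty}\phi(r)/r=\infty$. $\psi^*:\mathbb R\to[0,\infty)$ is convex, differentiable, even, $\psi^*(0)=0$, $\lim_{|\xi|\to\infty}\psi^*(\xi)/|\xi|=\infty$, $\lim_{\xi\to0}\psi^*(\xi)/|\xi|^2\in(0,\infty)$; $\psi$ is its convex conjugate. $\alpha:[0,\infty)^2\to[0,\infty)$ is not identically zero, continuous, concave, symmetric. **Functionals.** $\mathscr E(\rho):=\int_V\phi(\frac{\mathrm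 d\rho}{\mathrm d\pi})\,\mathrm d\pi$ if $\rho\ll\pi$, $+\infty$ otherwise. For $\rho=u\pi$ and $j\in\mathcal M_\sigma(E)$ let $\nu_\rho(\mathrm dx\,\mathrm dy):=\alpha(u(x),u(y))\,\vartheta_\kappa(\mathrm dx\,\mathrm dy)$ and $\mathscr R(\rho,j):=\frac12\iint\psi\big(\frac{\mathrm d(2j)}{\mathrm d\nu_\rho}\big)\,\mathrm d\nu_\rho$ if $|j|\ll\nu_\rho$, $+\infty$ otherwise. Set $\phi'(0):=\lim_{r\downarrow0}\phi'(r)\in[-\infty,\infty)$, $\Lambda_\phi(u,v):=\phi'(v)-\phi'(u)$ for $(u,v)\ne(0,0)$, $\Lambda_\phi(0,0):=0$. $D_\phi^+(u,v):=\psi^*(\Lambda_\phi(u,v))\alpha(u,v)$ if $\alpha(u,v)>0$ (with $\psi^*(\pm\infty)=+\infty$), $:=0$ if $u=v=0$, $:=+\infty$ if $\alpha(u,v)=0$ and $u\neq v$; $D_\phi:[0,\infty)^2\to[0,\infty]$ is the lower semicontinuous envelope of $D_\phi^+$. The Fisher information is $\mathscr D(\rho):=\frac12\iint_E D_\phi(u(x),u(y))\,\vartheta_\kappa(\mathrm dx\,\mathrm dy)$ for $\rho=u\pi$. Standing assumption: $\mathscr D$ is lower semicontinuous under setwise convergence, i.e. if $\rho_n,\rho$ have finite entropy and $\rho_n(B)\to\rho(B)$ for all Borel $B$, then $\liminf_n\mathscr D(\rho_n)\ge\mathscr D(\rho)$. **Continuity equations.** $(\rho,j)\in\mathcal{CE}([0,T])$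 means: $\rho=(\rho_t)_{t\in[0,T]}\subset\mathcal M^+(V)$; $j=(j_t)_{t\in[0,T]}\subset\mathcal M_\sigma(E)$ is a measurable family with $|j_t|(E\setminus E')=0$ and $\int_0^T\iint_E(1\wedge d(x,y))\,|j_t|(\mathrm dx\,\mathrm dy)\,\mathrm dt<\infty$; and for all $\varphi\in\mathrm{Lip}_b(V)$ and $[s,t]\subset[0,T]$: ( * ) $\int_V\varphi\,\mathrm d\rho_t-\int_V\varphi\,\mathrm d\rho_s=\int_s^t\iint_{E'}\overline\nabla\varphi(x,y)\,j_r(\mathrm dx\,\mathrm dy)\,\mathrm dr$. $\mathcal{ACE}([0,T])$: pairs in $\mathcal{CE}([0,T])$ with $\sup_{t\in[0,T]}\mathscr E(\rho_t)<\infty$ and $\int_0^T(\mathscr R(\rho_t,j_t)+\mathscr D(\rho_t))\,\mathrm dt<\infty$. $\mathcal{RCE}([0,T])$: pairs $(\rho,j)\in\mathcal{ACE}([0,T])$, $\rho_t=u_t\pi$, with $\operatorname{ess\,sup}_{t\in(0,T)}\|u_t\|_{L^\infty(V;\pi)}<\infty$ (that is, $u\in L^\infty(0,T;L^\infty(V;\pi))$), such that ( * ) holds for all $[s,t]\subset[0,T]$ and all $\varphi\in\mathcal X_2$. **Solutions.** $(\rho,j)\in\mathcal{CE}([0,T])$ with $\mathscr E(\rho_0)<\infty$ is a Dissipative solution if $\int_0^t(\mathscr R(\rho_r,j_r)+\mathscr D(\rho_r))\,\mathrm dr+\mathscr E(\rho_t)\le\mathscr E(\rho_0)$ for all $t\in[0,T]$.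 $(\rho,j)\in\mathcal{RCE}([0,T])$ with $\mathscr E(\rho_0)<\infty$ is a Reflecting solution if $\int_s^t(\mathscr R(\rho_r,j_r)+\mathscr D(\rho_r))\,\mathrm dr+\mathscr E(\rho_t)=\mathscr E(\rho_s)$ for all $[s,t]\subset[0,T]$. *)

theory Defs
  imports "HOL-Analysis.Analysis"
begin

text \<open>
  The separable metric space \<open>V\<close> is a type of class \<open>{metric_space, second_countable_topology}\<close>: a metric
  space is separable iff it is second countable, and then the Borel sigma-algebra of \<open>V \<times> V\<close> is the
  product of the Borel sigma-algebras.
\<close>

section \<open>Measures and fluxes\<close>

definition finite_borel_measures :: "'a::topological_space measure set" where
  "finite_borel_measures = {\<mu>. sets \<mu> = sets borel \<and> finite_measure \<mu>}"

definition measure_add :: "'a measure \<Rightarrow> 'a measure \<Rightarrow> 'a measure" where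
  "measure_add M N = measure_of (space M) (sets M) (\<lambda>B. emeasure M B + emeasure N B)"

text \<open>A flux is the pair of its positive and negative part, which may both have infinite mass.\<close>

type_synonym 'b flux = "'b measure \<times> 'b measure"

definition mutually_singular :: "'b measure \<Rightarrow> 'b measure \<Rightarrow> bool" where
  "mutually_singular M N \<longleftrightarrow> (\<exists>A\<in>sets M. emeasure M A = 0 \<and> emeasure N (space N - A) = 0)"

definition sigma_finite_fluxes :: "'b::topological_space flux set" where
  "sigma_finite_fluxes = {(\<mu>p, \<mu>m).
     sets \<mu>p = sets borel \<and> sets \<mu>m = sets borel \<and>
     sigma_finite_measure \<mu>p \<and> sigma_finite_measure \<mu>m \<and> mutually_singular \<mu>p \<mu>m}"

definition flux_variation :: "'b flux \<Rightarrow> 'b measure" where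
  "flux_variation \<mu> = measure_add (fst \<mu>) (snd \<mu>)"

definition flux_scale :: "ennreal \<Rightarrow> 'b flux \<Rightarrow> 'b flux" where
  "flux_scale c \<mu> = (scale_measure c (fst \<mu>), scale_measure c (snd \<mu>))"

definition set_flux_integral :: "'b flux \<Rightarrow> 'b set \<Rightarrow> ('b \<Rightarrow> real) \<Rightarrow> real" where
  "set_flux_integral \<mu> A f = (LINT z:A|fst \<mu>. f z) - (LINT z:A|snd \<mu>. f z)"

text \<open>The extended-valued \<open>RN_deriv\<close> is almost everywhere finite for sigma-finite measures, so
  \<open>enn2real\<close> loses nothing in the next two definitions.\<close>

definition density_wrt :: "'b measure \<Rightarrow> 'b measure \<Rightarrow> 'b \<Rightarrow> real" where
  "density_wrt \<gamma> \<mu> z = enn2real (RN_deriv \<gamma> \<mu> z)"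

definition flux_density :: "'b measure \<Rightarrow> 'b flux \<Rightarrow> 'b \<Rightarrow> real" where
  "flux_density \<gamma> \<mu> z = density_wrt \<gamma> (fst \<mu>) z - density_wrt \<gamma> (snd \<mu>) z"

section \<open>Jump kernels\<close>

definition offdiag :: "('a \<times> 'a) set" where
  "offdiag = {(x, y). x \<noteq> y}"

definition grad :: "('a \<Rightarrow> real) \<Rightarrow> 'a \<times> 'a \<Rightarrow> real" where
  "grad \<phi> = (\<lambda>(x, y). \<phi> y - \<phi> x)"

text \<open>\<open>\<pi>(dx) \<kappa>(x,dy)\<close>; the kernel need not consist of finite measures.\<close>

definition edge_measure ::
    "'a::topological_space measure \<Rightarrow> ('a \<Rightarrow> 'a measure) \<Rightarrow> ('a \<times> 'a) measure" where
  "edge_measure \<pi> \<kappa> =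
     measure_of UNIV (sets borel) (\<lambda>B. \<integral>\<^sup>+ x. emeasure (\<kappa> x) (Pair x -` B) \<partial>\<pi>)"

definition jump_kernel ::
    "'a::{metric_space, second_countable_topology} measure \<Rightarrow> ('a \<Rightarrow> 'a measure) \<Rightarrow> bool" where
  "jump_kernel \<pi> \<kappa> \<longleftrightarrow>
     (\<forall>x. sets (\<kappa> x) = sets borel \<and> sigma_finite_measure (\<kappa> x) \<and> emeasure (\<kappa> x) {x} = 0) \<and>
     (\<forall>f::'a \<Rightarrow> real. f \<in> borel_measurable borel \<longrightarrow> bounded (range f) \<longrightarrow>
        (\<lambda>x. LINT y|\<kappa> x. f y * min 1 ((dist x y)\<^sup>2)) \<in> borel_measurable borel) \<and>
     (SUP x. \<integral>\<^sup>+ y. ennreal (min 1 ((dist x y)\<^sup>2)) \<partial>\<kappa> x) < \<infinity> \<and>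
     distr (edge_measure \<pi> \<kappa>) borel (\<lambda>(x, y). (y, x)) = edge_measure \<pi> \<kappa>"

definition Lip_b :: "('a::metric_space \<Rightarrow> real) set" where
  "Lip_b = {\<phi>. bounded (range \<phi>) \<and> (\<exists>L. L-lipschitz_on UNIV \<phi>)}"

definition X2 ::
    "'a::topological_space measure \<Rightarrow> ('a \<Rightarrow> 'a measure) \<Rightarrow> ('a \<Rightarrow> real) set" where
  "X2 \<pi> \<kappa> = {\<phi>. \<phi> \<in> borel_measurable borel \<and> (\<exists>C. AE x in \<pi>. \<bar>\<phi> x\<bar> \<le> C) \<and>
     (\<integral>\<^sup>+ z\<in>offdiag. ennreal ((grad \<phi> z)\<^sup>2) \<partial>edge_measure \<pi> \<kappa>) < \<infinity>}"

section \<open>Density functions\<close>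

definition entropy_density :: "(real \<Rightarrow> real) \<Rightarrow> bool" where
  "entropy_density \<phi> \<longleftrightarrow>
     continuous_on {0..} \<phi> \<and> (\<forall>r>0. \<phi> differentiable (at r)) \<and> continuous_on {0<..} (deriv \<phi>) \<and>
     convex_on {0..} \<phi> \<and> (\<forall>r\<ge>0. 0 \<le> \<phi> r) \<and> (\<exists>r\<ge>0. \<phi> r = 0) \<and>
     filterlim (\<lambda>r. \<phi> r / r) at_top at_top"

definition dual_dissipation_density :: "(real \<Rightarrow> real) \<Rightarrow> bool" where
  "dual_dissipation_density \<psi>s \<longleftrightarrow>
     (\<forall>\<xi>. 0 \<le> \<psi>s \<xi>) \<and> convex_on UNIV \<psi>s \<and> (\<forall>\<xi>. \<psi>s differentiable (at \<xi>)) \<and>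
     (\<forall>\<xi>. \<psi>s (- \<xi>) = \<psi>s \<xi>) \<and> \<psi>s 0 = 0 \<and>
     filterlim (\<lambda>\<xi>. \<psi>s \<xi> / \<bar>\<xi>\<bar>) at_top at_infinity \<and>
     (\<exists>c>0. ((\<lambda>\<xi>. \<psi>s \<xi> / \<bar>\<xi>\<bar>\<^sup>2) \<longlongrightarrow> c) (at 0))"

text \<open>The supremum is finite, and nonnegative, for every dual dissipation density.\<close>

definition convex_conjugate :: "(real \<Rightarrow> real) \<Rightarrow> real \<Rightarrow> real" where
  "convex_conjugate f w = (SUP \<xi>. w * \<xi> - f \<xi>)"

definition mobility :: "(real \<Rightarrow> real \<Rightarrow> real) \<Rightarrow> bool" where
  "mobility \<alpha> \<longleftrightarrow>
     (\<forall>u\<ge>0. \<forall>v\<ge>0. 0 \<le> \<alpha> u v) \<and> (\<exists>u\<ge>0. \<exists>v\<ge>0. \<alpha> u v \<noteq> 0) \<and>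
     continuous_on ({0..} \<times> {0..}) (\<lambda>(u, v). \<alpha> u v) \<and>
     concave_on ({0..} \<times> {0..}) (\<lambda>(u, v). \<alpha> u v) \<and>
     (\<forall>u\<ge>0. \<forall>v\<ge>0. \<alpha> u v = \<alpha> v u)"

section \<open>Functionals\<close>

definition entropy ::
    "'a measure \<Rightarrow> (real \<Rightarrow> real) \<Rightarrow> 'a measure \<Rightarrow> ennreal" where
  "entropy \<pi> \<phi> \<rho> =
     (if absolutely_continuous \<pi> \<rho> then \<integral>\<^sup>+ x. ennreal (\<phi> (density_wrt \<pi> \<rho> x)) \<partial>\<pi> else \<infinity>)"

definition mobility_measure ::
    "'a::topological_space measure \<Rightarrow> ('a \<Rightarrow> 'a measure) \<Rightarrow> (real \<Rightarrow> real \<Rightarrow> real) \<Rightarrow>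
     'a measure \<Rightarrow> ('a \<times> 'a) measure" where
  "mobility_measure \<pi> \<kappa> \<alpha> \<rho> =
     density (edge_measure \<pi> \<kappa>) (\<lambda>(x, y). ennreal (\<alpha> (density_wrt \<pi> \<rho> x) (density_wrt \<pi> \<rho> y)))"

definition dissipation ::
    "'a::topological_space measure \<Rightarrow> ('a \<Rightarrow> 'a measure) \<Rightarrow> (real \<Rightarrow> real) \<Rightarrow>
     (real \<Rightarrow> real \<Rightarrow> real) \<Rightarrow> 'a measure \<Rightarrow> ('a \<times> 'a) flux \<Rightarrow> ennreal" where
  "dissipation \<pi> \<kappa> \<psi>s \<alpha> \<rho> j =
     (let \<nu> = mobility_measure \<pi> \<kappa> \<alpha> \<rho> in
      if absolutely_continuous \<nu> (flux_variation j)
      then (1/2) * (\<integral>\<^sup>+ z. ennreal (convex_conjugate \<psi>s (flux_density \<nu> (flux_scale 2 j) z)) \<partial>\<nu>)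
      else \<infinity>)"

text \<open>The derivative of \<open>\<phi>\<close> on \<open>[0,\<infinity>)\<close>; its value at \<open>0\<close> may be \<open>-\<infinity>\<close>.\<close>

definition ext_deriv :: "(real \<Rightarrow> real) \<Rightarrow> real \<Rightarrow> ereal" where
  "ext_deriv \<phi> r =
     (if r = 0 then Lim (at_right 0) (\<lambda>s. ereal (deriv \<phi> s)) else ereal (deriv \<phi> r))"

definition Lambda :: "(real \<Rightarrow> real) \<Rightarrow> real \<Rightarrow> real \<Rightarrow> ereal" where
  "Lambda \<phi> u v = (if u = 0 \<and> v = 0 then 0 else ext_deriv \<phi> v - ext_deriv \<phi> u)"

definition extend_infinity :: "(real \<Rightarrow> real) \<Rightarrow> ereal \<Rightarrow> ennreal" where
  "extend_infinity f \<xi> = (if \<bar>\<xi>\<bar> = \<infinity> then \<infinity> else ennreal (f (real_of_ereal \<xi>)))"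

text \<open>In the last branch \<open>u \<noteq> v\<close>: a mobility is concave, nonnegative and not identically zero, hence
  positive in the interior of the quadrant, so \<open>\<alpha> u v = 0\<close> and \<open>u = v\<close> force \<open>u = v = 0\<close>.\<close>

definition D_plus ::
    "(real \<Rightarrow> real) \<Rightarrow> (real \<Rightarrow> real) \<Rightarrow> (real \<Rightarrow> real \<Rightarrow> real) \<Rightarrow> real \<times> real \<Rightarrow> ennreal" where
  "D_plus \<phi> \<psi>s \<alpha> = (\<lambda>(u, v).
     if \<alpha> u v > 0 then extend_infinity \<psi>s (Lambda \<phi> u v) * ennreal (\<alpha> u v)
     else if u = 0 \<and> v = 0 then 0
     else \<infinity>)"

definition lsc_on :: "'b::topological_space set \<Rightarrow> ('b \<Rightarrow> ennreal) \<Rightarrow> bool" where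
  "lsc_on S g \<longleftrightarrow> (\<forall>p\<in>S. g p \<le> Liminf (at p within S) g)"

definition lsc_envelope_on :: "'b::topological_space set \<Rightarrow> ('b \<Rightarrow> ennreal) \<Rightarrow> 'b \<Rightarrow> ennreal" where
  "lsc_envelope_on S f p = (SUP g\<in>{g. lsc_on S g \<and> (\<forall>q\<in>S. g q \<le> f q)}. g p)"

definition fisher ::
    "'a::topological_space measure \<Rightarrow> ('a \<Rightarrow> 'a measure) \<Rightarrow> (real \<Rightarrow> real) \<Rightarrow> (real \<Rightarrow> real) \<Rightarrow>
     (real \<Rightarrow> real \<Rightarrow> real) \<Rightarrow> 'a measure \<Rightarrow> ennreal" where
  "fisher \<pi> \<kappa> \<phi> \<psi>s \<alpha> \<rho> =
     (1/2) * (\<integral>\<^sup>+ (x, y). lsc_envelope_on ({0..} \<times> {0..}) (D_plus \<phi> \<psi>s \<alpha>)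
                 (density_wrt \<pi> \<rho> x, density_wrt \<pi> \<rho> y) \<partial>edge_measure \<pi> \<kappa>)"

definition finite_entropy_measures ::
    "'a::topological_space measure \<Rightarrow> (real \<Rightarrow> real) \<Rightarrow> 'a measure set" where
  "finite_entropy_measures \<pi> \<phi> = {\<rho> \<in> finite_borel_measures. entropy \<pi> \<phi> \<rho> < \<infinity>}"

definition fisher_setwise_lsc ::
    "'a::topological_space measure \<Rightarrow> ('a \<Rightarrow> 'a measure) \<Rightarrow> (real \<Rightarrow> real) \<Rightarrow> (real \<Rightarrow> real) \<Rightarrow>
     (real \<Rightarrow> real \<Rightarrow> real) \<Rightarrow> bool" where
  "fisher_setwise_lsc \<pi> \<kappa> \<phi> \<psi>s \<alpha> \<longleftrightarrow>
     (\<forall>\<rho>n. \<forall>\<rho>\<in>finite_entropy_measures \<pi> \<phi>.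
        (\<forall>n::nat. \<rho>n n \<in> finite_entropy_measures \<pi> \<phi>) \<longrightarrow>
        (\<forall>B\<in>sets borel. (\<lambda>n. measure (\<rho>n n) B) \<longlonglongrightarrow> measure \<rho> B) \<longrightarrow>
        fisher \<pi> \<kappa> \<phi> \<psi>s \<alpha> \<rho> \<le> liminf (\<lambda>n. fisher \<pi> \<kappa> \<phi> \<psi>s \<alpha> (\<rho>n n)))"

definition fisher_convex ::
    "'a::topological_space measure \<Rightarrow> ('a \<Rightarrow> 'a measure) \<Rightarrow> (real \<Rightarrow> real) \<Rightarrow> (real \<Rightarrow> real) \<Rightarrow>
     (real \<Rightarrow> real \<Rightarrow> real) \<Rightarrow> bool" where
  "fisher_convex \<pi> \<kappa> \<phi> \<psi>s \<alpha> \<longleftrightarrow>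
     (\<forall>\<rho>\<in>finite_entropy_measures \<pi> \<phi>. \<forall>\<sigma>\<in>finite_entropy_measures \<pi> \<phi>. \<forall>\<theta>\<in>{0..1::real}.
        fisher \<pi> \<kappa> \<phi> \<psi>s \<alpha>
          (measure_add (scale_measure (ennreal (1 - \<theta>)) \<rho>) (scale_measure (ennreal \<theta>) \<sigma>))
        \<le> ennreal (1 - \<theta>) * fisher \<pi> \<kappa> \<phi> \<psi>s \<alpha> \<rho> + ennreal \<theta> * fisher \<pi> \<kappa> \<phi> \<psi>s \<alpha> \<sigma>)"

section \<open>Continuity equations\<close>

definition measurable_flux_family :: "real \<Rightarrow> (real \<Rightarrow> 'b::topological_space flux) \<Rightarrow> bool" where
  "measurable_flux_family T j \<longleftrightarrow>
     (\<forall>B\<in>sets borel.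
        (\<lambda>t. emeasure (fst (j t)) B) \<in> borel_measurable (restrict_space borel {0..T}) \<and>
        (\<lambda>t. emeasure (snd (j t)) B) \<in> borel_measurable (restrict_space borel {0..T}))"

definition continuity_identity ::
    "real \<Rightarrow> (real \<Rightarrow> 'a measure) \<Rightarrow> (real \<Rightarrow> ('a \<times> 'a) flux) \<Rightarrow> ('a \<Rightarrow> real) \<Rightarrow> bool" where
  "continuity_identity T \<rho> j \<phi> \<longleftrightarrow>
     (\<forall>s t. 0 \<le> s \<longrightarrow> s \<le> t \<longrightarrow> t \<le> T \<longrightarrow>
        (LINT x|\<rho> t. \<phi> x) - (LINT x|\<rho> s. \<phi> x) =
        (LBINT r:{s..t}. set_flux_integral (j r) offdiag (grad \<phi>)))"

definition grad_flux_integrable ::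
    "real \<Rightarrow> (real \<Rightarrow> ('a \<times> 'a) flux) \<Rightarrow> ('a \<Rightarrow> real) \<Rightarrow> bool" where
  "grad_flux_integrable T j \<phi> \<longleftrightarrow>
     (\<integral>\<^sup>+ r\<in>{0..T}. (\<integral>\<^sup>+ z\<in>offdiag. ennreal \<bar>grad \<phi> z\<bar> \<partial>flux_variation (j r)) \<partial>lborel) < \<infinity>"

definition CE ::
    "real \<Rightarrow> ((real \<Rightarrow> 'a::metric_space measure) \<times> (real \<Rightarrow> ('a \<times> 'a) flux)) set" where
  "CE T = {(\<rho>, j).
     (\<forall>t\<in>{0..T}. \<rho> t \<in> finite_borel_measures) \<and>
     (\<forall>t\<in>{0..T}. j t \<in> sigma_finite_fluxes) \<and>
     measurable_flux_family T j \<and>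
     (\<forall>t\<in>{0..T}. emeasure (flux_variation (j t)) (UNIV - offdiag) = 0) \<and>
     (\<integral>\<^sup>+ t\<in>{0..T}. (\<integral>\<^sup>+ (x, y). ennreal (min 1 (dist x y)) \<partial>flux_variation (j t)) \<partial>lborel) < \<infinity> \<and>
     (\<forall>\<phi>\<in>Lip_b. continuity_identity T \<rho> j \<phi>)}"

definition ACE ::
    "'a::metric_space measure \<Rightarrow> ('a \<Rightarrow> 'a measure) \<Rightarrow> (real \<Rightarrow> real) \<Rightarrow> (real \<Rightarrow> real) \<Rightarrow>
     (real \<Rightarrow> real \<Rightarrow> real) \<Rightarrow> real \<Rightarrow>
     ((real \<Rightarrow> 'a measure) \<times> (real \<Rightarrow> ('a \<times> 'a) flux)) set" where
  "ACE \<pi> \<kappa> \<phi> \<psi>s \<alpha> T = {(\<rho>, j). (\<rho>, j) \<in> CE T \<and>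
     (SUP t\<in>{0..T}. entropy \<pi> \<phi> (\<rho> t)) < \<infinity> \<and>
     (\<integral>\<^sup>+ t\<in>{0..T}. (dissipation \<pi> \<kappa> \<psi>s \<alpha> (\<rho> t) (j t) + fisher \<pi> \<kappa> \<phi> \<psi>s \<alpha> (\<rho> t)) \<partial>lborel) < \<infinity>}"

text \<open>\<open>u \<in> L\<^sup>\<infinity>(0,T; L\<^sup>\<infinity>(V;\<pi>))\<close> for \<open>u\<^sub>t = d\<rho>\<^sub>t/d\<pi>\<close>, which is nonnegative.\<close>

definition bounded_density :: "'a measure \<Rightarrow> real \<Rightarrow> (real \<Rightarrow> 'a measure) \<Rightarrow> bool" where
  "bounded_density \<pi> T \<rho> \<longleftrightarrow>
     (\<exists>C. AE t in lborel. t \<in> {0<..<T} \<longrightarrow> (AE x in \<pi>. density_wrt \<pi> (\<rho> t) x \<le> C))"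

text \<open>For test functions in \<open>Lip_b\<close> the integral of \<open>grad \<phi>\<close> converges absolutely by the moment bound in
  \<open>CE\<close>; for those in \<open>X2\<close> absolute convergence is part of the meaning of the identity and is therefore
  required explicitly, since Isabelle integrals of non-integrable functions are \<open>0\<close>.\<close>

definition RCE ::
    "'a::metric_space measure \<Rightarrow> ('a \<Rightarrow> 'a measure) \<Rightarrow> (real \<Rightarrow> real) \<Rightarrow> (real \<Rightarrow> real) \<Rightarrow>
     (real \<Rightarrow> real \<Rightarrow> real) \<Rightarrow> real \<Rightarrow>
     ((real \<Rightarrow> 'a measure) \<times> (real \<Rightarrow> ('a \<times> 'a) flux)) set" where
  "RCE \<pi> \<kappa> \<phi> \<psi>s \<alpha> T = {(\<rho>, j). (\<rho>, j) \<in> ACE \<pi> \<kappa> \<phi> \<psi>s \<alpha> T \<and> bounded_density \<pi> T \<rho> \<and>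
     (\<forall>\<zeta>\<in>X2 \<pi> \<kappa>. grad_flux_integrable T j \<zeta> \<and> continuity_identity T \<rho> j \<zeta>)}"

section \<open>Solutions\<close>

definition dissipative_solution ::
    "'a::metric_space measure \<Rightarrow> ('a \<Rightarrow> 'a measure) \<Rightarrow> (real \<Rightarrow> real) \<Rightarrow> (real \<Rightarrow> real) \<Rightarrow>
     (real \<Rightarrow> real \<Rightarrow> real) \<Rightarrow> real \<Rightarrow>
     (real \<Rightarrow> 'a measure) \<Rightarrow> (real \<Rightarrow> ('a \<times> 'a) flux) \<Rightarrow> bool" where
  "dissipative_solution \<pi> \<kappa> \<phi> \<psi>s \<alpha> T \<rho> j \<longleftrightarrow>
     (\<rho>, j) \<in> CE T \<and> entropy \<pi> \<phi> (\<rho> 0) < \<infinity> \<and>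
     (\<forall>t\<in>{0..T}.
        (\<integral>\<^sup>+ r\<in>{0..t}. (dissipation \<pi> \<kappa> \<psi>s \<alpha> (\<rho> r) (j r) + fisher \<pi> \<kappa> \<phi> \<psi>s \<alpha> (\<rho> r)) \<partial>lborel)
          + entropy \<pi> \<phi> (\<rho> t) \<le> entropy \<pi> \<phi> (\<rho> 0))"

definition reflecting_solution ::
    "'a::metric_space measure \<Rightarrow> ('a \<Rightarrow> 'a measure) \<Rightarrow> (real \<Rightarrow> real) \<Rightarrow> (real \<Rightarrow> real) \<Rightarrow>
     (real \<Rightarrow> real \<Rightarrow> real) \<Rightarrow> real \<Rightarrow>
     (real \<Rightarrow> 'a measure) \<Rightarrow> (real \<Rightarrow> ('a \<times> 'a) flux) \<Rightarrow> bool" where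
  "reflecting_solution \<pi> \<kappa> \<phi> \<psi>s \<alpha> T \<rho> j \<longleftrightarrow>
     (\<rho>, j) \<in> RCE \<pi> \<kappa> \<phi> \<psi>s \<alpha> T \<and> entropy \<pi> \<phi> (\<rho> 0) < \<infinity> \<and>
     (\<forall>s t. 0 \<le> s \<longrightarrow> s \<le> t \<longrightarrow> t \<le> T \<longrightarrow>
        (\<integral>\<^sup>+ r\<in>{s..t}. (dissipation \<pi> \<kappa> \<psi>s \<alpha> (\<rho> r) (j r) + fisher \<pi> \<kappa> \<phi> \<psi>s \<alpha> (\<rho> r)) \<partial>lborel)
          + entropy \<pi> \<phi> (\<rho> t) = entropy \<pi> \<phi> (\<rho> s))"

end

theory Submission
  imports Defs
begin

text \<open>
  The energy identity follows from the dissipation inequality and the chain rule inequality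
  \<open>\<E>(\<rho>\<^sub>a) - \<E>(\<rho>\<^sub>b) \<le> \<integral>\<^sub>a\<^sup>b (\<R> + \<D>)\<close>. Bounded densities and the continuity equation make \<open>t \<mapsto> \<rho>\<^sub>t\<close>
  setwise continuous, and Young's inequality together with the approximation hypothesis extends the
  continuity equation to \<open>\<X>\<^sub>2\<close>. For the chain rule, replace the density \<open>u\<close> by \<open>v = (1 - \<delta>) u + \<delta>\<close>;
  convexity of the Fisher information shows that this does not increase it, and
  \<open>\<zeta>\<^sub>s = \<phi>'(v\<^sub>s)\<close> becomes an admissible test function whenever \<open>\<D>(\<rho>\<^sub>s)\<close> is finite. Convexity of
  \<open>\<phi>\<close> and Young's inequality give, for \<open>r > s\<close>,
  \<open>\<E>(v\<^sub>r) - \<E>(v\<^sub>s) \<ge> - \<integral>\<^sub>s\<^sup>r (\<R> + m(s, r')) dr'\<close> with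
  \<open>m(s, r) = 1/2 \<integral> \<psi>\<^sup>*(grad \<zeta>\<^sub>s) \<alpha>(v\<^sub>r, v\<^sub>r)\<close>. The term \<open>m(s, r)\<close> is at most a constant times \<open>\<D>(\<rho>\<^sub>s)\<close>,
  and concavity of \<open>\<alpha>\<close> gives \<open>limsup m(s, r) \<le> \<D>(\<rho>\<^sub>s)\<close> as \<open>r \<rightarrow> s\<close>, so Fatou's lemma for the
  difference quotients yields the chain rule inequality for \<open>v\<close>; finally \<open>\<delta> \<rightarrow> 0\<close>.
\<close>

section \<open>Measures and lower integrals\<close>

text \<open>Two gaps in regularity shape the proof. The dissipation is not known to be measurable in
  time, so its time integral is a lower integral. It is replaced by a measurable minorant
  \<open>Q\<close> with the same integral, which almost everywhere dominates every measurable
  minorant; Young's inequality is therefore always rearranged so that the dissipation stands alone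
  above a measurable quantity. Lower integrals are superadditive, and this is the direction in which
  both halves of the energy identity use them. The density is continuous in time only against fixed
  integrable functions, so the entropy need not be differentiable along the curve and the mobility
  need not converge. Both enter through one-sided bounds, by convexity of \<phi> and concavity of
  \<alpha>. The primitive of \<open>Q\<close> is added to the entropy before difference quotients
  are formed, so no pointwise limit of the dissipation is needed and only m(s, r) has to be
  controlled near r = s. The mixture with \<pi> bounds the mobility below: this makes the gradient
  of the test function square integrable on edges, and it is the source of the integrable minorant
  in Fatou's lemma.\<close>

lemma space_measure_add [simp]: "space (measure_add M N) = space M"
  by (simp add: measure_add_def space_measure_of_conv)

lemma sets_measure_add [simp, measurable_cong]: "sets (measure_add M N) = sets M"
  by (simp add: measure_add_def)

lemma emeasure_measure_add:
  assumes "sets N = sets M" "A \<in> sets M"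
  shows "emeasure (measure_add M N) A = emeasure M A + emeasure N A"
  unfolding measure_add_def
proof (rule emeasure_measure_of_sigma)
  show "sigma_algebra (space M) (sets M)" ..
  show "positive (sets M) (\<lambda>B. emeasure M B + emeasure N B)"
    by (simp add: positive_def)
  show "countably_additive (sets M) (\<lambda>B. emeasure M B + emeasure N B)"
  proof (rule countably_additiveI)
    fix A :: "nat \<Rightarrow> 'a set" assume A: "range A \<subseteq> sets M" "disjoint_family A"
    have "(\<Sum>i. emeasure M (A i) + emeasure N (A i)) = (\<Sum>i. emeasure M (A i)) + (\<Sum>i. emeasure N (A i))"
      by (intro suminf_add[symmetric]) auto
    then show "(\<Sum>i. emeasure M (A i) + emeasure N (A i)) =
        emeasure M (\<Union>i. A i) + emeasure N (\<Union>i. A i)"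
      using A assms(1) by (simp add: suminf_emeasure)
  qed
qed (use assms in auto)

lemma nn_integral_measure_add:
  assumes N: "sets N = sets M" and f: "f \<in> borel_measurable M"
  shows "(\<integral>\<^sup>+x. f x \<partial>measure_add M N) = (\<integral>\<^sup>+x. f x \<partial>M) + (\<integral>\<^sup>+x. f x \<partial>N)"
  using f
proof (induction rule: borel_measurable_induct)
  case (cong f g)
  moreover have "space N = space M" using sets_eq_imp_space_eq[OF N] .
  ultimately have "integral\<^sup>N (measure_add M N) f = integral\<^sup>N (measure_add M N) g"
    "integral\<^sup>N M f = integral\<^sup>N M g" "integral\<^sup>N N f = integral\<^sup>N N g"
    using cong(3) by (intro nn_integral_cong; simp)+
  with cong(4) show ?case by simp
next
  case (set A)
  then show ?case using N by (simp add: emeasure_measure_add)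
next
  case (mult u c)
  have "u \<in> borel_measurable N" using mult N by (simp cong: measurable_cong_sets)
  moreover have "u \<in> borel_measurable (measure_add M N)" using mult by (simp cong: measurable_cong_sets)
  ultimately show ?case using mult by (simp add: nn_integral_cmult distrib_left)
next
  case (add u v)
  have [measurable]: "u \<in> borel_measurable N" "v \<in> borel_measurable N"
    "u \<in> borel_measurable (measure_add M N)" "v \<in> borel_measurable (measure_add M N)"
    "u \<in> borel_measurable M" "v \<in> borel_measurable M"
    using add N by (simp_all cong: measurable_cong_sets)
  show ?case using add by (simp add: nn_integral_add ac_simps)
next
  case (seq U)
  have m: "\<And>i. U i \<in> borel_measurable M" "\<And>i. U i \<in> borel_measurable N"
     "\<And>i. U i \<in> borel_measurable (measure_add M N)"
    using seq N by (simp_all cong: measurable_cong_sets)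
  have inc: "incseq (\<lambda>i. integral\<^sup>N M (U i))" "incseq (\<lambda>i. integral\<^sup>N N (U i))"
    using seq by (auto simp: incseq_def le_fun_def intro!: nn_integral_mono)
  have SU: "Sup (range U) = (\<lambda>x. SUP i. U i x)" by (simp add: fun_eq_iff image_comp)
  have "integral\<^sup>N (measure_add M N) (SUP i. U i) = (SUP i. integral\<^sup>N (measure_add M N) (U i))"
    using nn_integral_monotone_convergence_SUP[OF \<open>incseq U\<close> m(3)] by (simp add: SU)
  also have "\<dots> = (SUP i. integral\<^sup>N M (U i) + integral\<^sup>N N (U i))"
    using seq by simp
  also have "\<dots> = (SUP i. integral\<^sup>N M (U i)) + (SUP i. integral\<^sup>N N (U i))"
    by (rule ennreal_SUP_add[OF inc])
  also have "\<dots> = integral\<^sup>N M (SUP i. U i) + integral\<^sup>N N (SUP i. U i)"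
    using nn_integral_monotone_convergence_SUP[OF \<open>incseq U\<close> m(1)]
      nn_integral_monotone_convergence_SUP[OF \<open>incseq U\<close> m(2)] by (simp add: SU)
  finally show ?case .
qed

section \<open>Integrals that depend measurably on a parameter\<close>

text \<open>Induction on the integrand: \<open>fam\<close> settles indicators, and measurability in
  t survives sums, multiples and increasing limits. The measures may have infinite mass, so the
  argument stays with nonnegative functions.\<close>

lemma borel_measurable_nn_integral_family:
  fixes M :: "'s \<Rightarrow> 'b measure"
  assumes sets: "\<And>t. t \<in> space S \<Longrightarrow> sets (M t) = sets N"
    and fam: "\<And>B. B \<in> sets N \<Longrightarrow> (\<lambda>t. emeasure (M t) B) \<in> borel_measurable S"
    and f: "f \<in> borel_measurable N"
  shows "(\<lambda>t. \<integral>\<^sup>+x. f x \<partial>M t) \<in> borel_measurable S"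
  using f
proof (induction rule: borel_measurable_induct)
  case (cong f g)
  have "(\<integral>\<^sup>+x. f x \<partial>M t) = (\<integral>\<^sup>+x. g x \<partial>M t)" if "t \<in> space S" for t
    using cong sets_eq_imp_space_eq[OF sets[OF that]] by (intro nn_integral_cong) simp
  with cong show ?case by (simp cong: measurable_cong)
next
  case (set A)
  have "(\<lambda>t. \<integral>\<^sup>+x. indicator A x \<partial>M t) \<in> borel_measurable S \<longleftrightarrow> (\<lambda>t. emeasure (M t) A) \<in> borel_measurable S"
    using set sets by (intro measurable_cong) simp
  with fam set show ?case by simp
next
  case (mult u c)
  have "(\<lambda>t. \<integral>\<^sup>+x. c * u x \<partial>M t) \<in> borel_measurable S \<longleftrightarrow> (\<lambda>t. c * (\<integral>\<^sup>+x. u x \<partial>M t)) \<in> borel_measurable S"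
    using mult sets by (intro measurable_cong nn_integral_cmult) (simp cong: measurable_cong_sets)
  with mult show ?case by simp
next
  case (add u v)
  have "(\<lambda>t. \<integral>\<^sup>+x. v x + u x \<partial>M t) \<in> borel_measurable S \<longleftrightarrow>
      (\<lambda>t. (\<integral>\<^sup>+x. v x \<partial>M t) + (\<integral>\<^sup>+x. u x \<partial>M t)) \<in> borel_measurable S"
    using add sets by (intro measurable_cong nn_integral_add) (simp_all cong: measurable_cong_sets)
  with add show ?case by simp
next
  case (seq U)
  have "(\<integral>\<^sup>+x. (SUP i. U i) x \<partial>M t) = (SUP i. \<integral>\<^sup>+x. U i x \<partial>M t)" if "t \<in> space S" for t
    using nn_integral_monotone_convergence_SUP[OF \<open>incseq U\<close>, of "M t"] \<open>\<And>i. U i \<in> borel_measurable N\<close> sets[OF that]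
    by (simp add: image_comp cong: measurable_cong_sets)
  then have "(\<lambda>t. \<integral>\<^sup>+x. (SUP i. U i) x \<partial>M t) \<in> borel_measurable S \<longleftrightarrow>
      (\<lambda>t. SUP i. \<integral>\<^sup>+x. U i x \<partial>M t) \<in> borel_measurable S"
    by (intro measurable_cong)
  with seq show ?case by simp
qed

text \<open>The Bochner integral is 0 in the non-integrable case. Spelling this out reduces its
  dependence on a parameter to that of three nonnegative integrals.\<close>

lemma integral_eq_nn_integral_if:
  fixes f :: "'b \<Rightarrow> real"
  assumes "f \<in> borel_measurable M"
  shows "(LINT x|M. f x) = (if (\<integral>\<^sup>+x. ennreal \<bar>f x\<bar> \<partial>M) < \<infinity>
    then enn2real (\<integral>\<^sup>+x. ennreal (f x) \<partial>M) - enn2real (\<integral>\<^sup>+x. ennreal (- f x) \<partial>M) else 0)"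
proof (cases "integrable M f")
  case True
  then show ?thesis
    by (simp add: real_lebesgue_integral_def integrable_iff_bounded)
next
  case False
  then show ?thesis
    using assms by (simp add: not_integrable_integral_eq integrable_iff_bounded)
qed

lemma borel_measurable_lebesgue_integral_family:
  fixes M :: "'s \<Rightarrow> 'b measure" and f :: "'b \<Rightarrow> real"
  assumes sets: "\<And>t. t \<in> space S \<Longrightarrow> sets (M t) = sets N"
    and fam: "\<And>B. B \<in> sets N \<Longrightarrow> (\<lambda>t. emeasure (M t) B) \<in> borel_measurable S"
    and f: "f \<in> borel_measurable N"
  shows "(\<lambda>t. LINT x|M t. f x) \<in> borel_measurable S"
proof -
  note m = borel_measurable_nn_integral_family[where M = M, OF sets fam]
  have [measurable]: "(\<lambda>t. \<integral>\<^sup>+x. ennreal \<bar>f x\<bar> \<partial>M t) \<in> borel_measurable S"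
    "(\<lambda>t. \<integral>\<^sup>+x. ennreal (f x) \<partial>M t) \<in> borel_measurable S"
    "(\<lambda>t. \<integral>\<^sup>+x. ennreal (- f x) \<partial>M t) \<in> borel_measurable S"
    using f by (auto intro!: m)
  have "(\<lambda>t. LINT x|M t. f x) \<in> borel_measurable S \<longleftrightarrow>
    (\<lambda>t. if (\<integral>\<^sup>+x. ennreal \<bar>f x\<bar> \<partial>M t) < \<infinity>
    then enn2real (\<integral>\<^sup>+x. ennreal (f x) \<partial>M t) - enn2real (\<integral>\<^sup>+x. ennreal (- f x) \<partial>M t) else 0)
      \<in> borel_measurable S"
    using f sets by (intro measurable_cong integral_eq_nn_integral_if) (simp cong: measurable_cong_sets)
  then show ?thesis by simp
qed

text \<open>In the non-integrable case the left side is 0 by the default value of the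
  integral.\<close>

lemma ennreal_abs_integral_le:
  fixes f :: "'b \<Rightarrow> real"
  shows "ennreal \<bar>LINT x|M. f x\<bar> \<le> (\<integral>\<^sup>+x. ennreal \<bar>f x\<bar> \<partial>M)"
proof (cases "integrable M f")
  case True
  then show ?thesis using integral_norm_bound_ennreal[of M f] by simp
next
  case False
  then show ?thesis by (simp add: not_integrable_integral_eq)
qed

text \<open>No measurability of \<open>f\<close> here: \<open>integral\<^sup>N M f\<close> is then the lower integral.\<close>

lemma measurable_lower_envelope:
  obtains Q where "Q \<in> borel_measurable M" "Q \<le> f" "integral\<^sup>N M Q = integral\<^sup>N M f"
proof -
  let ?G = "{g. simple_function M g \<and> g \<le> f}"
  have "?G \<noteq> {}" by (auto intro!: exI[of _ "\<lambda>_. 0"] simp: le_fun_def)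
  \<comment> \<open>The supremum over all simple minorants is reached along a sequence, and the
    pointwise supremum of a sequence is measurable.\<close>
  from ennreal_SUP_countable_SUP[OF this, of "integral\<^sup>S M"]
  obtain g where g: "range g \<subseteq> integral\<^sup>S M ` ?G" and sup: "(SUP h\<in>?G. integral\<^sup>S M h) = (SUP i::nat. g i)"
    by auto
  from g have "\<forall>i. \<exists>h. h \<in> ?G \<and> g i = integral\<^sup>S M h" by (auto simp: image_iff subset_iff)
  then obtain h where h: "\<And>i. h i \<in> ?G" "\<And>i. g i = integral\<^sup>S M (h i)" by metis
  define Q where "Q x = (SUP i. h i x)" for x
  show ?thesis
  proof
    have "\<And>i. h i \<in> borel_measurable M" using h(1) by (auto intro: borel_measurable_simple_function)
    then show Q: "Q \<in> borel_measurable M" unfolding Q_def by simp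
    show le: "Q \<le> f" using h(1) by (auto simp: Q_def le_fun_def intro!: SUP_least)
    have "integral\<^sup>N M f = (SUP i. g i)" unfolding nn_integral_def using sup by (simp add: image_def)
    also have "\<dots> \<le> integral\<^sup>N M Q"
    proof (rule SUP_least)
      fix i
      have "g i = integral\<^sup>N M (h i)" using h by (simp add: nn_integral_eq_simple_integral)
      also have "\<dots> \<le> integral\<^sup>N M Q" by (intro nn_integral_mono) (auto simp: Q_def intro: SUP_upper)
      finally show "g i \<le> integral\<^sup>N M Q" .
    qed
    finally have "integral\<^sup>N M f \<le> integral\<^sup>N M Q" .
    moreover have "integral\<^sup>N M Q \<le> integral\<^sup>N M f"
      using le by (intro nn_integral_mono) (auto simp: le_fun_def)
    ultimately show "integral\<^sup>N M Q = integral\<^sup>N M f" by simp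
  qed
qed

text \<open>Otherwise the maximum of \<open>l\<close> and \<open>Q\<close> would be a measurable
  minorant of \<open>f\<close> with a strictly larger integral; finiteness of the integral makes the
  difference meaningful.\<close>

lemma lower_envelope_maximal:
  assumes Q: "Q \<in> borel_measurable M" "Q \<le> f" "integral\<^sup>N M Q = integral\<^sup>N M f" "integral\<^sup>N M f < \<infinity>"
    and l: "l \<in> borel_measurable M" "\<And>x. x \<in> space M \<Longrightarrow> l x \<le> f x"
  shows "AE x in M. l x \<le> Q x"
proof -
  have "(\<integral>\<^sup>+x. max (l x) (Q x) \<partial>M) \<le> integral\<^sup>N M f"
    using Q(2) l(2) by (intro nn_integral_mono) (auto simp: le_fun_def)
  then have "(\<integral>\<^sup>+x. max (l x) (Q x) - Q x \<partial>M) = 0"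
    using Q l by (subst nn_integral_diff) (auto simp: less_top intro: diff_eq_0_ennreal)
  then have "AE x in M. max (l x) (Q x) - Q x = 0"
    using Q(1) l(1) by (subst (asm) nn_integral_0_iff_AE) auto
  moreover have "AE x in M. Q x \<noteq> \<infinity>"
    using Q by (intro nn_integral_PInf_AE) auto
  ultimately show ?thesis
    by eventually_elim (auto simp: ennreal_minus_eq_0 max_def split: if_splits)
qed

text \<open>Measurable minorants of \<open>f\<close> and \<open>g\<close> add up to a measurable
  minorant of \<open>h\<close>.\<close>

lemma nn_integral_superadditive:
  fixes f g h :: "'a \<Rightarrow> ennreal"
  assumes "\<And>x. x \<in> space M \<Longrightarrow> f x + g x \<le> h x"
  shows "integral\<^sup>N M f + integral\<^sup>N M g \<le> integral\<^sup>N M h"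
proof -
  obtain F where F: "F \<in> borel_measurable M" "F \<le> f" "integral\<^sup>N M F = integral\<^sup>N M f"
    by (rule measurable_lower_envelope)
  obtain G where G: "G \<in> borel_measurable M" "G \<le> g" "integral\<^sup>N M G = integral\<^sup>N M g"
    by (rule measurable_lower_envelope)
  have "integral\<^sup>N M f + integral\<^sup>N M g = (\<integral>\<^sup>+x. F x + G x \<partial>M)"
    using F G by (simp add: nn_integral_add)
  also have "\<dots> \<le> integral\<^sup>N M h"
    using F(2) G(2) assms by (intro nn_integral_mono) (meson add_mono le_funD order_trans)
  finally show ?thesis .
qed

text \<open>Sublevel sets in \<open>S\<close> are closed. The Fisher information and the mixed
  entropy become measurable in time this way.\<close>

lemma seq_lsc_imp_borel_measurable:
  fixes f :: "'a::metric_space \<Rightarrow> 'b::{complete_linorder, second_countable_topology, linorder_topology}"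
  assumes S: "closed S"
    and lsc: "\<And>t x. t \<in> S \<Longrightarrow> (\<And>n. x n \<in> S) \<Longrightarrow> x \<longlonglongrightarrow> t \<Longrightarrow> f t \<le> liminf (\<lambda>n. f (x n))"
  shows "f \<in> borel_measurable (restrict_space borel S)"
proof (rule borel_measurableI_le)
  fix c
  have "closed {t \<in> S. f t \<le> c}"
    unfolding closed_sequential_limits
  proof safe
    fix x t assume x: "\<forall>n. x n \<in> {t \<in> S. f t \<le> c}" and lim: "x \<longlonglongrightarrow> t"
    show t: "t \<in> S" using S x lim by (auto simp: closed_sequential_limits)
    have "f t \<le> liminf (\<lambda>n. f (x n))" using x lim t by (intro lsc) auto
    also have "\<dots> \<le> limsup (\<lambda>n. f (x n))" by (intro Liminf_le_Limsup) simp
    also have "\<dots> \<le> c" using x by (intro Limsup_bounded) auto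
    finally show "f t \<le> c" .
  qed
  moreover have "{t \<in> space (restrict_space borel S). f t \<le> c} = {t \<in> S. f t \<le> c}"
    by (auto simp: space_restrict_space)
  ultimately show "{t \<in> space (restrict_space borel S). f t \<le> c} \<in> sets (restrict_space borel S)"
    using S by (auto simp: sets_restrict_space image_iff intro!: bexI[of _ "{t \<in> S. f t \<le> c}"])
qed

section \<open>The edge measure\<close>

locale jump_space =
  fixes \<pi> :: "'a::{metric_space, second_countable_topology} measure"
    and \<kappa> :: "'a \<Rightarrow> 'a measure"
  assumes pi_borel: "\<pi> \<in> finite_borel_measures"
    and kernel: "jump_kernel \<pi> \<kappa>"
begin

abbreviation edges :: "('a \<times> 'a) measure" where
  "edges \<equiv> edge_measure \<pi> \<kappa>"

lemma sets_pi [simp, measurable_cong]: "sets \<pi> = sets borel"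
  using pi_borel by (simp add: finite_borel_measures_def)

lemma space_pi [simp]: "space \<pi> = UNIV"
  using sets_eq_imp_space_eq[OF sets_pi] by simp

sublocale pi: finite_measure \<pi>
  using pi_borel by (simp add: finite_borel_measures_def)

lemma sets_kappa [simp, measurable_cong]: "sets (\<kappa> x) = sets borel"
  using kernel by (simp add: jump_kernel_def)

lemma space_kappa [simp]: "space (\<kappa> x) = UNIV"
  using sets_eq_imp_space_eq[OF sets_kappa] by simp

section \<open>Measurability of the kernel through a finite truncation\<close>

text \<open>The weight is the one whose integral the kernel hypothesis bounds. It makes the measure
  finite and is positive away from x, so measurability can be proved here and carried back to
  \<open>\<kappa>\<close>.\<close>

definition truncated_kernel :: "'a \<Rightarrow> 'a measure" where
  "truncated_kernel x = density (\<kappa> x) (\<lambda>y. ennreal (min 1 ((dist x y)\<^sup>2)))"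

lemma sets_truncated_kernel [simp, measurable_cong]: "sets (truncated_kernel x) = sets borel"
  by (simp add: truncated_kernel_def)

lemma space_truncated_kernel [simp]: "space (truncated_kernel x) = UNIV"
  by (simp add: truncated_kernel_def)

lemma truncated_kernel_bounded:
  "\<exists>C<\<infinity>. \<forall>x. (\<integral>\<^sup>+y. ennreal (min 1 ((dist x y)\<^sup>2)) \<partial>\<kappa> x) \<le> C"
  using kernel unfolding jump_kernel_def
  by (intro exI[of _ "SUP x. \<integral>\<^sup>+ y. ennreal (min 1 ((dist x y)\<^sup>2)) \<partial>\<kappa> x"]) (auto intro: SUP_upper)

lemma finite_truncated_kernel: "finite_measure (truncated_kernel x)"
proof (rule finite_measureI)
  obtain C where "C < \<infinity>" "(\<integral>\<^sup>+y. ennreal (min 1 ((dist x y)\<^sup>2)) \<partial>\<kappa> x) \<le> C"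
    using truncated_kernel_bounded by blast
  then show "emeasure (truncated_kernel x) (space (truncated_kernel x)) \<noteq> \<infinity>"
    by (auto simp: truncated_kernel_def emeasure_density)
qed

text \<open>Dynkin argument over measurable rectangles. Complements require subtracting measures,
  which is where finiteness of the truncated kernel enters.\<close>

lemma measurable_truncated_kernel_section:
  assumes "B \<in> sets borel"
  shows "(\<lambda>x. emeasure (truncated_kernel x) (Pair x -` B)) \<in> borel_measurable borel"
proof -
  let ?G = "{a \<times> b |a b. a \<in> sets (borel::'a measure) \<and> b \<in> sets (borel::'a measure)}"
  have sec [measurable]: "Pair x -` A \<in> sets borel" if "A \<in> sets borel" for A :: "('a \<times> 'a) set" and x
    using measurable_sets_borel[of "Pair x" borel A] that by (auto intro!: borel_measurable_continuous_onI continuous_intros)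
  have sets_eq: "sigma_sets UNIV ?G = sets (borel :: ('a \<times> 'a) measure)"
    unfolding borel_prod[symmetric] sets_pair_measure by simp
  have fam: "(\<lambda>x. emeasure (truncated_kernel x) A) \<in> borel_measurable borel" if [measurable]: "A \<in> sets borel" for A
  proof -
    \<comment> \<open>The kernel hypothesis speaks of Bochner integrals; finiteness identifies them
      with the measure of \<open>A\<close>.\<close>
    have "emeasure (truncated_kernel x) A = ennreal (LINT y|\<kappa> x. indicator A y * min 1 ((dist x y)\<^sup>2))" for x
    proof -
      have "emeasure (truncated_kernel x) A = (\<integral>\<^sup>+y. ennreal (indicator A y * min 1 ((dist x y)\<^sup>2)) \<partial>\<kappa> x)"
        unfolding truncated_kernel_def
        by (subst emeasure_density) (auto intro!: nn_integral_cong split: split_indicator)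
      moreover have "emeasure (truncated_kernel x) A < \<infinity>"
        using finite_measure.emeasure_finite[OF finite_truncated_kernel] by (simp add: less_top)
      ultimately show ?thesis
        by (subst nn_integral_eq_integral[symmetric])
          (auto simp: integrable_iff_bounded abs_mult)
    qed
    moreover have "bounded (range (indicator A :: 'a \<Rightarrow> real))"
      by (auto simp: bounded_iff intro!: exI[of _ 1] split: split_indicator)
    ultimately show ?thesis
      using kernel unfolding jump_kernel_def by (auto dest: spec[of _ "indicator A"])
  qed
  have "B \<in> sigma_sets UNIV ?G" using assms sets_eq by simp
  moreover have "Int_stable ?G"
    using Int_stable_pair_measure_generator[of "borel::'a measure" "borel::'a measure"] by simp
  moreover have "?G \<subseteq> Pow UNIV" by simp
  ultimately have "Int_stable ?G" "?G \<subseteq> Pow UNIV" "B \<in> sigma_sets UNIV ?G" by auto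
  then show ?thesis
  proof (induction rule: sigma_sets_induct_disjoint)
    case (basic A)
    then obtain a b where A: "A = a \<times> b" "a \<in> sets borel" "b \<in> sets borel" by auto
    have "emeasure (truncated_kernel x) (Pair x -` A) = indicator a x * emeasure (truncated_kernel x) b" for x
      unfolding A by (auto split: split_indicator)
    then show ?case using fam[OF A(3)] A(2) by simp
  next
    case empty
    then show ?case by simp
  next
    case (compl A)
    have "A \<in> sets borel" using compl(1) sets_eq by simp
    have "emeasure (truncated_kernel x) (Pair x -` (UNIV - A)) =
        emeasure (truncated_kernel x) UNIV - emeasure (truncated_kernel x) (Pair x -` A)" for x
      unfolding vimage_Diff
      using finite_measure.emeasure_finite[OF finite_truncated_kernel] sec[OF \<open>A \<in> sets borel\<close>]
      by (subst emeasure_Diff) (auto simp: truncated_kernel_def)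
    then show ?case using compl(2) fam[of UNIV] by simp
  next
    case (union A)
    have A: "\<And>i. A i \<in> sets borel" using union(2) sets_eq by auto
    have "emeasure (truncated_kernel x) (Pair x -` \<Union>(range A)) =
        (\<Sum>i. emeasure (truncated_kernel x) (Pair x -` A i))" for x
      unfolding vimage_UN using union(1) sec[OF A]
      by (intro suminf_emeasure[symmetric]) (auto simp: disjoint_family_on_def)
    then show ?case using union(3) by simp
  qed
qed

lemma measurable_Pair_borel [measurable]: "Pair x \<in> borel_measurable (borel :: 'a measure)"
  by (intro borel_measurable_continuous_onI continuous_intros)

lemma borel_measurable_fst_snd [measurable]:
  "fst \<in> borel_measurable (borel :: ('a \<times> 'a) measure)"
  "snd \<in> borel_measurable (borel :: ('a \<times> 'a) measure)"
  by (intro borel_measurable_continuous_onI continuous_intros)+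

text \<open>The weight vanishes only at y = x, a null point of \<open>\<kappa> x\<close>, so
  dividing by it undoes the truncation almost everywhere.\<close>

lemma nn_integral_kernel_eq_truncated:
  assumes f: "f \<in> borel_measurable borel"
  shows "(\<integral>\<^sup>+y. f (x, y) \<partial>\<kappa> x) =
    (\<integral>\<^sup>+y. f (x, y) * ennreal (1 / min 1 ((dist x y)\<^sup>2)) \<partial>truncated_kernel x)"
proof -
  have [measurable]: "(\<lambda>y. f (x, y)) \<in> borel_measurable borel"
    using measurable_compose[OF measurable_Pair_borel f] by simp
  have "AE y in \<kappa> x. y \<noteq> x"
  proof (rule AE_I)
    show "{y \<in> space (\<kappa> x). \<not> y \<noteq> x} \<subseteq> {x}" by auto
  qed (use kernel in \<open>auto simp: jump_kernel_def\<close>)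
  then have "AE y in \<kappa> x. f (x, y) =
      ennreal (min 1 ((dist x y)\<^sup>2)) * (f (x, y) * ennreal (1 / min 1 ((dist x y)\<^sup>2)))"
  proof eventually_elim
    case (elim y)
    then have "0 < min 1 ((dist x y)\<^sup>2)" by simp
    then have "ennreal (min 1 ((dist x y)\<^sup>2)) * ennreal (1 / min 1 ((dist x y)\<^sup>2)) = 1"
      by (simp add: ennreal_mult[symmetric] del: min_less_iff_conj)
    then show ?case by (simp add: mult.left_commute)
  qed
  then show ?thesis
    unfolding truncated_kernel_def by (subst nn_integral_density) (auto intro!: nn_integral_cong_AE)
qed

lemma borel_measurable_nn_integral_kernel [measurable]:
  assumes f [measurable]: "f \<in> borel_measurable borel"
  shows "(\<lambda>x. \<integral>\<^sup>+y. f (x, y) \<partial>\<kappa> x) \<in> borel_measurable borel"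
proof -
  define g :: "'a \<times> 'a \<Rightarrow> ennreal"
    where "g z = f z * ennreal (1 / min 1 ((dist (fst z) (snd z))\<^sup>2))" for z
  have [measurable]: "g \<in> borel_measurable borel"
    unfolding g_def by measurable
  \<comment> \<open>Pushing forward under \<open>Pair x\<close> makes the integrand independent of
    x, as the lemma on families of measures requires.\<close>
  have "(\<lambda>x. \<integral>\<^sup>+z. g z \<partial>distr (truncated_kernel x) borel (Pair x)) \<in> borel_measurable borel"
    by (intro borel_measurable_nn_integral_family[where N = borel])
       (auto simp: emeasure_distr intro: measurable_truncated_kernel_section)
  moreover have "(\<integral>\<^sup>+z. g z \<partial>distr (truncated_kernel x) borel (Pair x)) = (\<integral>\<^sup>+y. f (x, y) \<partial>\<kappa> x)" for x
    by (subst nn_integral_distr) (auto simp: nn_integral_kernel_eq_truncated[OF f] g_def)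
  ultimately show ?thesis by simp
qed

section \<open>The measure on edges: iterated integrals, symmetry, sigma-finiteness\<close>

lemma sets_edges [simp, measurable_cong]: "sets edges = sets borel"
  unfolding edge_measure_def using sets.space_closed[of borel] sets.sigma_sets_eq[of borel] by simp

lemma space_edges [simp]: "space edges = UNIV"
  by (simp add: edge_measure_def space_measure_of_conv)

text \<open>\<open>measure_of\<close> takes the prescribed values only if they are countably
  additive, and exchanging the sum with the integral over \<open>\<pi>\<close> needs sections that
  are measurable in x.\<close>

lemma emeasure_edges:
  assumes "B \<in> sets borel"
  shows "emeasure edges B = (\<integral>\<^sup>+x. (\<integral>\<^sup>+y. indicator B (x, y) \<partial>\<kappa> x) \<partial>\<pi>)"
proof -
  have sec: "Pair x -` A \<in> sets borel" if "A \<in> sets borel" for A :: "('a \<times> 'a) set" and x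
    using measurable_sets_borel[of "Pair x" borel A] that by auto
  have eq: "emeasure (\<kappa> x) (Pair x -` A) = (\<integral>\<^sup>+y. indicator A (x, y) \<partial>\<kappa> x)" if "A \<in> sets borel" for x A
  proof -
    have "(\<integral>\<^sup>+y. indicator A (x, y) \<partial>\<kappa> x) = (\<integral>\<^sup>+y. indicator (Pair x -` A) y \<partial>\<kappa> x)"
      by (intro nn_integral_cong) (auto split: split_indicator)
    then show ?thesis using sec[OF that] by simp
  qed
  have "emeasure edges B = (\<integral>\<^sup>+x. emeasure (\<kappa> x) (Pair x -` B) \<partial>\<pi>)"
    unfolding edge_measure_def
  proof (rule emeasure_measure_of_sigma)
    show "sigma_algebra UNIV (sets (borel :: ('a \<times> 'a) measure))"
      using sets.sigma_algebra_axioms[of "borel :: ('a \<times> 'a) measure"] by simp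
    show "countably_additive (sets borel) (\<lambda>B. \<integral>\<^sup>+x. emeasure (\<kappa> x) (Pair x -` B) \<partial>\<pi>)"
    proof (rule countably_additiveI)
      fix A :: "nat \<Rightarrow> ('a \<times> 'a) set" assume A: "range A \<subseteq> sets borel" "disjoint_family A"
      have [measurable]: "(\<lambda>x. emeasure (\<kappa> x) (Pair x -` A i)) \<in> borel_measurable borel" for i
        using A(1) borel_measurable_nn_integral_kernel[of "indicator (A i)"] by (auto simp: eq)
      have "(\<Sum>i. \<integral>\<^sup>+x. emeasure (\<kappa> x) (Pair x -` A i) \<partial>\<pi>) = (\<integral>\<^sup>+x. (\<Sum>i. emeasure (\<kappa> x) (Pair x -` A i)) \<partial>\<pi>)"
        by (intro nn_integral_suminf[symmetric]) simp
      also have "\<dots> = (\<integral>\<^sup>+x. emeasure (\<kappa> x) (Pair x -` (\<Union>i. A i)) \<partial>\<pi>)"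
        unfolding vimage_UN using A sec
        by (intro nn_integral_cong suminf_emeasure) (auto simp: disjoint_family_on_def)
      finally show "(\<Sum>i. \<integral>\<^sup>+x. emeasure (\<kappa> x) (Pair x -` A i) \<partial>\<pi>) =
        (\<integral>\<^sup>+x. emeasure (\<kappa> x) (Pair x -` (\<Union>i. A i)) \<partial>\<pi>)" .
    qed
  qed (use assms in \<open>auto simp: positive_def\<close>)
  then show ?thesis using assms by (simp add: eq)
qed

lemma nn_integral_edges:
  assumes "f \<in> borel_measurable borel"
  shows "(\<integral>\<^sup>+z. f z \<partial>edges) = (\<integral>\<^sup>+x. (\<integral>\<^sup>+y. f (x, y) \<partial>\<kappa> x) \<partial>\<pi>)"
  using assms
proof (induction rule: borel_measurable_induct)
  case (cong f g)
  then have "f = g" by auto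
  with cong show ?case by simp
next
  case (set A)
  then show ?case by (simp add: emeasure_edges)
next
  case (mult u c)
  then have [measurable]: "u \<in> borel_measurable borel" by simp
  have [measurable]: "(\<lambda>y. u (x, y)) \<in> borel_measurable borel" for x
    using measurable_compose[OF measurable_Pair_borel, of u] by simp
  show ?case using mult by (simp add: nn_integral_cmult)
next
  case (add u v)
  then have [measurable]: "u \<in> borel_measurable borel" "v \<in> borel_measurable borel" by auto
  have [measurable]: "(\<lambda>y. u (x, y)) \<in> borel_measurable borel" "(\<lambda>y. v (x, y)) \<in> borel_measurable borel" for x
    using measurable_compose[OF measurable_Pair_borel, of u] measurable_compose[OF measurable_Pair_borel, of v]
    by simp_all
  show ?case using add by (simp add: nn_integral_add)
next
  case (seq U)
  have [measurable]: "U i \<in> borel_measurable borel" for i using seq by simp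
  have [measurable]: "(\<lambda>y. U i (x, y)) \<in> borel_measurable borel" for x i
    using measurable_compose[OF measurable_Pair_borel, of "U i"] by simp
  have inc: "incseq (\<lambda>i y. U i (x, y))" for x
    using \<open>incseq U\<close> by (auto simp: incseq_def le_fun_def)
  have inc2: "incseq (\<lambda>i x. \<integral>\<^sup>+y. U i (x, y) \<partial>\<kappa> x)"
    using \<open>incseq U\<close> by (auto simp: incseq_def le_fun_def intro!: nn_integral_mono)
  have "(\<integral>\<^sup>+z. (SUP i. U i) z \<partial>edges) = (SUP i. \<integral>\<^sup>+z. U i z \<partial>edges)"
    using nn_integral_monotone_convergence_SUP[OF \<open>incseq U\<close>, of edges] by (simp add: image_comp)
  also have "\<dots> = (SUP i. \<integral>\<^sup>+x. \<integral>\<^sup>+y. U i (x, y) \<partial>\<kappa> x \<partial>\<pi>)"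
    using seq by simp
  also have "\<dots> = (\<integral>\<^sup>+x. (SUP i. \<integral>\<^sup>+y. U i (x, y) \<partial>\<kappa> x) \<partial>\<pi>)"
    using inc2 by (intro nn_integral_monotone_convergence_SUP[symmetric]) auto
  also have "\<dots> = (\<integral>\<^sup>+x. \<integral>\<^sup>+y. (SUP i. U i) (x, y) \<partial>\<kappa> x \<partial>\<pi>)"
    using inc by (subst nn_integral_monotone_convergence_SUP[symmetric]) (auto simp: image_comp)
  finally show ?case .
qed

lemma measurable_swap [measurable]: "(\<lambda>(x, y). (y, x)) \<in> borel_measurable (borel :: ('a \<times> 'a) measure)"
  by (intro borel_measurable_continuous_onI) (auto intro!: continuous_intros simp: case_prod_beta)

lemma distr_edges_swap: "distr edges borel (\<lambda>(x, y). (y, x)) = edges"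
  using kernel by (simp add: jump_kernel_def)

lemma nn_integral_edges_swap:
  assumes [measurable]: "f \<in> borel_measurable borel"
  shows "(\<integral>\<^sup>+z. f (snd z, fst z) \<partial>edges) = (\<integral>\<^sup>+z. f z \<partial>edges)"
proof -
  have "(\<integral>\<^sup>+z. f z \<partial>edges) = (\<integral>\<^sup>+z. f z \<partial>distr edges borel (\<lambda>(x, y). (y, x)))"
    by (simp add: distr_edges_swap)
  also have "\<dots> = (\<integral>\<^sup>+z. f (snd z, fst z) \<partial>edges)"
    by (subst nn_integral_distr) (auto simp: case_prod_beta)
  finally show ?thesis ..
qed

lemma AE_edges_fst:
  assumes "AE x in \<pi>. P x"
  shows "AE z in edges. P (fst z)"
proof -
  obtain N where N: "{x. \<not> P x} \<subseteq> N" "N \<in> sets borel" "emeasure \<pi> N = 0"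
    using assms by (auto elim!: AE_E)
  have [measurable]: "N \<times> UNIV \<in> sets borel"
    using N(2) by (intro borel_Times) auto
  have "AE x in \<pi>. x \<notin> N"
    using N by (intro AE_not_in) auto
  then have "AE x in \<pi>. (\<integral>\<^sup>+y. indicator (N \<times> UNIV) (x, y) \<partial>\<kappa> x) = 0"
    by eventually_elim simp
  then have "emeasure edges (N \<times> UNIV) = 0"
    by (subst emeasure_edges) (auto simp: nn_integral_0_iff_AE)
  then show ?thesis
    using N by (intro AE_I[where N = "N \<times> UNIV"]) auto
qed

text \<open>Detailed balance exchanges the coordinates, so a null set of \<open>\<pi>\<close> is
  also avoided by the endpoint of almost every edge.\<close>

lemma AE_edges_snd:
  assumes "AE x in \<pi>. P x"
  shows "AE z in edges. P (snd z)"
proof -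
  have "AE z in distr edges borel (\<lambda>(x, y). (y, x)). P (fst z)"
    by (subst distr_edges_swap) (rule AE_edges_fst[OF assms])
  from AE_distrD[OF _ this] show ?thesis by (auto simp: case_prod_beta)
qed

lemma AE_edges_both:
  assumes "AE x in \<pi>. P x"
  shows "AE z in edges. P (fst z) \<and> P (snd z)"
  using AE_edges_fst[OF assms] AE_edges_snd[OF assms] by eventually_elim simp

text \<open>The function \<open>w\<close> is strictly positive with finite integral, so the edge
  measure has the finite density 1 / w with respect to a finite measure. The diagonal term in
  \<open>w\<close> secures positivity where the moment weight vanishes and costs nothing, since
  \<open>\<kappa> x\<close> has no mass at x.\<close>

lemma sigma_finite_edges: "sigma_finite_measure edges"
proof -
  define w :: "'a \<times> 'a \<Rightarrow> real"
    where "w z = min 1 ((dist (fst z) (snd z))\<^sup>2) + (if fst z = snd z then 1 else 0)" for z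
  have w_pos: "0 < w z" for z
    by (auto simp: w_def min_def add_nonneg_pos)
  have [measurable]: "w \<in> borel_measurable borel"
  proof -
    have "w = (\<lambda>z. min 1 ((dist (fst z) (snd z))\<^sup>2) + (if dist (fst z) (snd z) = 0 then 1 else 0))"
      by (auto simp: w_def)
    then show ?thesis by simp
  qed
  obtain C where C: "C < \<infinity>" "\<And>x. (\<integral>\<^sup>+y. ennreal (min 1 ((dist x y)\<^sup>2)) \<partial>\<kappa> x) \<le> C"
    using truncated_kernel_bounded by blast
  have "(\<integral>\<^sup>+y. ennreal (w (x, y)) \<partial>\<kappa> x) \<le> C" for x
  proof -
    have "AE y in \<kappa> x. y \<noteq> x"
    proof (rule AE_I)
      show "{y \<in> space (\<kappa> x). \<not> y \<noteq> x} \<subseteq> {x}" by auto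
    qed (use kernel in \<open>auto simp: jump_kernel_def\<close>)
    then have "(\<integral>\<^sup>+y. ennreal (w (x, y)) \<partial>\<kappa> x) = (\<integral>\<^sup>+y. ennreal (min 1 ((dist x y)\<^sup>2)) \<partial>\<kappa> x)"
      by (intro nn_integral_cong_AE) (auto simp: w_def)
    with C show ?thesis by simp
  qed
  then have "(\<integral>\<^sup>+x. \<integral>\<^sup>+y. ennreal (w (x, y)) \<partial>\<kappa> x \<partial>\<pi>) \<le> (\<integral>\<^sup>+x. C \<partial>\<pi>)"
    by (rule nn_integral_mono)
  then have "(\<integral>\<^sup>+z. ennreal (w z) \<partial>edges) \<le> (\<integral>\<^sup>+x. C \<partial>\<pi>)"
    by (simp add: nn_integral_edges)
  also have "\<dots> < \<infinity>"
    using C(1) pi.emeasure_finite[of UNIV] by (auto simp: ennreal_mult_eq_top_iff less_top[symmetric])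
  finally have fin: "finite_measure (density edges (\<lambda>z. ennreal (w z)))"
    by (intro finite_measureI) (auto simp: emeasure_density)
  then interpret D: finite_measure "density edges (\<lambda>z. ennreal (w z))" .
  have "edges = density (density edges (\<lambda>z. ennreal (w z))) (\<lambda>z. ennreal (1 / w z))"
    using w_pos by (subst density_density_eq) (auto simp: ennreal_mult[symmetric] less_imp_le less_imp_neq[symmetric] density_1 )
  also have "sigma_finite_measure \<dots>"
    by (subst D.sigma_finite_iff_density_finite) auto
  finally show ?thesis .
qed

sublocale edges: sigma_finite_measure edges
  by (rule sigma_finite_edges)

end

section \<open>Entropy, dissipation and mobility densities\<close>

lemma continuous_on_compact_abs_bound:
  fixes f :: "'a::topological_space \<Rightarrow> real"
  assumes "compact S" "continuous_on S f"
  obtains B where "0 < B" "\<And>x. x \<in> S \<Longrightarrow> \<bar>f x\<bar> \<le> B"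
proof -
  have "bounded (f ` S)" using assms by (intro compact_imp_bounded compact_continuous_image)
  then show ?thesis using that by (auto simp: bounded_pos)
qed

section \<open>The dual dissipation density and its conjugate\<close>

lemma dual_dissipation_continuous:
  assumes "dual_dissipation_density \<psi>s"
  shows "continuous_on S \<psi>s"
  using assms unfolding dual_dissipation_density_def
  by (auto intro!: continuous_at_imp_continuous_on differentiable_imp_continuous_within)

lemma dual_dissipation_nonneg: "dual_dissipation_density \<psi>s \<Longrightarrow> 0 \<le> \<psi>s \<xi>"
  by (simp add: dual_dissipation_density_def)

lemma dual_dissipation_even: "dual_dissipation_density \<psi>s \<Longrightarrow> \<psi>s (- \<xi>) = \<psi>s \<xi>"
  by (simp add: dual_dissipation_density_def)

lemma borel_measurable_dual_dissipation:
  "dual_dissipation_density \<psi>s \<Longrightarrow> \<psi>s \<in> borel_measurable borel"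
  by (rule borel_measurable_continuous_onI[OF dual_dissipation_continuous])

lemma dual_dissipation_near_0:
  assumes "dual_dissipation_density \<psi>s"
  obtains c \<eta> where "0 < c" "0 < \<eta>"
    "\<And>\<xi>. \<bar>\<xi>\<bar> \<le> \<eta> \<Longrightarrow> c * \<xi>\<^sup>2 \<le> \<psi>s \<xi>" "\<And>\<xi>. \<bar>\<xi>\<bar> \<le> \<eta> \<Longrightarrow> \<psi>s \<xi> \<le> 3 * c * \<xi>\<^sup>2"
proof -
  obtain c where c: "c > 0" and lim: "((\<lambda>\<xi>. \<psi>s \<xi> / \<bar>\<xi>\<bar>\<^sup>2) \<longlongrightarrow> c) (at 0)"
    using assms by (auto simp: dual_dissipation_density_def)
  have "\<forall>\<^sub>F \<xi> in at 0. dist (\<psi>s \<xi> / \<bar>\<xi>\<bar>\<^sup>2) c < c / 2"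
    using c by (intro tendstoD[OF lim]) simp
  then obtain d where d: "d > 0" "\<And>\<xi>. \<xi> \<noteq> 0 \<Longrightarrow> \<bar>\<xi>\<bar> < d \<Longrightarrow> \<bar>\<psi>s \<xi> / \<xi>\<^sup>2 - c\<bar> < c / 2"
    by (auto simp: eventually_at dist_real_def)
  have 0: "\<psi>s 0 = 0" using assms by (simp add: dual_dissipation_density_def)
  show ?thesis
  \<comment> \<open>Here c is the limit of the quotient. Near 0 the quotient lies between c / 2 and
    3 * (c / 2), whence the factor 3 between the two bounds.\<close>
  proof (rule that[of "c / 2" "d / 2"])
    fix \<xi> :: real assume x: "\<bar>\<xi>\<bar> \<le> d / 2"
    show "c / 2 * \<xi>\<^sup>2 \<le> \<psi>s \<xi>"
    proof (cases "\<xi> = 0")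
      case False
      then have "\<bar>\<psi>s \<xi> / \<xi>\<^sup>2 - c\<bar> < c / 2" using x d(1) by (intro d(2)) auto
      then have "c / 2 < \<psi>s \<xi> / \<xi>\<^sup>2" by linarith
      then show ?thesis using False by (simp add: field_simps)
    qed (simp add: 0)
    show "\<psi>s \<xi> \<le> 3 * (c / 2) * \<xi>\<^sup>2"
    proof (cases "\<xi> = 0")
      case False
      then have "\<bar>\<psi>s \<xi> / \<xi>\<^sup>2 - c\<bar> < c / 2" using x d(1) by (intro d(2)) auto
      then have "\<psi>s \<xi> / \<xi>\<^sup>2 < 3 * (c / 2)" by linarith
      then show ?thesis using False by (simp add: field_simps)
    qed (simp add: 0)
  qed (use c d in auto)
qed

text \<open>Near 0 this is the limit of the quotient; from \<eta> to K it is boundedness of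
  \<open>\<psi>s\<close>, as the square of \<xi> is then at least that of \<eta>.\<close>

lemma dual_dissipation_quadratic_upper:
  assumes \<psi>: "dual_dissipation_density \<psi>s"
  obtains C where "0 < C" "\<And>\<xi>. \<bar>\<xi>\<bar> \<le> K \<Longrightarrow> \<psi>s \<xi> \<le> C * \<xi>\<^sup>2"
proof -
  obtain c \<eta> where c: "0 < c" "0 < \<eta>" "\<And>\<xi>. \<bar>\<xi>\<bar> \<le> \<eta> \<Longrightarrow> \<psi>s \<xi> \<le> 3 * c * \<xi>\<^sup>2"
    using dual_dissipation_near_0[OF \<psi>] by metis
  obtain B where B: "0 < B" "\<And>\<xi>. \<xi> \<in> {-K..K} \<Longrightarrow> \<bar>\<psi>s \<xi>\<bar> \<le> B"
    by (rule continuous_on_compact_abs_bound[OF _ dual_dissipation_continuous[OF \<psi>], of "{-K..K}"]) auto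
  show ?thesis
  proof (rule that[of "max (3 * c) (\<bar>B\<bar> / \<eta>\<^sup>2)"])
    fix \<xi> :: real assume K: "\<bar>\<xi>\<bar> \<le> K"
    show "\<psi>s \<xi> \<le> max (3 * c) (\<bar>B\<bar> / \<eta>\<^sup>2) * \<xi>\<^sup>2"
    proof (cases "\<bar>\<xi>\<bar> \<le> \<eta>")
      case True
      have "3 * c * \<xi>\<^sup>2 \<le> max (3 * c) (\<bar>B\<bar> / \<eta>\<^sup>2) * \<xi>\<^sup>2"
        by (intro mult_right_mono) auto
      with c(3)[OF True] show ?thesis by linarith
    next
      case False
      then have "\<eta>\<^sup>2 \<le> \<xi>\<^sup>2" using c(2) by (metis abs_le_square_iff abs_of_pos less_imp_le not_le)
      have "\<xi> \<in> {-K..K}" using K by auto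
      then have "\<psi>s \<xi> \<le> \<bar>B\<bar>" using B(2)[of \<xi>] by linarith
      also have "\<bar>B\<bar> = \<bar>B\<bar> / \<eta>\<^sup>2 * \<eta>\<^sup>2" using c(2) by simp
      also have "\<dots> \<le> max (3 * c) (\<bar>B\<bar> / \<eta>\<^sup>2) * \<xi>\<^sup>2"
        using \<open>\<eta>\<^sup>2 \<le> \<xi>\<^sup>2\<close> c by (intro mult_mono) (auto simp: le_max_iff_disj)
      finally show ?thesis .
    qed
  qed (use c in \<open>auto simp: less_max_iff_disj\<close>)
qed

text \<open>Convexity with value 0 at 0 propagates the bound near 0 outwards at the cost of a factor
  \<eta> / L. It will turn finite energy of a bounded gradient into square integrability.\<close>

lemma dual_dissipation_quadratic_lower:
  assumes \<psi>: "dual_dissipation_density \<psi>s"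
  obtains c where "0 < c" "\<And>\<xi>. \<bar>\<xi>\<bar> \<le> K \<Longrightarrow> c * \<xi>\<^sup>2 \<le> \<psi>s \<xi>"
proof -
  obtain c \<eta> where c: "0 < c" "0 < \<eta>" "\<And>\<xi>. \<bar>\<xi>\<bar> \<le> \<eta> \<Longrightarrow> c * \<xi>\<^sup>2 \<le> \<psi>s \<xi>"
    using dual_dissipation_near_0[OF \<psi>] by metis
  define L where "L = max K \<eta>"
  have L: "\<eta> \<le> L" "K \<le> L" "0 < L" using c by (auto simp: L_def)
  show ?thesis
  proof (rule that[of "c * (\<eta> / L)"])
    fix \<xi> :: real assume "\<bar>\<xi>\<bar> \<le> K"
    then have K: "\<bar>\<xi>\<bar> \<le> L" using L by simp
    show "c * (\<eta> / L) * \<xi>\<^sup>2 \<le> \<psi>s \<xi>"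
    proof (cases "\<bar>\<xi>\<bar> \<le> \<eta>")
      case True
      have "c * (\<eta> / L) \<le> c" using L c by (simp add: field_simps)
      then have "c * (\<eta> / L) * \<xi>\<^sup>2 \<le> c * \<xi>\<^sup>2" by (intro mult_right_mono) auto
      with c(3)[OF True] show ?thesis by linarith
    next
      case False
      \<comment> \<open>Scales \<xi> to length \<eta>, the end of the range where the quadratic
        bound is known.\<close>
      define t where "t = \<eta> / \<bar>\<xi>\<bar>"
      have t: "0 < t" "t < 1" using False c by (auto simp: t_def field_simps)
      have "\<bar>t * \<xi>\<bar> = \<eta>" using False c by (auto simp: t_def abs_mult)
      have "convex_on UNIV \<psi>s" "\<psi>s 0 = 0" using \<psi> by (auto simp: dual_dissipation_density_def)
      then have "\<psi>s (t * \<xi>) \<le> t * \<psi>s \<xi>"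
        using convex_onD[of UNIV \<psi>s t 0 \<xi>] t by simp
      moreover have "c * (t * \<xi>)\<^sup>2 \<le> \<psi>s (t * \<xi>)" using c(3)[of "t * \<xi>"] \<open>\<bar>t * \<xi>\<bar> = \<eta>\<close> by simp
      ultimately have "t * (c * t * \<xi>\<^sup>2) \<le> t * \<psi>s \<xi>" by (simp add: power2_eq_square mult_ac)
      then have "c * t * \<xi>\<^sup>2 \<le> \<psi>s \<xi>" using t by simp
      moreover have "\<eta> / L \<le> t" unfolding t_def using K False c L by (intro divide_left_mono) auto
      then have "c * (\<eta> / L) * \<xi>\<^sup>2 \<le> c * t * \<xi>\<^sup>2" using c by (intro mult_right_mono mult_left_mono) auto
      ultimately show ?thesis by linarith
    qed
  qed (use c L in auto)
qed

text \<open>Superlinear growth of \<open>\<psi>s\<close> beats the linear term. Boundedness is what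
  gives the real supremum in \<open>convex_conjugate\<close> its meaning.\<close>

lemma bdd_above_convex_conjugate:
  assumes \<psi>: "dual_dissipation_density \<psi>s"
  shows "bdd_above (range (\<lambda>\<xi>. w * \<xi> - \<psi>s \<xi>))"
proof -
  have "filterlim (\<lambda>\<xi>. \<psi>s \<xi> / \<bar>\<xi>\<bar>) at_top at_infinity"
    using \<psi> by (simp add: dual_dissipation_density_def)
  then have "\<forall>\<^sub>F \<xi> in at_infinity. \<bar>w\<bar> \<le> \<psi>s \<xi> / \<bar>\<xi>\<bar>"
    by (simp add: filterlim_at_top)
  then obtain b where b: "\<And>\<xi>. b \<le> \<bar>\<xi>\<bar> \<Longrightarrow> \<bar>w\<bar> \<le> \<psi>s \<xi> / \<bar>\<xi>\<bar>"
    by (auto simp: eventually_at_infinity)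
  have "w * \<xi> - \<psi>s \<xi> \<le> \<bar>w\<bar> * max b 1" for \<xi>
  proof (cases "max b 1 \<le> \<bar>\<xi>\<bar>")
    case True
    then have "0 < \<bar>\<xi>\<bar>" "\<bar>w\<bar> \<le> \<psi>s \<xi> / \<bar>\<xi>\<bar>" using b[of \<xi>] by linarith+
    then have "\<bar>w\<bar> * \<bar>\<xi>\<bar> \<le> \<psi>s \<xi>" by (simp only: pos_le_divide_eq)
    moreover have "w * \<xi> \<le> \<bar>w\<bar> * \<bar>\<xi>\<bar>" by (metis abs_ge_self abs_mult)
    moreover have "0 \<le> \<bar>w\<bar> * max b 1" by simp
    ultimately show ?thesis by linarith
  next
    case False
    have "w * \<xi> \<le> \<bar>w\<bar> * \<bar>\<xi>\<bar>" by (metis abs_ge_self abs_mult)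
    also have "\<dots> \<le> \<bar>w\<bar> * max b 1" using False by (intro mult_left_mono) auto
    finally show ?thesis using dual_dissipation_nonneg[OF \<psi>, of \<xi>] by linarith
  qed
  then show ?thesis by (intro bdd_aboveI) auto
qed

text \<open>Evenness of \<open>\<psi>s\<close> allows both signs of \<xi>. The absolute value is
  what later controls the variation of a flux and not only its signed integral.\<close>

lemma young_inequality:
  assumes \<psi>: "dual_dissipation_density \<psi>s"
  shows "\<bar>w * \<xi>\<bar> \<le> convex_conjugate \<psi>s w + \<psi>s \<xi>"
proof -
  have "w * \<zeta> - \<psi>s \<zeta> \<le> convex_conjugate \<psi>s w" for \<zeta>
    unfolding convex_conjugate_def by (rule cSUP_upper[OF _ bdd_above_convex_conjugate[OF \<psi>]]) simp
  from this[of \<xi>] this[of "- \<xi>"] show ?thesis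
    using dual_dissipation_even[OF \<psi>, of \<xi>] by (simp add: abs_le_iff)
qed

lemma convex_conjugate_nonneg:
  assumes \<psi>: "dual_dissipation_density \<psi>s"
  shows "0 \<le> convex_conjugate \<psi>s w"
  using young_inequality[OF \<psi>, of w 0] \<psi> by (simp add: dual_dissipation_density_def)

text \<open>A finite convex function on the line is continuous.\<close>

lemma borel_measurable_convex_conjugate:
  assumes \<psi>: "dual_dissipation_density \<psi>s"
  shows "convex_conjugate \<psi>s \<in> borel_measurable borel"
proof -
  have upper: "w * \<zeta> - \<psi>s \<zeta> \<le> convex_conjugate \<psi>s w" for \<zeta> w
    unfolding convex_conjugate_def by (rule cSUP_upper[OF _ bdd_above_convex_conjugate[OF \<psi>]]) simp
  have "convex_on UNIV (convex_conjugate \<psi>s)"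
  proof (rule convex_onI)
    fix t x y :: real assume t: "0 < t" "t < 1"
    have "((1 - t) * x + t * y) * \<xi> - \<psi>s \<xi> \<le> (1 - t) * convex_conjugate \<psi>s x + t * convex_conjugate \<psi>s y" for \<xi>
    proof -
      have "((1 - t) * x + t * y) * \<xi> - \<psi>s \<xi> = (1 - t) * (x * \<xi> - \<psi>s \<xi>) + t * (y * \<xi> - \<psi>s \<xi>)"
        by (simp add: algebra_simps)
      also have "\<dots> \<le> (1 - t) * convex_conjugate \<psi>s x + t * convex_conjugate \<psi>s y"
        using t upper by (intro add_mono mult_left_mono) auto
      finally show ?thesis .
    qed
    then show "convex_conjugate \<psi>s ((1 - t) *\<^sub>R x + t *\<^sub>R y) \<le>
        (1 - t) * convex_conjugate \<psi>s x + t * convex_conjugate \<psi>s y"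
      unfolding convex_conjugate_def[of _ "(1 - t) *\<^sub>R x + t *\<^sub>R y"] by (intro cSUP_least) auto
  qed simp
  then show ?thesis
    by (intro borel_measurable_continuous_onI convex_on_continuous) auto
qed

section \<open>The mobility: positivity, measurability, affine majorants\<close>

lemma mobility_nonneg: "mobility \<alpha> \<Longrightarrow> 0 \<le> u \<Longrightarrow> 0 \<le> v \<Longrightarrow> 0 \<le> \<alpha> u v"
  by (simp add: mobility_def)

lemma mobility_concave:
  assumes "mobility \<alpha>" "0 \<le> t" "t \<le> 1" "0 \<le> a" "0 \<le> b" "0 \<le> c" "0 \<le> d"
  shows "(1 - t) * \<alpha> a b + t * \<alpha> c d \<le> \<alpha> ((1 - t) * a + t * c) ((1 - t) * b + t * d)"
proof -
  have "convex_on ({0..} \<times> {0..}) (\<lambda>p. - (case p of (u, v) \<Rightarrow> \<alpha> u v))"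
    using assms by (simp add: mobility_def concave_on_def)
  from convex_onD[OF this, of t "(a, b)" "(c, d)"] assms show ?thesis by simp
qed

text \<open>Concavity spreads positivity. Averaging a point of positive value with its mirror image
  leads to the diagonal, and a convex combination with (2, 2) or (0, 0) leads on to (1, 1), the
  density pair of \<pi> with respect to itself.\<close>

lemma mobility_one_pos:
  assumes \<alpha>: "mobility \<alpha>"
  shows "0 < \<alpha> 1 1"
proof -
  obtain p q where pq: "0 \<le> p" "0 \<le> q" "0 < \<alpha> p q" 
    using \<alpha> by (force simp: mobility_def less_le)
  then have "0 < \<alpha> q p" using \<alpha> by (simp add: mobility_def)
  define m where "m = (p + q) / 2"
  have e: "(1 - 1/2) * p + 1/2 * q = m" "(1 - 1/2) * q + 1/2 * p = m" by (simp_all add: m_def field_simps)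
  have "(1 - 1/2) * \<alpha> p q + 1/2 * \<alpha> q p \<le> \<alpha> ((1 - 1/2) * p + 1/2 * q) ((1 - 1/2) * q + 1/2 * p)"
    using pq by (intro mobility_concave[OF \<alpha>]) auto
  then have "(1 - 1/2) * \<alpha> p q + 1/2 * \<alpha> q p \<le> \<alpha> m m" unfolding e .
  with pq \<open>0 < \<alpha> q p\<close> have m: "0 \<le> m" "0 < \<alpha> m m" by (auto simp: m_def)
  consider "m = 1" | "m < 1" | "1 < m" by linarith
  then show ?thesis
  proof cases
    case 2
    define t where "t = (1 - m) / (2 - m)"
    have "t * (2 - m) = 1 - m" using 2 by (simp add: t_def)
    moreover have "(1 - t) * m + t * 2 = m + t * (2 - m)" by (simp add: algebra_simps)
    moreover have "0 \<le> t" "t < 1" using 2 m by (auto simp: t_def)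
    ultimately have t: "0 \<le> t" "t < 1" "(1 - t) * m + t * 2 = 1" by simp_all
    have "(1 - t) * \<alpha> m m + t * \<alpha> 2 2 \<le> \<alpha> 1 1"
      using mobility_concave[OF \<alpha>, of t m m 2 2] t m by simp
    moreover have "0 < (1 - t) * \<alpha> m m" "0 \<le> t * \<alpha> 2 2" using t m mobility_nonneg[OF \<alpha>] by auto
    ultimately show ?thesis by linarith
  next
    case 3
    define t where "t = 1 - 1 / m"
    have t: "0 \<le> t" "t < 1" "(1 - t) * m = 1" using 3 by (auto simp: t_def field_simps)
    have "(1 - t) * \<alpha> m m + t * \<alpha> 0 0 \<le> \<alpha> 1 1"
      using mobility_concave[OF \<alpha>, of t m m 0 0] t m by simp
    moreover have "0 < (1 - t) * \<alpha> m m" "0 \<le> t * \<alpha> 0 0" using t m mobility_nonneg[OF \<alpha>] by auto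
    ultimately show ?thesis by linarith
  qed (use m in simp)
qed

lemma mobility_continuous:
  assumes "mobility \<alpha>" "continuous_on S f" "continuous_on S g" "\<And>x. x \<in> S \<Longrightarrow> 0 \<le> f x" "\<And>x. x \<in> S \<Longrightarrow> 0 \<le> g x"
  shows "continuous_on S (\<lambda>x. \<alpha> (f x) (g x))"
proof -
  have "continuous_on S (\<lambda>x. (\<lambda>(u, v). \<alpha> u v) (f x, g x))"
    using assms by (rule_tac continuous_on_compose2[where g = "\<lambda>(u, v). \<alpha> u v" and t = "{0..} \<times> {0..}"])
      (auto simp: mobility_def intro!: continuous_intros)
  then show ?thesis by simp
qed

text \<open>\<open>\<alpha>\<close> is specified on the closed quadrant only; composing it with
  positive parts gives a function continuous on the whole plane.\<close>

lemma borel_measurable_mobility: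
  assumes "mobility \<alpha>" and [measurable]: "f \<in> borel_measurable M" "g \<in> borel_measurable M"
    and nn: "\<And>x. 0 \<le> f x" "\<And>x. 0 \<le> g x"
  shows "(\<lambda>x. \<alpha> (f x) (g x)) \<in> borel_measurable M"
proof -
  have "continuous_on UNIV (\<lambda>p. \<alpha> (max 0 (fst p)) (max 0 (snd p)))"
    by (intro mobility_continuous[OF assms(1)] continuous_intros) auto
  then have "(\<lambda>x. (\<lambda>p. \<alpha> (max 0 (fst p)) (max 0 (snd p))) (f x, g x)) \<in> borel_measurable M"
    by (rule borel_measurable_continuous_on) simp
  then show ?thesis using nn by (simp add: max_def)
qed

lemma mobility_bounded:
  assumes \<alpha>: "mobility \<alpha>"
  obtains A where "0 < A" "\<And>u v. 0 \<le> u \<Longrightarrow> u \<le> M \<Longrightarrow> 0 \<le> v \<Longrightarrow> v \<le> M \<Longrightarrow> \<alpha> u v \<le> A"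
proof -
  have "continuous_on ({0..M} \<times> {0..M}) (\<lambda>p. \<alpha> (fst p) (snd p))"
    by (intro mobility_continuous[OF \<alpha>] continuous_intros) auto
  then obtain B where B: "0 < B" "\<And>p. p \<in> {0..M} \<times> {0..M} \<Longrightarrow> \<bar>\<alpha> (fst p) (snd p)\<bar> \<le> B"
    by (rule continuous_on_compact_abs_bound[rotated]) (auto intro: compact_Times)
  show ?thesis
  proof (rule that[of B])
    fix u v :: real assume "0 \<le> u" "u \<le> M" "0 \<le> v" "v \<le> M"
    with B(2)[of "(u, v)"] show "\<alpha> u v \<le> B" by simp
  qed (use B in simp)
qed

text \<open>A hyperplane separates the closed convex hypograph from a point just above the graph.
  The slack \<epsilon> matters at the boundary of the quadrant, where a concave function such as the
  geometric mean can have infinite slope.\<close>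

lemma mobility_affine_majorant:
  assumes \<alpha>: "mobility \<alpha>" and "0 \<le> p" "0 \<le> q" "0 < \<epsilon>"
  obtains a b c where "\<And>u v. 0 \<le> u \<Longrightarrow> 0 \<le> v \<Longrightarrow> \<alpha> u v \<le> c + a * u + b * v" "c + a * p + b * q < \<alpha> p q + \<epsilon>"
proof -
  define S where "S = {z :: (real \<times> real) \<times> real. 0 \<le> fst (fst z) \<and> 0 \<le> snd (fst z) \<and>
    snd z \<le> \<alpha> (max 0 (fst (fst z))) (max 0 (snd (fst z)))}"
  have "continuous_on UNIV (\<lambda>z :: (real \<times> real) \<times> real. \<alpha> (max 0 (fst (fst z))) (max 0 (snd (fst z))))"
    by (intro mobility_continuous[OF \<alpha>] continuous_intros) auto
  then have "closed S"
    unfolding S_def by (intro closed_Collect_conj closed_Collect_le continuous_intros) auto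
  moreover have "convex S"
    unfolding convex_alt
  proof safe
    fix a b c a' b' c' t :: real
    assume *: "((a, b), c) \<in> S" "((a', b'), c') \<in> S" and t: "0 \<le> t" "t \<le> 1"
    have nn: "0 \<le> a" "0 \<le> b" "0 \<le> a'" "0 \<le> b'" "c \<le> \<alpha> a b" "c' \<le> \<alpha> a' b'"
      using * by (auto simp: S_def)
    have "(1 - t) * c + t * c' \<le> (1 - t) * \<alpha> a b + t * \<alpha> a' b'"
      using nn t by (intro add_mono mult_left_mono) auto
    also have "\<dots> \<le> \<alpha> ((1 - t) * a + t * a') ((1 - t) * b + t * b')"
      by (intro mobility_concave[OF \<alpha>] t nn)
    finally show "(1 - t) *\<^sub>R ((a, b), c) + t *\<^sub>R ((a', b'), c') \<in> S"
      using nn t by (simp add: S_def)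
  qed
  moreover have "((p, q), \<alpha> p q + \<epsilon>) \<notin> S" using assms by (simp add: S_def)
  ultimately obtain n d where *: "inner n ((p, q), \<alpha> p q + \<epsilon>) < d" "\<And>x. x \<in> S \<Longrightarrow> d < inner n x"
    using separating_hyperplane_closed_point[of S "((p, q), \<alpha> p q + \<epsilon>)"] by blast
  obtain a b e where n: "n = ((a, b), e)" by (metis surj_pair)
  have lt: "a * p + b * q + e * (\<alpha> p q + \<epsilon>) < d" using *(1) by (simp add: n)
  have gt: "d < a * u + b * v + e * y" if "0 \<le> u" "0 \<le> v" "y \<le> \<alpha> u v" for u v y
    using *(2)[of "((u, v), y)"] that by (simp add: n S_def)
  have "d < a * p + b * q + e * \<alpha> p q" using gt assms by simp
  \<comment> \<open>The graph point lies in the hypograph directly below the separated point, so the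
    hyperplane is not vertical.\<close>
  with lt have "e * \<epsilon> < 0" by (simp add: algebra_simps)
  then have e: "e < 0" using \<open>0 < \<epsilon>\<close> by (simp add: mult_less_0_iff)
  show ?thesis
  proof (rule that[of "d / e" "- a / e" "- b / e"])
    fix u v :: real assume "0 \<le> u" "0 \<le> v"
    with gt[of u v "\<alpha> u v"] have "d < a * u + b * v + e * \<alpha> u v" by simp
    then have "\<alpha> u v \<le> (d - a * u - b * v) / e" using e by (simp add: neg_le_divide_eq mult.commute)
    then show "\<alpha> u v \<le> d / e + - a / e * u + - b / e * v" by (simp add: diff_divide_distrib)
  next
    have "(d - a * p - b * q) / e < \<alpha> p q + \<epsilon>" using lt e by (simp add: neg_divide_less_eq mult.commute)
    then show "d / e + - a / e * p + - b / e * q < \<alpha> p q + \<epsilon>" by (simp add: diff_divide_distrib)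
  qed
qed

text \<open>The cells \<open>B i\<close> and affine functions play the role of a measurable selection of
  supergradients of the concave mobility.\<close>

lemma mobility_piecewise_affine_majorant:
  assumes \<alpha>: "mobility \<alpha>" and "0 < \<epsilon>"
  obtains N :: nat and B :: "nat \<Rightarrow> (real \<times> real) set" and a b c :: "nat \<Rightarrow> real" where
    "\<And>i. i < N \<Longrightarrow> B i \<in> sets borel" "disjoint_family_on B {..<N}" "{0..M} \<times> {0..M} \<subseteq> (\<Union>i<N. B i)"
    "\<And>i u v. i < N \<Longrightarrow> 0 \<le> u \<Longrightarrow> 0 \<le> v \<Longrightarrow> \<alpha> u v \<le> c i + a i * u + b i * v"
    "\<And>i u v. i < N \<Longrightarrow> (u, v) \<in> B i \<Longrightarrow> 0 \<le> u \<Longrightarrow> 0 \<le> v \<Longrightarrow> c i + a i * u + b i * v \<le> \<alpha> u v + \<epsilon>"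
proof -
  let ?K = "{0..M} \<times> {0..M}"
  have "\<forall>p\<in>?K. \<exists>a b c. (\<forall>u v. 0 \<le> u \<longrightarrow> 0 \<le> v \<longrightarrow> \<alpha> u v \<le> c + a * u + b * v) \<and>
      c + a * fst p + b * snd p < \<alpha> (fst p) (snd p) + \<epsilon>"
  proof
    fix p assume "p \<in> ?K"
    then have "0 \<le> fst p" "0 \<le> snd p" by auto
    from mobility_affine_majorant[OF \<alpha> this \<open>0 < \<epsilon>\<close>]
    show "\<exists>a b c. (\<forall>u v. 0 \<le> u \<longrightarrow> 0 \<le> v \<longrightarrow> \<alpha> u v \<le> c + a * u + b * v) \<and>
      c + a * fst p + b * snd p < \<alpha> (fst p) (snd p) + \<epsilon>" by metis
  qed
  then obtain a b c where
    maj: "\<And>p u v. p \<in> ?K \<Longrightarrow> 0 \<le> u \<Longrightarrow> 0 \<le> v \<Longrightarrow> \<alpha> u v \<le> c p + a p * u + b p * v" and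
    near: "\<And>p. p \<in> ?K \<Longrightarrow> c p + a p * fst p + b p * snd p < \<alpha> (fst p) (snd p) + \<epsilon>"
    by metis
  \<comment> \<open>The affine function chosen at p stays \<epsilon>-close to
    \<open>\<alpha>\<close> on an open neighbourhood of p. Finitely many of these cover the square
    and are then made disjoint.\<close>
  define U where "U p = {z. c p + a p * fst z + b p * snd z < \<alpha> (max 0 (fst z)) (max 0 (snd z)) + \<epsilon>}" for p
  have U: "open (U p)" for p
    unfolding U_def by (intro open_Collect_less continuous_intros mobility_continuous[OF \<alpha>]) auto
  have "p \<in> U p" if "p \<in> ?K" for p
  proof -
    have "max 0 (fst p) = fst p" "max 0 (snd p) = snd p" using that by auto
    with near[OF that] show ?thesis by (simp add: U_def)
  qed
  then have "?K \<subseteq> \<Union>(U ` ?K)" by blast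
  moreover have "compact ?K" by (rule compact_Times; rule compact_Icc)
  ultimately obtain D where D: "D \<subseteq> ?K" "finite D" "?K \<subseteq> \<Union>(U ` D)"
    using U by (elim compactE_image)
  obtain ps where ps: "set ps = D" using finite_list[OF D(2)] by blast
  define B where "B i = disjointed (\<lambda>i. U (ps ! i)) i" for i
  show ?thesis
  proof (rule that[of "length ps" B "\<lambda>i. c (ps ! i)" "\<lambda>i. a (ps ! i)" "\<lambda>i. b (ps ! i)"])
    show "B i \<in> sets borel" for i
      unfolding B_def disjointed_def using U by (intro sets.Diff sets.finite_UN) auto
    show "disjoint_family_on B {..<length ps}"
      using disjoint_family_disjointed[of "\<lambda>i. U (ps ! i)"] by (auto simp: disjoint_family_on_def B_def)
    show "?K \<subseteq> (\<Union>i<length ps. B i)"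
    proof
      fix z assume "z \<in> ?K"
      then obtain p where "p \<in> D" "z \<in> U p" using D by auto
      then obtain i where i: "i < length ps" "z \<in> U (ps ! i)" using ps by (auto simp: in_set_conv_nth)
      define k where "k = (LEAST i. z \<in> U (ps ! i))"
      have "z \<in> U (ps ! k)" "k \<le> i" "\<And>l. l < k \<Longrightarrow> z \<notin> U (ps ! l)"
        unfolding k_def using i by (auto intro: LeastI Least_le dest: not_less_Least)
      then show "z \<in> (\<Union>i<length ps. B i)"
        using i by (auto simp: B_def disjointed_def intro!: bexI[of _ k])
    qed
  next
    fix i and u v :: real assume i: "i < length ps" and nn: "0 \<le> u" "0 \<le> v"
    have K: "ps ! i \<in> ?K" using i ps D by (metis nth_mem subsetD)
    show "\<alpha> u v \<le> c (ps ! i) + a (ps ! i) * u + b (ps ! i) * v"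
      using maj[OF K nn] .
    assume "(u, v) \<in> B i"
    then have "(u, v) \<in> U (ps ! i)" using disjointed_subset[of "\<lambda>i. U (ps ! i)" i] by (auto simp: B_def)
    then show "c (ps ! i) + a (ps ! i) * u + b (ps ! i) * v \<le> \<alpha> u v + \<epsilon>"
      using nn by (simp add: U_def max_def)
  qed
qed

section \<open>The entropy density and its derivative\<close>

lemma entropy_density_tangent:
  assumes \<phi>: "entropy_density \<phi>" and "0 < x" "0 \<le> y"
  shows "\<phi> x + deriv \<phi> x * (y - x) \<le> \<phi> y"
proof -
  have "(\<phi> has_real_derivative deriv \<phi> x) (at x)"
    using \<phi> \<open>0 < x\<close> by (simp add: entropy_density_def DERIV_deriv_iff_real_differentiable)
  then have "(\<phi> has_real_derivative deriv \<phi> x) (at x within {0..})"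
    by (rule has_field_derivative_at_within)
  then have "\<phi> y - \<phi> x \<ge> deriv \<phi> x * (y - x)"
  proof (rule convex_on_imp_above_tangent[rotated -1])
    show "convex_on {0..} \<phi>" using \<phi> by (simp add: entropy_density_def)
    show "x \<in> interior {0..}" using \<open>0 < x\<close> by simp
    show "connected {0::real..}" by simp
  qed (use \<open>0 \<le> y\<close> in auto)
  then show ?thesis by simp
qed

lemma entropy_density_nonneg: "entropy_density \<phi> \<Longrightarrow> 0 \<le> r \<Longrightarrow> 0 \<le> \<phi> r"
  by (simp add: entropy_density_def)

lemma borel_measurable_entropy_density:
  assumes \<phi>: "entropy_density \<phi>" and [measurable]: "f \<in> borel_measurable M" and nn: "\<And>x. 0 \<le> f x"
  shows "(\<lambda>x. \<phi> (f x)) \<in> borel_measurable M"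
proof -
  have "continuous_on UNIV (\<lambda>r. \<phi> (max 0 r))"
  proof (rule continuous_on_compose2[of "{0..}" \<phi>])
    show "continuous_on {0..} \<phi>" using \<phi> by (simp add: entropy_density_def)
  qed (auto intro!: continuous_intros)
  then have "(\<lambda>x. (\<lambda>r. \<phi> (max 0 r)) (f x)) \<in> borel_measurable M"
    by (rule borel_measurable_continuous_on) simp
  then show ?thesis using nn by (simp add: max_def)
qed

lemma borel_measurable_deriv_entropy_density:
  assumes \<phi>: "entropy_density \<phi>" and [measurable]: "f \<in> borel_measurable M" and "0 < \<delta>" "\<And>x. \<delta> \<le> f x"
  shows "(\<lambda>x. deriv \<phi> (f x)) \<in> borel_measurable M"
proof -
  have "continuous_on UNIV (\<lambda>r. deriv \<phi> (max \<delta> r))"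
  proof (rule continuous_on_compose2[of "{0<..}" "deriv \<phi>"])
    show "continuous_on {0<..} (deriv \<phi>)" using \<phi> by (simp add: entropy_density_def)
  qed (use \<open>0 < \<delta>\<close> in \<open>auto simp: less_max_iff_disj intro!: continuous_intros\<close>)
  then have "(\<lambda>x. (\<lambda>r. deriv \<phi> (max \<delta> r)) (f x)) \<in> borel_measurable M"
    by (rule borel_measurable_continuous_on) simp
  then show ?thesis using assms(4) by (simp add: max_def)
qed

lemma entropy_density_bounded:
  assumes \<phi>: "entropy_density \<phi>"
  obtains B where "0 \<le> B" "\<And>r. 0 \<le> r \<Longrightarrow> r \<le> M \<Longrightarrow> \<phi> r \<le> B"
proof -
  have "continuous_on {0..} \<phi>" using \<phi> by (simp add: entropy_density_def)
  then have "continuous_on {0..M} \<phi>" by (rule continuous_on_subset) auto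
  then obtain B where B: "0 < B" "\<And>r. r \<in> {0..M} \<Longrightarrow> \<bar>\<phi> r\<bar> \<le> B"
    by (rule continuous_on_compact_abs_bound[rotated]) auto
  show ?thesis
  proof (rule that[of B])
    fix r assume "0 \<le> r" "r \<le> M"
    with B(2)[of r] show "\<phi> r \<le> B" by simp
  qed (use B in simp)
qed

lemma deriv_entropy_density_bounded:
  assumes \<phi>: "entropy_density \<phi>" and "0 < \<delta>"
  obtains B where "0 < B" "\<And>r. \<delta> \<le> r \<Longrightarrow> r \<le> M \<Longrightarrow> \<bar>deriv \<phi> r\<bar> \<le> B"
proof -
  have "continuous_on {0<..} (deriv \<phi>)" using \<phi> by (simp add: entropy_density_def)
  then have "continuous_on {\<delta>..M} (deriv \<phi>)" by (rule continuous_on_subset) (use \<open>0 < \<delta>\<close> in auto)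
  then obtain B where "0 < B" "\<And>r. r \<in> {\<delta>..M} \<Longrightarrow> \<bar>deriv \<phi> r\<bar> \<le> B"
    by (rule continuous_on_compact_abs_bound[rotated]) auto
  then show ?thesis by (intro that[of B]) auto
qed

section \<open>The integrand of the Fisher information\<close>

text \<open>The envelope is a supremum of lower semicontinuous minorants, so one minorant suffices:
  the continuous expression on the open quadrant, extended by 0, which stays below every lower limit
  at the boundary.\<close>

lemma lsc_envelope_D_plus_ge:
  assumes \<phi>: "entropy_density \<phi>" and \<psi>: "dual_dissipation_density \<psi>s" and \<alpha>: "mobility \<alpha>"
    and "0 < u" "0 < v"
  shows "ennreal (\<psi>s (deriv \<phi> v - deriv \<phi> u) * \<alpha> u v) \<le>
    lsc_envelope_on ({0..} \<times> {0..}) (D_plus \<phi> \<psi>s \<alpha>) (u, v)"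
proof -
  define h where "h p = \<psi>s (deriv \<phi> (snd p) - deriv \<phi> (fst p)) * \<alpha> (fst p) (snd p)" for p
  define g where "g p = (if p \<in> {0<..} \<times> {0<..} then ennreal (h p) else 0)" for p
  have d: "continuous_on {0<..} (deriv \<phi>)" using \<phi> by (simp add: entropy_density_def)
  have "continuous_on ({0<..} \<times> {0<..}) (\<lambda>p. deriv \<phi> (snd p))"
    "continuous_on ({0<..} \<times> {0<..}) (\<lambda>p. deriv \<phi> (fst p))"
    by (rule continuous_on_compose2[OF d]; auto intro!: continuous_intros)+
  then have "continuous_on ({0<..} \<times> {0<..}) (\<lambda>p. \<psi>s (deriv \<phi> (snd p) - deriv \<phi> (fst p)))"
    by (rule_tac continuous_on_compose2[OF dual_dissipation_continuous[OF \<psi>, of UNIV]])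
      (auto intro!: continuous_intros)
  moreover have "continuous_on ({0<..} \<times> {0<..}) (\<lambda>p. \<alpha> (fst p) (snd p))"
    by (rule mobility_continuous[OF \<alpha>]) (auto intro!: continuous_intros)
  ultimately have cont: "continuous_on ({0<..} \<times> {0<..}) h"
    unfolding h_def by (rule continuous_on_mult)
  have opn: "open ({0<..} \<times> {0<..} :: (real \<times> real) set)" by (intro open_Times) auto
  have "lsc_on ({0..} \<times> {0..}) g"
    unfolding lsc_on_def
  proof
    fix p :: "real \<times> real"
    show "g p \<le> Liminf (at p within {0..} \<times> {0..}) g"
    proof (cases "p \<in> {0<..} \<times> {0<..}")
      case True
      have "(h \<longlongrightarrow> h p) (at p)" using cont True by (simp only: continuous_on_eq_continuous_at[OF opn] isCont_def)
      then have "((\<lambda>p. ennreal (h p)) \<longlongrightarrow> g p) (at p)"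
        unfolding g_def using True by (simp add: tendsto_ennrealI)
      moreover have "\<forall>\<^sub>F q in at p. g q = ennreal (h q)"
        using eventually_at_topological[of "\<lambda>q. g q = ennreal (h q)" p UNIV] opn True by (auto simp: g_def)
      ultimately have "(g \<longlongrightarrow> g p) (at p)" by (rule tendsto_cong[THEN iffD2, rotated])
      then have lim: "(g \<longlongrightarrow> g p) (at p within {0..} \<times> {0..})" by (rule tendsto_within_subset) simp
      show ?thesis
      proof (cases "at p within ({0..} \<times> {0..}) = bot")
        case True
        then show ?thesis by (simp add: Liminf_bot)
      next
        case False
        then show ?thesis using lim_imp_Liminf[OF False lim] by simp
      qed
    qed (simp add: g_def)
  qed
  moreover have "g q \<le> D_plus \<phi> \<psi>s \<alpha> q" if "q \<in> {0..} \<times> {0..}" for q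
  proof (cases "q \<in> {0<..} \<times> {0<..}")
    case True
    obtain a b where q: "q = (a, b)" by (metis surj_pair)
    have ab: "0 < a" "0 < b" using True q by auto
    have "Lambda \<phi> a b = ereal (deriv \<phi> b - deriv \<phi> a)"
      using ab by (simp add: Lambda_def ext_deriv_def)
    then have "extend_infinity \<psi>s (Lambda \<phi> a b) = ennreal (\<psi>s (deriv \<phi> b - deriv \<phi> a))"
      by (simp add: extend_infinity_def)
    then show ?thesis
      using ab dual_dissipation_nonneg[OF \<psi>] mobility_nonneg[OF \<alpha>, of a b]
      by (auto simp: q g_def h_def D_plus_def ennreal_mult)
  qed (simp add: g_def)
  ultimately have "g (u, v) \<le> lsc_envelope_on ({0..} \<times> {0..}) (D_plus \<phi> \<psi>s \<alpha>) (u, v)"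
    unfolding lsc_envelope_on_def by (intro SUP_upper) auto
  then show ?thesis using assms by (simp add: g_def h_def)
qed

text \<open>Makes \<pi>, whose own density is 1, a zero of the Fisher information.\<close>

lemma lsc_envelope_D_plus_one:
  assumes "dual_dissipation_density \<psi>s" "mobility \<alpha>"
  shows "lsc_envelope_on ({0..} \<times> {0..}) (D_plus \<phi> \<psi>s \<alpha>) (1, 1) = 0"
proof -
  have "D_plus \<phi> \<psi>s \<alpha> (1, 1) = 0"
    using mobility_one_pos[OF assms(2)] assms(1)
    by (simp add: D_plus_def Lambda_def ext_deriv_def extend_infinity_def dual_dissipation_density_def zero_ereal_def)
  moreover have "lsc_envelope_on ({0..} \<times> {0..}) (D_plus \<phi> \<psi>s \<alpha>) (1, 1) \<le> D_plus \<phi> \<psi>s \<alpha> (1, 1)"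
    unfolding lsc_envelope_on_def by (rule SUP_least) auto
  ultimately show ?thesis by simp
qed

section \<open>Approximation by bounded Lipschitz functions\<close>

lemma Lip_b_bounded: "\<zeta> \<in> Lip_b \<Longrightarrow> \<exists>C. \<forall>x. \<bar>\<zeta> x\<bar> \<le> C"
  by (auto simp: Lip_b_def bounded_iff)

lemma Lip_b_continuous: "\<zeta> \<in> Lip_b \<Longrightarrow> continuous_on S \<zeta>"
  unfolding Lip_b_def by (auto intro: continuous_on_subset[OF lipschitz_on_continuous_on])

lemma borel_measurable_Lip_b [measurable_dest]: "\<zeta> \<in> Lip_b \<Longrightarrow> \<zeta> \<in> borel_measurable borel"
  by (intro borel_measurable_continuous_onI Lip_b_continuous)

lemma Lip_b_const: "(\<lambda>_. c) \<in> Lip_b"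
  by (auto simp: Lip_b_def bounded_iff intro: lipschitz_on_constant)

lemma Lip_b_add:
  assumes "\<zeta> \<in> Lip_b" "\<xi> \<in> Lip_b"
  shows "(\<lambda>x. \<zeta> x + \<xi> x) \<in> Lip_b"
proof -
  obtain C D where CD: "\<And>x. \<bar>\<zeta> x\<bar> \<le> C" "\<And>x. \<bar>\<xi> x\<bar> \<le> D" using assms Lip_b_bounded by metis
  have "\<bar>\<zeta> x + \<xi> x\<bar> \<le> C + D" for x
    using CD(1)[of x] CD(2)[of x] by linarith
  then have "bounded (range (\<lambda>x. \<zeta> x + \<xi> x))"
    by (auto simp: bounded_iff)
  moreover have "\<exists>L. L-lipschitz_on UNIV (\<lambda>x. \<zeta> x + \<xi> x)"
    using assms unfolding Lip_b_def by (auto intro: lipschitz_on_add)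
  ultimately show ?thesis by (simp add: Lip_b_def)
qed

lemma Lip_b_cmult:
  assumes "\<zeta> \<in> Lip_b"
  shows "(\<lambda>x. c * \<zeta> x) \<in> Lip_b"
proof -
  obtain C where "\<And>x. \<bar>\<zeta> x\<bar> \<le> C" using assms Lip_b_bounded by metis
  then have "\<bar>c * \<zeta> x\<bar> \<le> \<bar>c\<bar> * C" for x by (simp add: abs_mult mult_left_mono)
  then have "bounded (range (\<lambda>x. c * \<zeta> x))" by (auto simp: bounded_iff)
  moreover have "\<exists>L. L-lipschitz_on UNIV (\<lambda>x. c * \<zeta> x)"
    using assms unfolding Lip_b_def by (auto intro: lipschitz_on_cmult_real)
  ultimately show ?thesis by (simp add: Lip_b_def)
qed

lemma Lip_b_contraction:
  assumes \<zeta>: "\<zeta> \<in> Lip_b" and T: "\<And>r s. \<bar>T r - T s\<bar> \<le> \<bar>r - s\<bar>"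
  shows "(\<lambda>x. T (\<zeta> x)) \<in> Lip_b"
proof -
  obtain C where C: "\<And>x. \<bar>\<zeta> x\<bar> \<le> C" using \<zeta> Lip_b_bounded by metis
  have "\<bar>T (\<zeta> x)\<bar> \<le> C + \<bar>T 0\<bar>" for x using C[of x] T[of "\<zeta> x" 0] by linarith
  then have "bounded (range (\<lambda>x. T (\<zeta> x)))" by (auto simp: bounded_iff)
  moreover obtain L where L: "L-lipschitz_on UNIV \<zeta>" using \<zeta> by (auto simp: Lip_b_def)
  have "L-lipschitz_on UNIV (\<lambda>x. T (\<zeta> x))"
  proof (rule lipschitz_onI)
    fix x y show "dist (T (\<zeta> x)) (T (\<zeta> y)) \<le> L * dist x y"
      using T[of "\<zeta> x" "\<zeta> y"] lipschitz_onD[OF L, of x y] by (simp add: dist_real_def)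
  qed (use lipschitz_on_nonneg[OF L] in simp)
  ultimately show ?thesis by (auto simp: Lip_b_def)
qed

section \<open>Density in L1 of a finite Borel measure\<close>

text \<open>Membership in the L1 closure of \<open>Lip_b\<close>, phrased with \<epsilon> so that
  limits of approximable functions need no diagonal sequence.\<close>

definition lip_approximable :: "'a::metric_space measure \<Rightarrow> ('a \<Rightarrow> real) \<Rightarrow> bool" where
  "lip_approximable M h \<longleftrightarrow> h \<in> borel_measurable borel \<and>
     (\<forall>\<epsilon>>0. \<exists>\<zeta>\<in>Lip_b. (\<integral>\<^sup>+x. ennreal \<bar>h x - \<zeta> x\<bar> \<partial>M) < ennreal \<epsilon>)"

lemma lip_approximable_limit:
  assumes M: "sets M = sets borel" and h: "h \<in> borel_measurable borel"
    and g: "\<And>n. lip_approximable M (g n)"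
    and lim: "(\<lambda>n::nat. \<integral>\<^sup>+x. ennreal \<bar>h x - g n x\<bar> \<partial>M) \<longlonglongrightarrow> 0"
  shows "lip_approximable M h"
  unfolding lip_approximable_def
proof (intro conjI allI impI h)
  fix \<epsilon> :: real assume "0 < \<epsilon>"
  then have "\<forall>\<^sub>F n in sequentially. (\<integral>\<^sup>+x. ennreal \<bar>h x - g n x\<bar> \<partial>M) < ennreal (\<epsilon> / 2)"
    by (intro order_tendstoD[OF lim]) simp
  then obtain n where n: "(\<integral>\<^sup>+x. ennreal \<bar>h x - g n x\<bar> \<partial>M) < ennreal (\<epsilon> / 2)"
    by (auto simp: eventually_sequentially)
  obtain \<zeta> where \<zeta>: "\<zeta> \<in> Lip_b" "(\<integral>\<^sup>+x. ennreal \<bar>g n x - \<zeta> x\<bar> \<partial>M) < ennreal (\<epsilon> / 2)"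
    using g[of n] \<open>0 < \<epsilon>\<close> unfolding lip_approximable_def by (meson half_gt_zero)
  have [measurable]: "g n \<in> borel_measurable M" "h \<in> borel_measurable M" "\<zeta> \<in> borel_measurable M"
    using g[of n] h \<zeta> M by (auto simp: lip_approximable_def cong: measurable_cong_sets)
  have "(\<integral>\<^sup>+x. ennreal \<bar>h x - \<zeta> x\<bar> \<partial>M) \<le> (\<integral>\<^sup>+x. ennreal \<bar>h x - g n x\<bar> + ennreal \<bar>g n x - \<zeta> x\<bar> \<partial>M)"
    by (intro nn_integral_mono) (simp add: ennreal_plus[symmetric] del: ennreal_plus)
  also have "\<dots> = (\<integral>\<^sup>+x. ennreal \<bar>h x - g n x\<bar> \<partial>M) + (\<integral>\<^sup>+x. ennreal \<bar>g n x - \<zeta> x\<bar> \<partial>M)"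
    by (rule nn_integral_add) auto
  also have "\<dots> < ennreal (\<epsilon> / 2) + ennreal (\<epsilon> / 2)"
    by (rule add_strict_mono[OF n \<zeta>(2)])
  also have "\<dots> = ennreal \<epsilon>" using \<open>0 < \<epsilon>\<close> by (simp add: ennreal_plus[symmetric] del: ennreal_plus)
  finally show "\<exists>\<zeta>\<in>Lip_b. (\<integral>\<^sup>+x. ennreal \<bar>h x - \<zeta> x\<bar> \<partial>M) < ennreal \<epsilon>" using \<zeta>(1) by blast
qed

lemma lip_approximable_Lip_b: "\<zeta> \<in> Lip_b \<Longrightarrow> lip_approximable M \<zeta>"
  unfolding lip_approximable_def by (auto intro!: bexI[of _ \<zeta>])

lemma lip_approximable_add:
  assumes M: "sets M = sets borel" and h: "lip_approximable M h" and g: "lip_approximable M g"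
  shows "lip_approximable M (\<lambda>x. h x + g x)"
  unfolding lip_approximable_def
proof (intro conjI allI impI)
  show "(\<lambda>x. h x + g x) \<in> borel_measurable borel" using h g by (auto simp: lip_approximable_def)
  fix \<epsilon> :: real assume "0 < \<epsilon>"
  obtain \<zeta> \<xi> where \<zeta>: "\<zeta> \<in> Lip_b" "(\<integral>\<^sup>+x. ennreal \<bar>h x - \<zeta> x\<bar> \<partial>M) < ennreal (\<epsilon> / 2)"
     and \<xi>: "\<xi> \<in> Lip_b" "(\<integral>\<^sup>+x. ennreal \<bar>g x - \<xi> x\<bar> \<partial>M) < ennreal (\<epsilon> / 2)"
    using h g \<open>0 < \<epsilon>\<close> unfolding lip_approximable_def by (meson half_gt_zero)
  have [measurable]: "g \<in> borel_measurable M" "h \<in> borel_measurable M" "\<zeta> \<in> borel_measurable M" "\<xi> \<in> borel_measurable M"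
    using g h \<zeta> \<xi> M by (auto simp: lip_approximable_def cong: measurable_cong_sets)
  have "(\<integral>\<^sup>+x. ennreal \<bar>h x + g x - (\<zeta> x + \<xi> x)\<bar> \<partial>M) \<le> (\<integral>\<^sup>+x. ennreal \<bar>h x - \<zeta> x\<bar> + ennreal \<bar>g x - \<xi> x\<bar> \<partial>M)"
    by (intro nn_integral_mono) (simp add: ennreal_plus[symmetric] del: ennreal_plus)
  also have "\<dots> = (\<integral>\<^sup>+x. ennreal \<bar>h x - \<zeta> x\<bar> \<partial>M) + (\<integral>\<^sup>+x. ennreal \<bar>g x - \<xi> x\<bar> \<partial>M)"
    by (rule nn_integral_add) auto
  also have "\<dots> < ennreal (\<epsilon> / 2) + ennreal (\<epsilon> / 2)"
    by (rule add_strict_mono[OF \<zeta>(2) \<xi>(2)])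
  also have "\<dots> = ennreal \<epsilon>" using \<open>0 < \<epsilon>\<close> by (simp add: ennreal_plus[symmetric] del: ennreal_plus)
  finally show "\<exists>\<zeta>\<in>Lip_b. (\<integral>\<^sup>+x. ennreal \<bar>h x + g x - \<zeta> x\<bar> \<partial>M) < ennreal \<epsilon>"
    by (rule bexI[OF _ Lip_b_add[OF \<zeta>(1) \<xi>(1)]])
qed

lemma lip_approximable_cmult:
  assumes M: "sets M = sets borel" and h: "lip_approximable M h"
  shows "lip_approximable M (\<lambda>x. c * h x)"
  unfolding lip_approximable_def
proof (intro conjI allI impI)
  show "(\<lambda>x. c * h x) \<in> borel_measurable borel" using h by (auto simp: lip_approximable_def)
  fix \<epsilon> :: real assume "0 < \<epsilon>"
  then have "0 < \<epsilon> / (\<bar>c\<bar> + 1)" by simp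
  then obtain \<zeta> where \<zeta>: "\<zeta> \<in> Lip_b" "(\<integral>\<^sup>+x. ennreal \<bar>h x - \<zeta> x\<bar> \<partial>M) < ennreal (\<epsilon> / (\<bar>c\<bar> + 1))"
    using h unfolding lip_approximable_def by meson
  have [measurable]: "h \<in> borel_measurable M" "\<zeta> \<in> borel_measurable M"
    using h \<zeta> M by (auto simp: lip_approximable_def cong: measurable_cong_sets)
  have "(\<integral>\<^sup>+x. ennreal \<bar>c * h x - c * \<zeta> x\<bar> \<partial>M) = (\<integral>\<^sup>+x. ennreal \<bar>c\<bar> * ennreal \<bar>h x - \<zeta> x\<bar> \<partial>M)"
    by (simp add: ennreal_mult[symmetric] abs_mult[symmetric] right_diff_distrib)
  also have "\<dots> = ennreal \<bar>c\<bar> * (\<integral>\<^sup>+x. ennreal \<bar>h x - \<zeta> x\<bar> \<partial>M)" by (rule nn_integral_cmult) simp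
  also have "\<dots> \<le> ennreal \<bar>c\<bar> * ennreal (\<epsilon> / (\<bar>c\<bar> + 1))" using \<zeta> by (intro mult_left_mono) auto
  also have "\<dots> = ennreal (\<bar>c\<bar> * (\<epsilon> / (\<bar>c\<bar> + 1)))" using \<open>0 < \<epsilon>\<close> by (intro ennreal_mult[symmetric]) auto
  also have "\<dots> < ennreal \<epsilon>"
  proof (rule ennreal_lessI)
    show "\<bar>c\<bar> * (\<epsilon> / (\<bar>c\<bar> + 1)) < \<epsilon>" using \<open>0 < \<epsilon>\<close> by (simp add: field_simps)
  qed fact
  finally show "\<exists>\<zeta>\<in>Lip_b. (\<integral>\<^sup>+x. ennreal \<bar>c * h x - \<zeta> x\<bar> \<partial>M) < ennreal \<epsilon>"
    by (rule bexI[OF _ Lip_b_cmult[OF \<zeta>(1)]])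
qed

lemma lip_approximable_indicator_empty: "lip_approximable M (indicator {})"
proof -
  have "(indicator {} :: 'a \<Rightarrow> real) = (\<lambda>_. 0)" by (simp add: fun_eq_iff)
  then show ?thesis using lip_approximable_Lip_b[OF Lip_b_const[of 0]] by metis
qed

lemma lip_approximable_indicator_closed:
  fixes F :: "'a::metric_space set"
  assumes M: "sets M = sets borel" "finite_measure M" and F: "closed F"
  shows "lip_approximable M (indicator F)"
\<comment> \<open>\<open>infdist\<close> to the empty set is 0, so the cut-offs used below would not
  tend to its indicator.\<close>
proof (cases "F = {}")
  case True
  then show ?thesis by (simp add: lip_approximable_indicator_empty)
next
  case False
  interpret finite_measure M by fact
  \<comment> \<open>Lipschitz cut-offs that decrease to the indicator of F, since a point off a
    nonempty closed set has positive distance from it.\<close>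
  define \<zeta> where "\<zeta> n x = max 0 (1 - real n * infdist x F)" for n x
  have \<zeta>_Lip: "\<zeta> n \<in> Lip_b" for n
  proof -
    have "\<bar>\<zeta> n x\<bar> \<le> 1" for x using infdist_nonneg[of x F] by (simp add: \<zeta>_def)
    then have "bounded (range (\<zeta> n))" by (auto simp: bounded_iff)
    moreover have "(real n)-lipschitz_on UNIV (\<zeta> n)"
    proof (rule lipschitz_onI)
      fix x y
      have "real n * \<bar>infdist x F - infdist y F\<bar> \<le> real n * dist x y"
        using infdist_triangle_abs[of x F y] by (intro mult_left_mono) auto
      then have "\<bar>real n * infdist x F - real n * infdist y F\<bar> \<le> real n * dist x y"
        by (simp add: abs_mult right_diff_distrib[symmetric])
      then show "dist (\<zeta> n x) (\<zeta> n y) \<le> real n * dist x y"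
        unfolding \<zeta>_def dist_real_def by linarith
    qed simp
    ultimately show ?thesis by (auto simp: Lip_b_def)
  qed
  have [measurable]: "\<And>n. \<zeta> n \<in> borel_measurable M" "F \<in> sets M"
    using \<zeta>_Lip F M by (auto cong: measurable_cong_sets intro: borel_measurable_Lip_b)
  have "(\<lambda>n. \<integral>\<^sup>+x. ennreal \<bar>indicator F x - \<zeta> n x\<bar> \<partial>M) \<longlonglongrightarrow> (\<integral>\<^sup>+x. 0 \<partial>M)"
  proof (rule nn_integral_dominated_convergence[where w = "\<lambda>_. 1"])
    show "(\<integral>\<^sup>+x. 1 \<partial>M) < \<infinity>" using emeasure_finite by (simp add: less_top[symmetric])
    show "AE x in M. (\<lambda>n. ennreal \<bar>indicator F x - \<zeta> n x\<bar>) \<longlonglongrightarrow> 0"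
    proof (rule AE_I2)
      fix x
      have "\<forall>\<^sub>F n in sequentially. \<bar>indicator F x - \<zeta> n x\<bar> = 0"
      proof (cases "x \<in> F")
        case True
        then show ?thesis by (simp add: \<zeta>_def)
      next
        case x: False
        then have pos: "0 < infdist x F"
          using F False infdist_pos_not_in_closed by blast
        obtain N :: nat where "1 / infdist x F < real N" using reals_Archimedean2 by blast
        then have N: "1 < real N * infdist x F" using pos by (simp add: field_simps)
        have "\<bar>indicator F x - \<zeta> n x\<bar> = 0" if "N \<le> n" for n
        proof -
          have "real N * infdist x F \<le> real n * infdist x F" using that pos by (intro mult_right_mono) auto
          with N x show ?thesis by (simp add: \<zeta>_def)
        qed
        then show ?thesis by (auto simp: eventually_sequentially)
      qed
      then have "\<forall>\<^sub>F n in sequentially. ennreal \<bar>indicator F x - \<zeta> n x\<bar> = 0" by eventually_elim simp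
      then show "(\<lambda>n. ennreal \<bar>indicator F x - \<zeta> n x\<bar>) \<longlonglongrightarrow> 0" by (rule tendsto_eventually)
    qed
    show "AE x in M. ennreal \<bar>indicator F x - \<zeta> n x\<bar> \<le> 1" for n
      using infdist_nonneg[of _ F] by (intro AE_I2) (auto simp: \<zeta>_def split: split_indicator)
  qed auto
  then show ?thesis
    using F by (intro lip_approximable_limit[OF M(1) _ lip_approximable_Lip_b[OF \<zeta>_Lip]]) auto
qed

text \<open>Dynkin argument over the intersection-stable class of closed sets. Disjoint unions pass
  to the limit by dominated convergence, the measure being finite.\<close>

lemma lip_approximable_indicator:
  fixes A :: "'a::metric_space set"
  assumes M: "sets M = sets borel" "finite_measure M" and A: "A \<in> sets borel"
  shows "lip_approximable M (indicator A)"
proof -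
  interpret finite_measure M by fact
  have "Int_stable (Collect closed :: 'a set set)" "Collect closed \<subseteq> Pow (UNIV :: 'a set)"
    "A \<in> sigma_sets UNIV (Collect closed)"
    using A by (auto simp: Int_stable_def borel_eq_closed)
  then show ?thesis
  proof (induction rule: sigma_sets_induct_disjoint)
    case (basic A)
    then show ?case using lip_approximable_indicator_closed[OF M] by simp
  next
    case empty
    show ?case by (rule lip_approximable_indicator_empty)
  next
    case (compl A)
    have "lip_approximable M (\<lambda>x. 1 + (-1) * indicator A x)"
      by (rule lip_approximable_add[OF M(1) lip_approximable_Lip_b[OF Lip_b_const]
            lip_approximable_cmult[OF M(1) compl(2)]])
    moreover have "(\<lambda>x. 1 + (-1) * indicator A x :: real) = indicator (UNIV - A)"
      by (auto split: split_indicator)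
    ultimately show ?case by simp
  next
    case (union A)
    have A: "\<And>i. A i \<in> sets borel" using union by (auto simp: borel_eq_closed)
    have fin: "lip_approximable M (\<lambda>x. \<Sum>i<n. indicator (A i) x)" for n
    proof (induction n)
      case 0
      then show ?case using lip_approximable_Lip_b[OF Lip_b_const[of 0]] by simp
    next
      case (Suc n)
      then show ?case using union by (simp add: lip_approximable_add M)
    qed
    have eq: "(\<Sum>i<n. indicator (A i) x) = (indicator (\<Union>i<n. A i) x :: real)" for n x
      using union(1) by (subst indicator_UN_disjoint) (auto simp: disjoint_family_on_def)
    have "(\<lambda>n. \<integral>\<^sup>+x. ennreal \<bar>indicator (\<Union>i. A i) x - (\<Sum>i<n. indicator (A i) x)\<bar> \<partial>M) \<longlonglongrightarrow> (\<integral>\<^sup>+x. 0 \<partial>M)"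
    proof (rule nn_integral_dominated_convergence[where w = "\<lambda>_. 1"])
      show "(\<integral>\<^sup>+x. 1 \<partial>M) < \<infinity>" using emeasure_finite by (simp add: less_top[symmetric])
      show "AE x in M. (\<lambda>n. ennreal \<bar>indicator (\<Union>i. A i) x - (\<Sum>i<n. indicator (A i) x)\<bar>) \<longlonglongrightarrow> 0"
      proof (rule AE_I2)
        fix x
        have "\<exists>N. \<forall>n\<ge>N. indicator (\<Union>i. A i) x = (indicator (\<Union>i<n. A i) x :: real)"
        proof (cases "x \<in> (\<Union>i. A i)")
          case True
          then obtain i where "x \<in> A i" by auto
          then show ?thesis by (intro exI[of _ "Suc i"]) (auto split: split_indicator)
        qed (auto split: split_indicator)
        then have "\<forall>\<^sub>F n in sequentially. ennreal \<bar>indicator (\<Union>i. A i) x - (\<Sum>i<n. indicator (A i) x)\<bar> = 0"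
          unfolding eq eventually_sequentially by force
        then show "(\<lambda>n. ennreal \<bar>indicator (\<Union>i. A i) x - (\<Sum>i<n. indicator (A i) x)\<bar>) \<longlonglongrightarrow> 0"
          by (rule tendsto_eventually)
      qed
      show "AE x in M. ennreal \<bar>indicator (\<Union>i. A i) x - (\<Sum>i<n. indicator (A i) x)\<bar> \<le> 1" for n
        unfolding eq by (intro AE_I2) (auto split: split_indicator)
    qed (use A M in \<open>auto cong: measurable_cong_sets\<close>)
    then show ?case
      using A by (intro lip_approximable_limit[OF M(1) _ fin]) auto
  qed
qed

theorem Lip_b_dense_L1:
  fixes h :: "'a::metric_space \<Rightarrow> real"
  assumes M: "sets M = sets borel" "finite_measure M" and h: "integrable M h"
  shows "lip_approximable M h"
  using h
proof (induction rule: integrable_induct)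
  case (base A c)
  have "lip_approximable M (\<lambda>x. c * indicator A x)"
    using base M by (intro lip_approximable_cmult lip_approximable_indicator) auto
  then show ?case by (simp add: mult.commute)
next
  case (add f g)
  then show ?case by (intro lip_approximable_add M)
next
  case (lim f s)
  have [measurable]: "\<And>i. s i \<in> borel_measurable M" "f \<in> borel_measurable M" using lim by auto
  have "(\<lambda>n. \<integral>\<^sup>+x. ennreal (norm (f x - s n x)) \<partial>M) \<longlonglongrightarrow> (\<integral>\<^sup>+x. 0 \<partial>M)"
  \<comment> \<open>The simple approximants are at most twice |f|, so their distance from f is at
    most three times |f|.\<close>
  proof (rule nn_integral_dominated_convergence[where w = "\<lambda>x. ennreal (3 * norm (f x))"])
    show "(\<integral>\<^sup>+x. ennreal (3 * norm (f x)) \<partial>M) < \<infinity>"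
      using \<open>integrable M f\<close> by (simp add: ennreal_mult nn_integral_cmult integrable_iff_bounded ennreal_mult_less_top)
    show "AE x in M. ennreal (norm (f x - s n x)) \<le> ennreal (3 * norm (f x))" for n
    proof (rule AE_I2)
      fix x assume "x \<in> space M"
      from \<open>\<And>i x. x \<in> space M \<Longrightarrow> norm (s i x) \<le> 2 * norm (f x)\<close>[OF this, of n] show "ennreal (norm (f x - s n x)) \<le> ennreal (3 * norm (f x))"
        unfolding real_norm_def by (intro ennreal_leI) linarith
    qed
    show "AE x in M. (\<lambda>n. ennreal (norm (f x - s n x))) \<longlonglongrightarrow> 0"
    proof (rule AE_I2)
      fix x assume "x \<in> space M"
      then have "(\<lambda>n. norm (f x - s n x)) \<longlonglongrightarrow> norm (f x - f x)" using \<open>\<And>x. x \<in> space M \<Longrightarrow> (\<lambda>i. s i x) \<longlonglongrightarrow> f x\<close> by (intro tendsto_intros)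
      then show "(\<lambda>n. ennreal (norm (f x - s n x))) \<longlonglongrightarrow> 0"
        using tendsto_ennrealI by fastforce
    qed
  qed auto
  then show ?case
    using \<open>\<And>i. lip_approximable M (s i)\<close> M by (intro lip_approximable_limit[OF M(1), of f s]) (auto cong: measurable_cong_sets)
qed

section \<open>A one-sided fundamental theorem of calculus\<close>

text \<open>Fatou's lemma applied to the difference quotients of \<open>W\<close>; the linear lower bound with the
  large constant \<open>B\<close> supplies the integrable minorant.\<close>

lemma decrease_le_integral_of_lower_derivative:
  fixes W k :: "real \<Rightarrow> real"
  assumes ab: "a < b" and B: "1 \<le> B"
    and W [measurable]: "W \<in> borel_measurable borel" and WM: "\<And>s. \<bar>W s\<bar> \<le> M"
    and k: "integrable lborel k" and k0: "\<And>s. 0 \<le> k s"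
    and lin: "AE s in lborel. s \<in> {a..b} \<longrightarrow> (\<forall>r\<in>{s..b}. - (B * k s * (r - s)) \<le> W r - W s)"
    and der: "AE s in lborel. s \<in> {a..<b} \<longrightarrow> (\<forall>\<epsilon>>0. \<forall>\<^sub>F r in at_right s. - ((k s + \<epsilon>) * (r - s)) \<le> W r - W s)"
    and lsc: "\<And>\<epsilon>. 0 < \<epsilon> \<Longrightarrow> \<forall>\<^sub>F r in at_right a. W a - \<epsilon> \<le> W r"
  shows "W a - W b \<le> (LINT s|lborel. indicator {a..b} s * k s)"
proof (rule field_le_epsilon)
  fix \<epsilon> :: real assume \<epsilon>: "0 < \<epsilon>"
  have [measurable]: "k \<in> borel_measurable borel" using k by simp
  have W_int: "integrable lborel (\<lambda>s. indicator S s * W s)" if "S \<in> sets borel" "S \<subseteq> {a..b}" for S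
  proof (rule Bochner_Integration.integrable_bound[of lborel "\<lambda>s. M * indicator {a..b} s"])
    show "AE s in lborel. norm (indicator S s * W s) \<le> norm (M * indicator {a..b} s)"
    proof (rule AE_I2)
      fix s
      show "norm (indicator S s * W s) \<le> norm (M * indicator {a..b} s)"
        using WM[of s] that(2) by (auto split: split_indicator)
    qed
  qed (use that ab in \<open>auto intro!: integrable_real_indicator\<close>)
  have k_int: "integrable lborel (\<lambda>s. indicator S s * k s)" if "S \<in> sets borel" for S
    using integrable_real_mult_indicator[of S lborel k] that k by (simp add: mult.commute)
  \<comment> \<open>Positive steps tending to 0, kept below b - a so that the splittings of the
    interval below make sense.\<close>
  define h where "h n = (b - a) / 2 * inverse (real (Suc n))" for n :: nat
  have h: "0 < h n" "h n < b - a" for n 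
  proof -
    have "inverse (real (Suc n)) \<le> 1" by (simp add: field_simps)
    then have "(b - a) / 2 * inverse (real (Suc n)) \<le> (b - a) / 2 * 1" using ab by (intro mult_left_mono) auto
    then have "h n \<le> (b - a) / 2 * 1" unfolding h_def .
    also have "\<dots> < b - a" using ab by (simp add: field_simps)
    finally show "h n < b - a" .
    show "0 < h n" using ab by (simp add: h_def)
  qed
  have "h \<longlonglongrightarrow> 0"
    unfolding h_def using LIMSEQ_inverse_real_of_nat by (rule tendsto_mult_right_zero)
  have h_lim: "filterlim (\<lambda>n. s + h n) (at_right s) sequentially" for s
  proof -
    have "(\<lambda>n. s + h n) \<longlonglongrightarrow> s + 0" by (intro tendsto_intros \<open>h \<longlonglongrightarrow> 0\<close>)
    moreover have "h n \<noteq> 0" for n using h(1)[of n] by simp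
    ultimately show ?thesis using h(1) by (simp add: filterlim_at)
  qed
  \<comment> \<open>Adding B * k makes the forward difference quotient nonnegative by
    \<open>lin\<close>, as Fatou's lemma demands.\<close>
  define f where "f n s = indicator {a..b - h n} s * ((W (s + h n) - W s) / h n + B * k s)" for n s
  have [measurable]: "f n \<in> borel_measurable borel" for n unfolding f_def by measurable
  have f_nonneg: "AE s in lborel. 0 \<le> f n s" for n
    using lin
  proof eventually_elim
    case (elim s)
    show ?case
    proof (cases "s \<in> {a..b - h n}")
      case True
      then have "s \<in> {a..b}" "s + h n \<in> {s..b}" using h(1)[of n] by auto
      with elim have "- (B * k s * h n) \<le> W (s + h n) - W s" by fastforce
      then have "- (B * k s) \<le> (W (s + h n) - W s) / h n" using h(1)[of n] by (simp add: field_simps)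
      then show ?thesis by (simp add: f_def)
    qed (simp add: f_def)
  qed
  define X where "X n = (LINT s|lborel. f n s)" for n
  let ?K = "LINT s|lborel. indicator {a..b} s * k s"
  have shift: "integrable lborel (\<lambda>s. indicator {a..b - h n} s * W (s + h n))"
    "(LINT s|lborel. indicator {a..b - h n} s * W (s + h n)) = (LINT s|lborel. indicator {a + h n..b} s * W s)" for n
  proof -
    have eq: "indicator {a + h n..b} (h n + 1 * s) * W (h n + 1 * s) = indicator {a..b - h n} s * W (s + h n)" for s
      by (auto split: split_indicator simp: add.commute)
    show "integrable lborel (\<lambda>s. indicator {a..b - h n} s * W (s + h n))"
      using lborel_integrable_real_affine[OF W_int[of "{a + h n..b}"], of 1 "h n"] h(1)[of n] unfolding eq by simp
    show "(LINT s|lborel. indicator {a..b - h n} s * W (s + h n)) = (LINT s|lborel. indicator {a + h n..b} s * W s)"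
      using lborel_integral_real_affine[of 1 "\<lambda>s. indicator {a + h n..b} s * W s" "h n"] unfolding eq by simp
  qed
  have f_eq: "f n = (\<lambda>s. (1 / h n) * (indicator {a..b - h n} s * W (s + h n) - indicator {a..b - h n} s * W s)
      + B * (indicator {a..b - h n} s * k s))" for n
    by (auto simp: f_def fun_eq_iff field_simps)
  have f_int: "integrable lborel (f n)" for n
    unfolding f_eq using shift W_int[of "{a..b - h n}"] k_int h(1)[of n] by auto
  have "\<forall>\<^sub>F r in at_right a. W a - \<epsilon> \<le> W r" by (rule lsc[OF \<epsilon>])
  then obtain \<eta> where \<eta>: "a < \<eta>" "\<And>r. a < r \<Longrightarrow> r < \<eta> \<Longrightarrow> W a - \<epsilon> \<le> W r"
    by (auto simp: eventually_at_right_field)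
  have "\<forall>\<^sub>F n in sequentially. h n < \<eta> - a"
    using \<open>h \<longlonglongrightarrow> 0\<close> \<eta>(1) by (intro order_tendstoD) auto
  \<comment> \<open>By translation the integral of the difference quotient collapses to the mean of
    W over the last stretch of length h n minus its mean over the first one.\<close>
  then have X_le: "\<forall>\<^sub>F n in sequentially. X n \<le> W b - W a + \<epsilon> + B * ?K"
  proof eventually_elim
    case (elim n)
    have split1: "(LINT s|lborel. indicator {a + h n..b} s * W s) + (LINT s|lborel. indicator {a..<a + h n} s * W s)
       = (LINT s|lborel. indicator {a..b} s * W s)"
      using h[of n] by (subst Bochner_Integration.integral_add[symmetric])
        (auto intro!: W_int Bochner_Integration.integral_cong split: split_indicator)
    have split2: "(LINT s|lborel. indicator {a..b - h n} s * W s) + (LINT s|lborel. indicator {b - h n<..b} s * W s)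
       = (LINT s|lborel. indicator {a..b} s * W s)"
      using h[of n] by (subst Bochner_Integration.integral_add[symmetric])
        (auto intro!: W_int Bochner_Integration.integral_cong split: split_indicator)
    have split3: "(LINT s|lborel. indicator {a..b - h n} s * k s) + (LINT s|lborel. indicator {b - h n<..b} s * k s) = ?K"
      using h[of n] by (subst Bochner_Integration.integral_add[symmetric])
        (auto intro!: k_int Bochner_Integration.integral_cong split: split_indicator)
    have "integrable lborel (\<lambda>s. indicator {b - h n<..b} s * W s)"
      by (rule W_int) (use h[of n] in auto)
    \<comment> \<open>The mean near b is bounded by \<open>lin\<close> with r = b. The resulting
      error supplies the part of the integral of B * k over the last stretch, which f n
      omits.\<close>
    then have "(LINT s|lborel. indicator {b - h n<..b} s * W s) \<le>
        (LINT s|lborel. W b * indicator {b - h n<..b} s + h n * B * (indicator {b - h n<..b} s * k s))"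
    proof (rule integral_mono_AE)
      show "AE s in lborel. indicator {b - h n<..b} s * W s \<le> 
          W b * indicator {b - h n<..b} s + h n * B * (indicator {b - h n<..b} s * k s)"
        using lin
      proof eventually_elim
        case (elim s)
        show ?case
        proof (cases "s \<in> {b - h n<..b}")
          case True
          then have "- (B * k s * (b - s)) \<le> W b - W s" using elim h[of n] by auto
          moreover have "B * k s * (b - s) \<le> B * k s * h n"
            using True B k0 by (intro mult_left_mono) auto
          ultimately show ?thesis using True by (simp add: mult_ac)
        qed simp
      qed
    qed (use h[of n] k_int in auto)
    also have "\<dots> = h n * (W b + B * (LINT s|lborel. indicator {b - h n<..b} s * k s))"
      using h[of n] k_int[of "{b - h n<..b}"] by (simp add: algebra_simps)
    finally have up: "(1 / h n) * (LINT s|lborel. indicator {b - h n<..b} s * W s) \<le>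
        W b + B * (LINT s|lborel. indicator {b - h n<..b} s * k s)"
      using h(1)[of n] by (simp add: field_simps)
    \<comment> \<open>The mean near a is subtracted, so a lower bound suffices, and
      \<open>lsc\<close> provides it.\<close>
    have "h n * (W a - \<epsilon>) = (LINT s|lborel. (W a - \<epsilon>) * indicator {a..<a + h n} s)"
      using h[of n] by simp
    also have "\<dots> \<le> (LINT s|lborel. indicator {a..<a + h n} s * W s)"
    proof (rule integral_mono)
      fix s
      have "W a - \<epsilon> \<le> W s" if "s \<in> {a..<a + h n}"
        using that \<eta>(2)[of s] elim \<epsilon> by (cases "s = a") auto
      then show "(W a - \<epsilon>) * indicator {a..<a + h n} s \<le> indicator {a..<a + h n} s * W s"
        by (auto split: split_indicator)
    qed (use h[of n] in \<open>auto intro!: W_int\<close>)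
    finally have lo: "W a - \<epsilon> \<le> (1 / h n) * (LINT s|lborel. indicator {a..<a + h n} s * W s)"
      using h(1)[of n] by (simp add: field_simps)
    have "X n = (1 / h n) * ((LINT s|lborel. indicator {a + h n..b} s * W s) - (LINT s|lborel. indicator {a..b - h n} s * W s))
        + B * (LINT s|lborel. indicator {a..b - h n} s * k s)"
      unfolding X_def f_eq shift(2)[symmetric]
      using shift(1) W_int[of "{a..b - h n}"] k_int[of "{a..b - h n}"] h(1)[of n]
      by (subst Bochner_Integration.integral_add) (auto simp: diff_divide_distrib)
    also have "\<dots> = (1 / h n) * ((LINT s|lborel. indicator {b - h n<..b} s * W s) - (LINT s|lborel. indicator {a..<a + h n} s * W s))
        + B * (LINT s|lborel. indicator {a..b - h n} s * k s)"
    proof -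
      have "(LINT s|lborel. indicator {a + h n..b} s * W s) - (LINT s|lborel. indicator {a..b - h n} s * W s) =
        (LINT s|lborel. indicator {b - h n<..b} s * W s) - (LINT s|lborel. indicator {a..<a + h n} s * W s)"
        using split1 split2 by linarith
      then show ?thesis by simp
    qed
    also have "\<dots> = (1 / h n) * (LINT s|lborel. indicator {b - h n<..b} s * W s) -
        (1 / h n) * (LINT s|lborel. indicator {a..<a + h n} s * W s)
        + B * (LINT s|lborel. indicator {a..b - h n} s * k s)"
      by (simp only: right_diff_distrib)
    also have "\<dots> \<le> W b - W a + \<epsilon> + B * ?K"
      using up lo split3[symmetric] by (simp add: distrib_left)
    finally show ?case .
  qed
  have X_nonneg: "0 \<le> X n" for n
    unfolding X_def by (intro integral_nonneg_AE f_nonneg)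
  have rhs: "0 \<le> W b - W a + \<epsilon> + B * ?K"
    using X_le X_nonneg by (auto simp: eventually_sequentially intro: order_trans)
  \<comment> \<open>The pointwise lower limit of f n is at least (B - 1) * k, while its integrals
    stay below W b - W a + \<epsilon> + B * ?K. The large constant cancels and leaves a single
    ?K.\<close>
  have "ennreal ((B - 1) * ?K) = (\<integral>\<^sup>+s. ennreal ((B - 1) * (indicator {a..b} s * k s)) \<partial>lborel)"
    using k_int[of "{a..b}"] B k0 by (subst nn_integral_eq_integral) (auto intro!: AE_I2 mult_nonneg_nonneg)
  also have "\<dots> \<le> (\<integral>\<^sup>+s. liminf (\<lambda>n. ennreal (f n s)) \<partial>lborel)"
  proof (rule nn_integral_mono_AE)
    have "AE s in lborel. s \<noteq> b" by (rule AE_lborel_singleton)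
    with der show "AE s in lborel. ennreal ((B - 1) * (indicator {a..b} s * k s)) \<le> liminf (\<lambda>n. ennreal (f n s))"
    proof eventually_elim
      case (elim s)
      show ?case
      proof (cases "s \<in> {a..<b}")
        case True
        show ?thesis
        proof (rule ennreal_le_epsilon)
          fix e :: real assume e: "0 < e"
          have "\<forall>\<^sub>F r in at_right s. - ((k s + e) * (r - s)) \<le> W r - W s" using elim True e by blast
          then have "\<forall>\<^sub>F n in sequentially. - ((k s + e) * (s + h n - s)) \<le> W (s + h n) - W s"
            using h_lim[of s] by (rule eventually_compose_filterlim)
          moreover have "\<forall>\<^sub>F n in sequentially. h n < b - s"
            using \<open>h \<longlonglongrightarrow> 0\<close> True by (intro order_tendstoD) auto
          ultimately have "\<forall>\<^sub>F n in sequentially. ennreal ((B - 1) * k s - e) \<le> ennreal (f n s)"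
          proof eventually_elim
            case (elim n)
            then have "- (k s + e) \<le> (W (s + h n) - W s) / h n" using h(1)[of n] by (simp add: field_simps)
            then show ?case using True elim by (intro ennreal_leI) (simp add: f_def algebra_simps)
          qed
          then have "ennreal ((B - 1) * k s - e) \<le> liminf (\<lambda>n. ennreal (f n s))"
            by (rule Liminf_bounded)
          moreover have "ennreal ((B - 1) * k s) \<le> ennreal ((B - 1) * k s - e) + ennreal e"
            using e by (cases "e \<le> (B - 1) * k s") (auto simp: ennreal_plus[symmetric] ennreal_neg intro!: ennreal_leI simp del: ennreal_plus)
          ultimately show "ennreal ((B - 1) * (indicator {a..b} s * k s)) \<le> liminf (\<lambda>n. ennreal (f n s)) + ennreal e"
            using True by (simp add: order_trans[OF _ add_right_mono])
        qed
      qed (use elim in auto)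
    qed
  qed
  also have "\<dots> \<le> liminf (\<lambda>n. \<integral>\<^sup>+s. ennreal (f n s) \<partial>lborel)"
    by (intro nn_integral_liminf) simp
  also have "\<dots> = liminf (\<lambda>n. ennreal (X n))"
    unfolding X_def using f_int f_nonneg by (simp add: nn_integral_eq_integral)
  also have "\<dots> \<le> limsup (\<lambda>n. ennreal (X n))" by (intro Liminf_le_Limsup) simp
  also have "\<dots> \<le> ennreal (W b - W a + \<epsilon> + B * ?K)"
    using X_le by (intro Limsup_bounded) (auto elim!: eventually_mono intro: ennreal_leI)
  finally have "(B - 1) * ?K \<le> W b - W a + \<epsilon> + B * ?K" using rhs by (simp add: ennreal_le_iff)
  then show "W a - W b \<le> ?K + \<epsilon>" by (simp add: algebra_simps)
qed

section \<open>Young's inequality for fluxes\<close>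

lemma ennreal_half_mult_2: "(1 / 2) * (2 * x) = (x :: ennreal)"
proof -
  have "(1 / 2 :: ennreal) * 2 = 2 / 2" by (simp add: ennreal_divide_times)
  also have "\<dots> = 1" by (rule ennreal_divide_self) auto
  finally have "(1 / 2 :: ennreal) * 2 = 1" .
  then show ?thesis by (metis mult.assoc mult_1)
qed

lemma ennreal_half: "0 \<le> x \<Longrightarrow> (1 / 2) * ennreal x = ennreal (x / 2)"
proof -
  assume "0 \<le> x"
  then have "(1 / 2) * ennreal x = (1 / 2) * (2 * ennreal (x / 2))"
    by (simp add: ennreal_mult[symmetric] flip: ennreal_numeral)
  then show ?thesis by (simp only: ennreal_half_mult_2)
qed

lemma scale_measure_eq_density: "scale_measure c M = density M (\<lambda>_. c)"
  by (rule measure_eqI) (auto simp: emeasure_density nn_integral_cmult)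

lemma flux_variation_simps:
  assumes "j \<in> sigma_finite_fluxes"
  shows "sets (fst j) = sets borel" "sets (snd j) = sets borel" "sets (flux_variation j) = sets borel"
    "space (fst j) = UNIV" "space (snd j) = UNIV" "space (flux_variation j) = UNIV"
proof -
  show 1: "sets (fst j) = sets borel" and 2: "sets (snd j) = sets borel"
    using assms by (auto simp: sigma_finite_fluxes_def)
  then show 3: "sets (flux_variation j) = sets borel" by (simp add: flux_variation_def)
  from 1 2 3 show "space (fst j) = UNIV" "space (snd j) = UNIV" "space (flux_variation j) = UNIV"
    by (auto dest: sets_eq_imp_space_eq)
qed

lemma emeasure_flux_variation:
  assumes "j \<in> sigma_finite_fluxes" "B \<in> sets borel"
  shows "emeasure (flux_variation j) B = emeasure (fst j) B + emeasure (snd j) B"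
  using assms flux_variation_simps[OF assms(1)] unfolding flux_variation_def
  by (simp add: emeasure_measure_add)

lemma nn_integral_flux_variation:
  assumes "j \<in> sigma_finite_fluxes" "f \<in> borel_measurable borel"
  shows "(\<integral>\<^sup>+z. f z \<partial>flux_variation j) = (\<integral>\<^sup>+z. f z \<partial>fst j) + (\<integral>\<^sup>+z. f z \<partial>snd j)"
  using assms flux_variation_simps[OF assms(1)] unfolding flux_variation_def
  by (intro nn_integral_measure_add) (auto cong: measurable_cong_sets)

context jump_space
begin

lemma borel_measurable_density_wrt [measurable]: "density_wrt \<pi> \<rho> \<in> borel_measurable borel"
proof -
  have "RN_deriv \<pi> \<rho> \<in> borel_measurable borel"
    using borel_measurable_RN_deriv[of \<pi> \<rho>] by (simp cong: measurable_cong_sets)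
  then have "(\<lambda>z. enn2real (RN_deriv \<pi> \<rho> z)) \<in> borel_measurable borel" by measurable
  then show ?thesis unfolding density_wrt_def[abs_def] .
qed

lemma density_wrt_nonneg: "0 \<le> density_wrt \<pi> \<rho> x"
  by (simp add: density_wrt_def)

lemma grad_measurable [measurable]:
  assumes [measurable]: "\<zeta> \<in> borel_measurable borel"
  shows "grad \<zeta> \<in> borel_measurable (borel :: ('a \<times> 'a) measure)"
proof -
  have "grad \<zeta> = (\<lambda>z. \<zeta> (snd z) - \<zeta> (fst z))" by (auto simp: grad_def)
  then show ?thesis by simp
qed

lemma offdiag_measurable [measurable]: "offdiag \<in> sets (borel :: ('a \<times> 'a) measure)"
proof -
  have "offdiag = {z :: 'a \<times> 'a. 0 < dist (fst z) (snd z)}" by (auto simp: offdiag_def)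
  moreover have "open {z :: 'a \<times> 'a. 0 < dist (fst z) (snd z)}"
    by (intro open_Collect_less continuous_intros)
  ultimately show ?thesis by simp
qed

lemma grad_offdiag: "indicator offdiag z * grad \<zeta> z = grad \<zeta> z"
  by (auto simp: offdiag_def grad_def split: split_indicator)

lemma borel_measurable_edge_mobility:
  assumes "mobility \<alpha>" and [measurable]: "u \<in> borel_measurable borel" and "\<And>x. 0 \<le> u x"
  shows "(\<lambda>z :: 'a \<times> 'a. \<alpha> (u (fst z)) (u (snd z))) \<in> borel_measurable borel"
  using assms by (intro borel_measurable_mobility[OF assms(1)]) auto

text \<open>Write twice the flux as w times \<nu>. Mutual singularity of the two parts excludes
  cancellation, so |w| is the density of twice the variation; Young's inequality for w and f is
  integrated against \<nu>, and the factor 2 meets the factor 1/2 in \<open>dissipation\<close>. If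
  absolute continuity fails, the right side is infinite.\<close>

theorem flux_young:
  assumes \<psi>: "dual_dissipation_density \<psi>s" and \<alpha>: "mobility \<alpha>"
    and j: "j \<in> sigma_finite_fluxes" and f [measurable]: "f \<in> borel_measurable borel"
  shows "(\<integral>\<^sup>+z. ennreal \<bar>f z\<bar> \<partial>flux_variation j) \<le> dissipation \<pi> \<kappa> \<psi>s \<alpha> \<rho> j +
    (1/2) * (\<integral>\<^sup>+z. ennreal (\<psi>s (f z) * \<alpha> (density_wrt \<pi> \<rho> (fst z)) (density_wrt \<pi> \<rho> (snd z))) \<partial>edges)"
proof (cases "absolutely_continuous (mobility_measure \<pi> \<kappa> \<alpha> \<rho>) (flux_variation j)")
  case False
  then show ?thesis by (simp add: dissipation_def Let_def)
next
  case ac: True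
  define a where "a z = \<alpha> (density_wrt \<pi> \<rho> (fst z)) (density_wrt \<pi> \<rho> (snd z))" for z
  have [measurable]: "a \<in> borel_measurable borel"
    unfolding a_def[abs_def] by (intro borel_measurable_edge_mobility[OF \<alpha>] borel_measurable_density_wrt density_wrt_nonneg)
  have a_nonneg: "0 \<le> a z" for z
    unfolding a_def by (intro mobility_nonneg[OF \<alpha>] density_wrt_nonneg)
  have [measurable]: "\<psi>s \<in> borel_measurable borel" "convex_conjugate \<psi>s \<in> borel_measurable borel"
    using borel_measurable_dual_dissipation[OF \<psi>] borel_measurable_convex_conjugate[OF \<psi>] .
  define \<nu> where "\<nu> = mobility_measure \<pi> \<kappa> \<alpha> \<rho>"
  have \<nu>: "\<nu> = density edges (\<lambda>z. ennreal (a z))"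
    by (simp add: \<nu>_def mobility_measure_def a_def[abs_def] case_prod_beta')
  have sets_\<nu> [simp, measurable_cong]: "sets \<nu> = sets borel" by (simp add: \<nu>)
  have "sigma_finite_measure \<nu>"
    unfolding \<nu> by (subst edges.sigma_finite_iff_density_finite) auto
  then interpret \<nu>: sigma_finite_measure \<nu> .
  note js = flux_variation_simps[OF j]
  define P where "P = scale_measure 2 (fst j)"
  define Q where "Q = scale_measure 2 (snd j)"
  have PQ_sets [simp, measurable_cong]: "sets P = sets borel" "sets Q = sets borel"
    using js by (simp_all add: P_def Q_def)
  have null: "emeasure (fst j) B = 0 \<and> emeasure (snd j) B = 0" if "B \<in> null_sets \<nu>" for B
  proof -
    have "B \<in> null_sets (flux_variation j)"
      using ac that by (auto simp: absolutely_continuous_def \<nu>_def)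
    moreover have "B \<in> sets borel" using that sets_\<nu> by (auto simp: null_sets_def)
    ultimately have "emeasure (fst j) B + emeasure (snd j) B = 0"
      using emeasure_flux_variation[OF j] by (auto simp: null_sets_def)
    then show ?thesis by simp
  qed
  have acP: "absolutely_continuous \<nu> P" and acQ: "absolutely_continuous \<nu> Q"
    using null sets_\<nu> PQ_sets by (auto simp: absolutely_continuous_def null_sets_def P_def Q_def)
  have sfj: "sigma_finite_measure (fst j)" "sigma_finite_measure (snd j)"
    using j by (auto simp: sigma_finite_fluxes_def)
  have sf: "sigma_finite_measure P" "sigma_finite_measure Q"
    unfolding P_def Q_def scale_measure_eq_density using sfj
    by (simp_all add: sigma_finite_measure.sigma_finite_iff_density_finite)
  define p where "p = RN_deriv \<nu> P"
  define q where "q = RN_deriv \<nu> Q"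
  have [measurable]: "p \<in> borel_measurable borel" "q \<in> borel_measurable borel"
    using borel_measurable_RN_deriv[of \<nu> P] borel_measurable_RN_deriv[of \<nu> Q]
    by (simp_all add: p_def q_def cong: measurable_cong_sets)
  have dens: "density \<nu> p = P" "density \<nu> q = Q"
    unfolding p_def q_def using acP acQ by (auto intro!: \<nu>.density_RN_deriv)
  \<comment> \<open>Finite densities, so that \<open>enn2real\<close> in \<open>flux_density\<close>
    loses nothing.\<close>
  have fin: "AE z in \<nu>. p z \<noteq> \<infinity>" "AE z in \<nu>. q z \<noteq> \<infinity>"
    unfolding p_def q_def
    using \<nu>.RN_deriv_finite[OF sf(1) acP] \<nu>.RN_deriv_finite[OF sf(2) acQ] by simp_all
  obtain A where A: "A \<in> sets borel" "emeasure (fst j) A = 0" "emeasure (snd j) (UNIV - A) = 0"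
    using j js by (auto simp: sigma_finite_fluxes_def mutually_singular_def)
  have zero: "AE z in \<nu>. z \<in> B \<longrightarrow> r z = 0"
    if "r \<in> borel_measurable borel" "density \<nu> r = scale_measure 2 m" "emeasure m B = 0" "B \<in> sets borel" for r m B
  proof -
    have [measurable]: "r \<in> borel_measurable borel" "B \<in> sets borel" by fact+
    have "emeasure (density \<nu> r) B = 0" using that by simp
    then have "(\<integral>\<^sup>+z. r z * indicator B z \<partial>\<nu>) = 0" by (subst (asm) emeasure_density) auto
    then have "AE z in \<nu>. r z * indicator B z = 0" by (subst (asm) nn_integral_0_iff_AE) auto
    then show ?thesis by eventually_elim (auto split: split_indicator_asm)
  qed
  have "AE z in \<nu>. z \<in> A \<longrightarrow> p z = 0"
    using A by (intro zero[of p "fst j"]) (auto simp: dens P_def)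
  moreover have "AE z in \<nu>. z \<in> UNIV - A \<longrightarrow> q z = 0"
    using A by (intro zero[of q "snd j"]) (auto simp: dens Q_def)
  ultimately have sing: "AE z in \<nu>. p z = 0 \<or> q z = 0"
    by eventually_elim auto
  define w where "w z = flux_density \<nu> (flux_scale 2 j) z" for z
  have w: "w z = enn2real (p z) - enn2real (q z)" for z
    by (simp add: w_def flux_density_def density_wrt_def flux_scale_def p_def q_def P_def Q_def)
  have [measurable]: "w \<in> borel_measurable borel" unfolding w[abs_def] by measurable
  have "2 * (\<integral>\<^sup>+z. ennreal \<bar>f z\<bar> \<partial>flux_variation j) = (\<integral>\<^sup>+z. ennreal \<bar>f z\<bar> \<partial>P) + (\<integral>\<^sup>+z. ennreal \<bar>f z\<bar> \<partial>Q)"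
    using js by (simp add: nn_integral_flux_variation[OF j] P_def Q_def nn_integral_scale_measure distrib_left
        cong: measurable_cong_sets)
  also have "\<dots> = (\<integral>\<^sup>+z. p z * ennreal \<bar>f z\<bar> \<partial>\<nu>) + (\<integral>\<^sup>+z. q z * ennreal \<bar>f z\<bar> \<partial>\<nu>)"
    unfolding dens[symmetric] by (simp add: nn_integral_density)
  also have "\<dots> = (\<integral>\<^sup>+z. p z * ennreal \<bar>f z\<bar> + q z * ennreal \<bar>f z\<bar> \<partial>\<nu>)"
    by (rule nn_integral_add[symmetric]) auto
  also have "\<dots> \<le> (\<integral>\<^sup>+z. ennreal (convex_conjugate \<psi>s (w z)) + ennreal (\<psi>s (f z)) \<partial>\<nu>)"
  proof (rule nn_integral_mono_AE)
    show "AE z in \<nu>. p z * ennreal \<bar>f z\<bar> + q z * ennreal \<bar>f z\<bar>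
        \<le> ennreal (convex_conjugate \<psi>s (w z)) + ennreal (\<psi>s (f z))"
      using sing fin
    proof eventually_elim
      case (elim z)
      have "p z + q z = ennreal \<bar>w z\<bar>"
        using elim by (cases "p z"; cases "q z") (auto simp: w)
      then have "p z * ennreal \<bar>f z\<bar> + q z * ennreal \<bar>f z\<bar> = ennreal \<bar>w z * f z\<bar>"
        by (simp add: distrib_right[symmetric] ennreal_mult[symmetric] abs_mult)
      also have "\<dots> \<le> ennreal (convex_conjugate \<psi>s (w z) + \<psi>s (f z))"
        by (intro ennreal_leI young_inequality[OF \<psi>])
      also have "\<dots> = ennreal (convex_conjugate \<psi>s (w z)) + ennreal (\<psi>s (f z))"
        using convex_conjugate_nonneg[OF \<psi>] dual_dissipation_nonneg[OF \<psi>] by simp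
      finally show ?case .
    qed
  qed
  also have "\<dots> = (\<integral>\<^sup>+z. ennreal (convex_conjugate \<psi>s (w z)) \<partial>\<nu>) + (\<integral>\<^sup>+z. ennreal (\<psi>s (f z)) \<partial>\<nu>)"
    by (rule nn_integral_add) auto
  also have "(\<integral>\<^sup>+z. ennreal (\<psi>s (f z)) \<partial>\<nu>) = (\<integral>\<^sup>+z. ennreal (\<psi>s (f z) * a z) \<partial>edges)"
    unfolding \<nu> using a_nonneg dual_dissipation_nonneg[OF \<psi>]
    by (subst nn_integral_density) (auto simp: ennreal_mult mult.commute)
  finally have "(1 / 2) * (2 * (\<integral>\<^sup>+z. ennreal \<bar>f z\<bar> \<partial>flux_variation j)) \<le>
      (1 / 2) * ((\<integral>\<^sup>+z. ennreal (convex_conjugate \<psi>s (w z)) \<partial>\<nu>) + (\<integral>\<^sup>+z. ennreal (\<psi>s (f z) * a z) \<partial>edges))"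
    by (intro mult_left_mono) auto
  also have "\<dots> = dissipation \<pi> \<kappa> \<psi>s \<alpha> \<rho> j + (1 / 2) * (\<integral>\<^sup>+z. ennreal (\<psi>s (f z) * a z) \<partial>edges)"
    using ac by (simp add: dissipation_def Let_def \<nu>_def w_def distrib_left)
  finally show ?thesis unfolding ennreal_half_mult_2 a_def .
qed

end

section \<open>Curves with bounded density\<close>

text \<open>Measurability in time is available on the interval only; outside it the flux is
  arbitrary.\<close>

lemma set_integrable_lborel_restrict:
  fixes f :: "real \<Rightarrow> real"
  assumes "f \<in> borel_measurable (restrict_space borel {a..b})"
    and "(\<integral>\<^sup>+t\<in>{a..b}. ennreal \<bar>f t\<bar> \<partial>lborel) < \<infinity>"
  shows "set_integrable lborel {a..b} f"
  unfolding set_integrable_def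
proof (rule integrableI_bounded)
  show "(\<lambda>t. indicator {a..b} t *\<^sub>R f t) \<in> borel_measurable lborel"
    using assms(1) by (subst (asm) borel_measurable_restrict_space_iff) auto
  have "(\<integral>\<^sup>+t. ennreal (norm (indicator {a..b} t *\<^sub>R f t)) \<partial>lborel) = (\<integral>\<^sup>+t\<in>{a..b}. ennreal \<bar>f t\<bar> \<partial>lborel)"
    by (intro nn_integral_cong) (auto split: split_indicator)
  with assms(2) show "(\<integral>\<^sup>+t. ennreal (norm (indicator {a..b} t *\<^sub>R f t)) \<partial>lborel) < \<infinity>" by simp
qed

lemma continuous_on_indefinite_LBINT:
  fixes f :: "real \<Rightarrow> real"
  assumes f: "set_integrable lborel {a..b} f"
  shows "continuous_on {a..b} (\<lambda>t. LBINT r:{a..t}. f r)"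
proof -
  have "continuous_on {a..b} (\<lambda>t. integral {a..t} f)"
    using set_borel_integral_eq_integral(1)[OF f] by (rule indefinite_integral_continuous_1)
  moreover have "integral {a..t} f = (LBINT r:{a..t}. f r)" if "t \<in> {a..b}" for t
    using that set_integrable_subset[OF f, of "{a..t}"] by (intro set_borel_integral_eq_integral(2)[symmetric]) auto
  ultimately show ?thesis by (rule continuous_on_eq)
qed

lemma AE_lborel_interval_ex:
  assumes "AE x in lborel. x \<in> {c<..<d} \<longrightarrow> P x" "max a c < min b d"
  shows "\<exists>x::real\<in>{a<..<b} \<inter> {c<..<d}. P x"
proof (rule ccontr)
  assume "\<not> ?thesis"
  with assms(1) have "AE x in lborel. x \<notin> {max a c<..<min b d}"
    by (auto elim!: eventually_mono)
  then have "emeasure lborel {max a c<..<min b d} = 0"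
    by (subst (asm) AE_iff_null_sets[symmetric]) (auto simp: null_sets_def)
  then have "min b d - max a c \<le> 0"
    by (simp only: emeasure_lborel_Ioo[OF less_imp_le[OF assms(2)]] ennreal_eq_0_iff)
  with assms(2) show False by linarith
qed

locale bounded_curve = jump_space \<pi> \<kappa>
  for \<pi> :: "'a::{metric_space, second_countable_topology} measure" and \<kappa> +
  fixes \<phi> \<psi>s :: "real \<Rightarrow> real" and \<alpha> :: "real \<Rightarrow> real \<Rightarrow> real" and T C :: real
    and \<rho> :: "real \<Rightarrow> 'a measure" and j :: "real \<Rightarrow> ('a \<times> 'a) flux"
  assumes T: "0 < T" and C: "0 < C"
    and \<phi>: "entropy_density \<phi>" and \<psi>: "dual_dissipation_density \<psi>s" and \<alpha>: "mobility \<alpha>"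
    and fisher_lsc: "fisher_setwise_lsc \<pi> \<kappa> \<phi> \<psi>s \<alpha>"
    and diss: "dissipative_solution \<pi> \<kappa> \<phi> \<psi>s \<alpha> T \<rho> j"
    and bounded: "AE t in lborel. t \<in> {0<..<T} \<longrightarrow> (AE x in \<pi>. density_wrt \<pi> (\<rho> t) x \<le> C)"
begin

text \<open>The cap gives a version of the density that is bounded at every point and for every t;
  on the time interval it agrees almost everywhere with the density by
  \<open>density_eq_u\<close>.\<close>

definition u :: "real \<Rightarrow> 'a \<Rightarrow> real" where
  "u t x = min C (density_wrt \<pi> (\<rho> t) x)"

text \<open>The integrand in time of the continuity equation. The restriction to
  \<open>offdiag\<close> drops out in \<open>flow_eq\<close>, since gradients vanish on the
  diagonal.\<close>

definition flow :: "('a \<Rightarrow> real) \<Rightarrow> real \<Rightarrow> real" where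
  "flow \<zeta> r = set_flux_integral (j r) offdiag (grad \<zeta>)"

lemma u_measurable [measurable]: "u t \<in> borel_measurable borel"
  unfolding u_def[abs_def] by measurable

lemma u_nonneg: "0 \<le> u t x" and u_le: "u t x \<le> C"
  using C density_wrt_nonneg by (auto simp: u_def)

lemma CE: "(\<rho>, j) \<in> CE T"
  using diss by (simp add: dissipative_solution_def)

lemma rho_borel: "t \<in> {0..T} \<Longrightarrow> \<rho> t \<in> finite_borel_measures"
  and j_flux: "t \<in> {0..T} \<Longrightarrow> j t \<in> sigma_finite_fluxes"
  and j_measurable: "measurable_flux_family T j"
  using CE by (auto simp: CE_def)

lemma sets_rho: "t \<in> {0..T} \<Longrightarrow> sets (\<rho> t) = sets borel"
  and finite_rho: "t \<in> {0..T} \<Longrightarrow> finite_measure (\<rho> t)"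
  using rho_borel by (auto simp: finite_borel_measures_def)

lemma entropy_le:
  assumes "t \<in> {0..T}"
  shows "entropy \<pi> \<phi> (\<rho> t) \<le> entropy \<pi> \<phi> (\<rho> 0)"
proof -
  obtain I where "I + entropy \<pi> \<phi> (\<rho> t) \<le> entropy \<pi> \<phi> (\<rho> 0)"
    using diss assms unfolding dissipative_solution_def by blast
  moreover have "entropy \<pi> \<phi> (\<rho> t) \<le> I + entropy \<pi> \<phi> (\<rho> t)" by simp
  ultimately show ?thesis by (rule order_trans[rotated])
qed

lemma entropy_finite:
  assumes "t \<in> {0..T}"
  shows "entropy \<pi> \<phi> (\<rho> t) < \<infinity>"
proof -
  have "entropy \<pi> \<phi> (\<rho> 0) < \<infinity>" using diss unfolding dissipative_solution_def by blast
  with entropy_le[OF assms] show ?thesis by (rule le_less_trans)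
qed

lemma rho_finite_entropy: "t \<in> {0..T} \<Longrightarrow> \<rho> t \<in> finite_entropy_measures \<pi> \<phi>"
  using entropy_finite rho_borel by (simp add: finite_entropy_measures_def)

lemma rho_ac: "t \<in> {0..T} \<Longrightarrow> absolutely_continuous \<pi> (\<rho> t)"
  using entropy_finite[of t] by (auto simp: entropy_def split: if_splits)

section \<open>Pairing of fluxes with gradients\<close>

lemma flow_eq: "flow \<zeta> r = (LINT z|fst (j r). grad \<zeta> z) - (LINT z|snd (j r). grad \<zeta> z)"
  by (simp add: flow_def set_flux_integral_def set_lebesgue_integral_def grad_offdiag)

lemma j_measurable_emeasure:
  assumes "B \<in> sets borel"
  shows "(\<lambda>t. emeasure (fst (j t)) B) \<in> borel_measurable (restrict_space borel {0..T})"
    and "(\<lambda>t. emeasure (snd (j t)) B) \<in> borel_measurable (restrict_space borel {0..T})"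
  using j_measurable assms by (auto simp: measurable_flux_family_def)

lemma sets_j:
  assumes "t \<in> {0..T}"
  shows "sets (fst (j t)) = sets borel" "sets (snd (j t)) = sets borel" "sets (flux_variation (j t)) = sets borel"
  using flux_variation_simps[OF j_flux[OF assms]] by auto

lemma flow_measurable:
  assumes "\<zeta> \<in> borel_measurable borel"
  shows "flow \<zeta> \<in> borel_measurable (restrict_space borel {0..T})"
  unfolding flow_eq[abs_def]
  by (intro borel_measurable_diff borel_measurable_lebesgue_integral_family[where N = borel])
    (use assms j_measurable_emeasure sets_j in \<open>simp_all add: space_restrict_space\<close>)

lemma variation_measurable:
  assumes f: "f \<in> borel_measurable borel"
  shows "(\<lambda>r. \<integral>\<^sup>+z. f z \<partial>flux_variation (j r)) \<in> borel_measurable (restrict_space borel {0..T})"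
proof -
  have "(\<lambda>r. (\<integral>\<^sup>+z. f z \<partial>fst (j r)) + (\<integral>\<^sup>+z. f z \<partial>snd (j r))) \<in> borel_measurable (restrict_space borel {0..T})"
    by (intro borel_measurable_add borel_measurable_nn_integral_family[where N = borel])
      (use f j_measurable_emeasure sets_j in \<open>simp_all add: space_restrict_space\<close>)
  then show ?thesis
    by (rule measurable_cong[THEN iffD2, rotated])
      (auto simp: space_restrict_space intro!: nn_integral_flux_variation j_flux f)
qed

lemma flow_le_variation:
  assumes r: "r \<in> {0..T}" and [measurable]: "\<zeta> \<in> borel_measurable borel"
  shows "ennreal \<bar>flow \<zeta> r\<bar> \<le> (\<integral>\<^sup>+z. ennreal \<bar>grad \<zeta> z\<bar> \<partial>flux_variation (j r))"
proof -
  have "ennreal \<bar>flow \<zeta> r\<bar> \<le> ennreal \<bar>LINT z|fst (j r). grad \<zeta> z\<bar> + ennreal \<bar>LINT z|snd (j r). grad \<zeta> z\<bar>"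
    unfolding flow_eq by (simp add: ennreal_plus[symmetric] del: ennreal_plus)
  also have "\<dots> \<le> (\<integral>\<^sup>+z. ennreal \<bar>grad \<zeta> z\<bar> \<partial>fst (j r)) + (\<integral>\<^sup>+z. ennreal \<bar>grad \<zeta> z\<bar> \<partial>snd (j r))"
    by (intro add_mono ennreal_abs_integral_le)
  also have "\<dots> = (\<integral>\<^sup>+z. ennreal \<bar>grad \<zeta> z\<bar> \<partial>flux_variation (j r))"
    using j_flux[OF r] by (intro nn_integral_flux_variation[symmetric]) auto
  finally show ?thesis .
qed

lemma flow_set_integrable:
  assumes [measurable]: "\<zeta> \<in> borel_measurable borel"
    and fin: "(\<integral>\<^sup>+r\<in>{0..T}. (\<integral>\<^sup>+z. ennreal \<bar>grad \<zeta> z\<bar> \<partial>flux_variation (j r)) \<partial>lborel) < \<infinity>"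
  shows "set_integrable lborel {0..T} (flow \<zeta>)"
proof (rule set_integrable_lborel_restrict)
  show "flow \<zeta> \<in> borel_measurable (restrict_space borel {0..T})" by (rule flow_measurable) fact
  have "(\<integral>\<^sup>+r\<in>{0..T}. ennreal \<bar>flow \<zeta> r\<bar> \<partial>lborel) \<le>
      (\<integral>\<^sup>+r\<in>{0..T}. (\<integral>\<^sup>+z. ennreal \<bar>grad \<zeta> z\<bar> \<partial>flux_variation (j r)) \<partial>lborel)"
    by (intro nn_integral_mono) (auto split: split_indicator intro: flow_le_variation)
  with fin show "(\<integral>\<^sup>+r\<in>{0..T}. ennreal \<bar>flow \<zeta> r\<bar> \<partial>lborel) < \<infinity>" by simp
qed

text \<open>The gradient is at most \<open>K\<close> times min 1 (dist x y), with \<open>K\<close>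
  the larger of an oscillation bound and a Lipschitz constant; the flux integral of this moment is
  finite by \<open>CE\<close>.\<close>

lemma Lip_b_grad_integrable:
  assumes \<zeta>: "\<zeta> \<in> Lip_b"
  shows "(\<integral>\<^sup>+r\<in>{0..T}. (\<integral>\<^sup>+z. ennreal \<bar>grad \<zeta> z\<bar> \<partial>flux_variation (j r)) \<partial>lborel) < \<infinity>"
proof -
  obtain B where B: "\<And>x. \<bar>\<zeta> x\<bar> \<le> B" using Lip_b_bounded[OF \<zeta>] by blast
  obtain L where L: "L-lipschitz_on UNIV \<zeta>" using \<zeta> by (auto simp: Lip_b_def)
  define K where "K = max (2 * B) L"
  have "0 \<le> L" using lipschitz_on_nonneg[OF L] .
  then have K: "0 \<le> K" by (simp add: K_def)
  have grad: "\<bar>grad \<zeta> z\<bar> \<le> K * min 1 (dist (fst z) (snd z))" for z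
  proof -
    have "\<bar>grad \<zeta> z\<bar> \<le> 2 * B" using B[of "fst z"] B[of "snd z"] by (auto simp: grad_def split: prod.split)
    then have "\<bar>grad \<zeta> z\<bar> \<le> K * 1" by (simp add: K_def)
    moreover have "\<bar>grad \<zeta> z\<bar> \<le> L * dist (fst z) (snd z)"
      using lipschitz_onD[OF L, of "fst z" "snd z"] by (auto simp: grad_def dist_real_def abs_minus_commute split: prod.split)
    then have "\<bar>grad \<zeta> z\<bar> \<le> K * dist (fst z) (snd z)"
      using mult_right_mono[of L K "dist (fst z) (snd z)"] by (simp add: K_def)
    ultimately show ?thesis by (auto simp: min_def)
  qed
  have "(\<integral>\<^sup>+r\<in>{0..T}. (\<integral>\<^sup>+z. ennreal \<bar>grad \<zeta> z\<bar> \<partial>flux_variation (j r)) \<partial>lborel) \<le>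
      (\<integral>\<^sup>+r. ennreal K * ((\<integral>\<^sup>+(x, y). ennreal (min 1 (dist x y)) \<partial>flux_variation (j r)) * indicator {0..T} r) \<partial>lborel)"
  proof (rule nn_integral_mono)
    fix r
    show "(\<integral>\<^sup>+z. ennreal \<bar>grad \<zeta> z\<bar> \<partial>flux_variation (j r)) * indicator {0..T} r \<le>
      ennreal K * ((\<integral>\<^sup>+(x, y). ennreal (min 1 (dist x y)) \<partial>flux_variation (j r)) * indicator {0..T} r)"
    proof (cases "r \<in> {0..T}")
      case True
      have [measurable_cong]: "sets (flux_variation (j r)) = sets borel"
        using flux_variation_simps[OF j_flux[OF True]] by simp
      have "(\<integral>\<^sup>+z. ennreal \<bar>grad \<zeta> z\<bar> \<partial>flux_variation (j r)) \<le>
        (\<integral>\<^sup>+z. ennreal K * (case z of (x, y) \<Rightarrow> ennreal (min 1 (dist x y))) \<partial>flux_variation (j r))"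
        using grad K by (intro nn_integral_mono) (auto simp: ennreal_mult[symmetric] intro!: ennreal_leI split: prod.split)
      also have "\<dots> = ennreal K * (\<integral>\<^sup>+(x, y). ennreal (min 1 (dist x y)) \<partial>flux_variation (j r))"
        by (rule nn_integral_cmult) (simp add: case_prod_beta')
      finally show ?thesis using True by simp
    qed simp
  qed
  also have "\<dots> = ennreal K * (\<integral>\<^sup>+r\<in>{0..T}. (\<integral>\<^sup>+(x, y). ennreal (min 1 (dist x y)) \<partial>flux_variation (j r)) \<partial>lborel)"
  proof (rule nn_integral_cmult)
    have "(\<lambda>r. \<integral>\<^sup>+z. (case z of (x, y) \<Rightarrow> ennreal (min 1 (dist x y))) \<partial>flux_variation (j r))
        \<in> borel_measurable (restrict_space borel {0..T})"
      by (rule variation_measurable) (simp add: case_prod_beta')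
    then show "(\<lambda>r. (\<integral>\<^sup>+(x, y). ennreal (min 1 (dist x y)) \<partial>flux_variation (j r)) * indicator {0..T} r)
        \<in> borel_measurable lborel"
      by (subst (asm) borel_measurable_restrict_space_iff_ennreal) auto
  qed
  also have "\<dots> < \<infinity>"
    using CE by (auto simp: CE_def ennreal_mult_less_top)
  finally show ?thesis .
qed

lemma Lip_b_continuous_curve:
  assumes \<zeta>: "\<zeta> \<in> Lip_b"
  shows "continuous_on {0..T} (\<lambda>t. LINT x|\<rho> t. \<zeta> x)"
proof -
  have "set_integrable lborel {0..T} (flow \<zeta>)"
    using \<zeta> by (intro flow_set_integrable Lip_b_grad_integrable) (auto intro: borel_measurable_Lip_b)
  then have "continuous_on {0..T} (\<lambda>t. (LINT x|\<rho> 0. \<zeta> x) + (LBINT r:{0..t}. flow \<zeta> r))"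
    by (intro continuous_intros continuous_on_indefinite_LBINT)
  moreover have "(LINT x|\<rho> 0. \<zeta> x) + (LBINT r:{0..t}. flow \<zeta> r) = (LINT x|\<rho> t. \<zeta> x)" if "t \<in> {0..T}" for t
  proof -
    have "continuity_identity T \<rho> j \<zeta>" using CE \<zeta> by (auto simp: CE_def)
    then have "(LINT x|\<rho> t. \<zeta> x) - (LINT x|\<rho> 0. \<zeta> x) = (LBINT r:{0..t}. flow \<zeta> r)"
      using that unfolding continuity_identity_def flow_def by simp
    then show ?thesis by simp
  qed
  ultimately show ?thesis by (rule continuous_on_eq)
qed

section \<open>The density bound at every time\<close>

lemma integral_Lip_b_le_good:
  assumes s: "s \<in> {0..T}" and ae: "AE x in \<pi>. density_wrt \<pi> (\<rho> s) x \<le> C"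
    and \<zeta>: "\<zeta> \<in> Lip_b" "\<And>x. 0 \<le> \<zeta> x"
  shows "(LINT x|\<rho> s. \<zeta> x) \<le> C * (LINT x|\<pi>. \<zeta> x)"
proof -
  have [measurable]: "\<zeta> \<in> borel_measurable borel" using \<zeta> by (auto intro: borel_measurable_Lip_b)
  obtain K where K: "\<And>x. \<bar>\<zeta> x\<bar> \<le> K" using Lip_b_bounded[OF \<zeta>(1)] by blast
  have int: "integrable \<pi> \<zeta>" using K by (intro pi.integrable_const_bound[of _ K]) auto
  have "AE x in \<pi>. RN_deriv \<pi> (\<rho> s) x \<noteq> \<infinity>"
    using finite_measure.axioms(1)[OF finite_rho[OF s]] rho_ac[OF s] sets_rho[OF s]
    by (intro pi.RN_deriv_finite) auto
  with ae have "AE x in \<pi>. RN_deriv \<pi> (\<rho> s) x \<le> ennreal C"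
  proof eventually_elim
    case (elim x)
    then have "RN_deriv \<pi> (\<rho> s) x = ennreal (density_wrt \<pi> (\<rho> s) x)"
      by (simp add: density_wrt_def less_top)
    with elim show ?case by (simp add: ennreal_leI)
  qed
  then have "(\<integral>\<^sup>+x. RN_deriv \<pi> (\<rho> s) x * ennreal (\<zeta> x) \<partial>\<pi>) \<le> (\<integral>\<^sup>+x. ennreal C * ennreal (\<zeta> x) \<partial>\<pi>)"
    by (intro nn_integral_mono_AE) (auto elim!: eventually_mono intro: mult_right_mono)
  also have "\<dots> = ennreal (C * (LINT x|\<pi>. \<zeta> x))"
    using int \<zeta> C by (simp add: nn_integral_cmult nn_integral_eq_integral ennreal_mult integral_nonneg_AE)
  also have "(\<integral>\<^sup>+x. RN_deriv \<pi> (\<rho> s) x * ennreal (\<zeta> x) \<partial>\<pi>) = (\<integral>\<^sup>+x. ennreal (\<zeta> x) \<partial>\<rho> s)"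
    using rho_ac[OF s] sets_rho[OF s] by (intro pi.RN_deriv_nn_integral[symmetric]) auto
  finally have le: "(\<integral>\<^sup>+x. ennreal (\<zeta> x) \<partial>\<rho> s) \<le> ennreal (C * (LINT x|\<pi>. \<zeta> x))" .
  have "integrable (\<rho> s) \<zeta>"
    using K sets_rho[OF s] by (intro finite_measure.integrable_const_bound[OF finite_rho[OF s], of _ K])
      (auto cong: measurable_cong_sets)
  then show ?thesis
    using le \<zeta> C by (simp add: nn_integral_eq_integral ennreal_le_iff integral_nonneg_AE)
qed

text \<open>Times at which the density bound holds have full measure, hence are dense, and the
  pairing with a bounded Lipschitz function is continuous in time. This removes the exceptional null
  set of times.\<close>

lemma integral_Lip_b_le:
  assumes t: "t \<in> {0..T}" and \<zeta>: "\<zeta> \<in> Lip_b" "\<And>x. 0 \<le> \<zeta> x"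
  shows "(LINT x|\<rho> t. \<zeta> x) \<le> C * (LINT x|\<pi>. \<zeta> x)"
proof -
  define \<delta> where "\<delta> n = 1 / real (Suc n)" for n
  have \<delta>: "0 < \<delta> n" for n by (simp add: \<delta>_def)
  have \<delta>_lim: "\<delta> \<longlonglongrightarrow> 0" unfolding \<delta>_def by (rule LIMSEQ_Suc[OF lim_1_over_n])
  have "\<exists>s\<in>{t - \<delta> n<..<t + \<delta> n} \<inter> {0<..<T}. AE x in \<pi>. density_wrt \<pi> (\<rho> s) x \<le> C" for n
    using t T \<delta>[of n] by (intro AE_lborel_interval_ex bounded) auto
  then have "\<forall>n. \<exists>s. s \<in> {t - \<delta> n<..<t + \<delta> n} \<inter> {0<..<T} \<and> (AE x in \<pi>. density_wrt \<pi> (\<rho> s) x \<le> C)"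
    by blast
  from choice[OF this] obtain s where s: "\<And>n. s n \<in> {t - \<delta> n<..<t + \<delta> n} \<inter> {0<..<T}"
    "\<And>n. AE x in \<pi>. density_wrt \<pi> (\<rho> (s n)) x \<le> C" by blast
  have s0: "s n \<in> {0..T}" for n using s(1)[of n] by auto
  have "\<bar>s n - t\<bar> \<le> \<delta> n" for n using s(1)[of n] by auto
  then have "(\<lambda>n. s n - t) \<longlonglongrightarrow> 0"
    by (intro Lim_null_comparison[OF _ \<delta>_lim] always_eventually) auto
  then have s_lim: "s \<longlonglongrightarrow> t" by (rule LIM_zero_cancel)
  have "(\<lambda>n. LINT x|\<rho> (s n). \<zeta> x) \<longlonglongrightarrow> (LINT x|\<rho> t. \<zeta> x)"
    by (rule continuous_on_tendsto_compose[OF Lip_b_continuous_curve[OF \<zeta>(1)] s_lim t])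
      (rule always_eventually, use s0 in blast)
  moreover have "(LINT x|\<rho> (s n). \<zeta> x) \<le> C * (LINT x|\<pi>. \<zeta> x)" for n
    by (rule integral_Lip_b_le_good[OF s0 s(2) \<zeta>])
  ultimately show ?thesis by (intro LIMSEQ_le_const2) blast+
qed

text \<open>The indicator is approximated by Lipschitz functions in L1 of \<open>\<pi>\<close> and
  of \<open>\<rho> t\<close> at once, by working with the sum of the two measures.\<close>

lemma rho_le_pi:
  assumes t: "t \<in> {0..T}" and B: "B \<in> sets borel"
  shows "emeasure (\<rho> t) B \<le> ennreal C * emeasure \<pi> B"
proof -
  interpret R: finite_measure "\<rho> t" using finite_rho[OF t] .
  define \<mu> where "\<mu> = measure_add \<pi> (\<rho> t)"
  have sets_\<mu>: "sets \<mu> = sets borel" by (simp add: \<mu>_def)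
  have \<mu>_eq: "(\<integral>\<^sup>+x. f x \<partial>\<mu>) = (\<integral>\<^sup>+x. f x \<partial>\<pi>) + (\<integral>\<^sup>+x. f x \<partial>\<rho> t)" if "f \<in> borel_measurable borel" for f
    unfolding \<mu>_def using that sets_rho[OF t] by (intro nn_integral_measure_add) (auto cong: measurable_cong_sets)
  have "finite_measure \<mu>"
  proof (rule finite_measureI)
    have "emeasure \<mu> (space \<mu>) = emeasure \<pi> UNIV + emeasure (\<rho> t) UNIV"
      unfolding \<mu>_def using sets_rho[OF t] by (subst emeasure_measure_add) auto
    then show "emeasure \<mu> (space \<mu>) \<noteq> \<infinity>"
      using pi.emeasure_finite[of UNIV] R.emeasure_finite[of UNIV] by simp
  qed
  with sets_\<mu> B have approx: "lip_approximable \<mu> (indicator B)" by (intro lip_approximable_indicator)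
  have "emeasure (\<rho> t) B \<le> ennreal C * emeasure \<pi> B + ennreal e" if e: "0 < e" for e
  proof -
    \<comment> \<open>The error occurs once under \<open>\<rho> t\<close> and C times under
      \<open>\<pi>\<close>.\<close>
    define e' where "e' = e / (C + 1)"
    have "0 < e'" using e C by (simp add: e'_def)
    with approx obtain \<xi> where \<xi>: "\<xi> \<in> Lip_b" "(\<integral>\<^sup>+x. ennreal \<bar>indicator B x - \<xi> x\<bar> \<partial>\<mu>) < ennreal e'"
      unfolding lip_approximable_def by blast
    \<comment> \<open>The bound for Lipschitz functions concerns nonnegative ones; the positive part
      approximates an indicator at least as well.\<close>
    define \<zeta> where "\<zeta> x = max 0 (\<xi> x)" for x
    have \<zeta>: "\<zeta> \<in> Lip_b" "\<And>x. 0 \<le> \<zeta> x"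
      unfolding \<zeta>_def[abs_def] by (auto intro!: Lip_b_contraction[OF \<xi>(1)])
    have [measurable]: "\<zeta> \<in> borel_measurable borel" "\<xi> \<in> borel_measurable borel"
      using \<zeta> \<xi> by (auto intro: borel_measurable_Lip_b)
    have [measurable]: "B \<in> sets borel" by fact
    have "(\<integral>\<^sup>+x. ennreal \<bar>indicator B x - \<zeta> x\<bar> \<partial>\<mu>) \<le> (\<integral>\<^sup>+x. ennreal \<bar>indicator B x - \<xi> x\<bar> \<partial>\<mu>)"
      by (intro nn_integral_mono ennreal_leI) (auto simp: \<zeta>_def split: split_indicator)
    also have "\<dots> \<le> ennreal e'" using \<xi>(2) by simp
    finally have sum_le: "(\<integral>\<^sup>+x. ennreal \<bar>indicator B x - \<zeta> x\<bar> \<partial>\<pi>) + (\<integral>\<^sup>+x. ennreal \<bar>indicator B x - \<zeta> x\<bar> \<partial>\<rho> t) \<le> ennreal e'"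
      by (subst (asm) \<mu>_eq) auto
    have le: "(\<integral>\<^sup>+x. ennreal \<bar>indicator B x - \<zeta> x\<bar> \<partial>\<pi>) \<le> ennreal e'" "(\<integral>\<^sup>+x. ennreal \<bar>indicator B x - \<zeta> x\<bar> \<partial>\<rho> t) \<le> ennreal e'"
      by (rule order_trans[OF _ sum_le], simp)+
    have m: "\<zeta> \<in> borel_measurable (\<rho> t)" "(\<lambda>x. indicator B x) \<in> borel_measurable (\<rho> t)" "B \<in> sets (\<rho> t)"
      using sets_rho[OF t] by (auto cong: measurable_cong_sets)
    have [measurable]: "\<zeta> \<in> borel_measurable (\<rho> t)" "B \<in> sets (\<rho> t)" using m by auto
    obtain K where K: "\<And>x. \<bar>\<zeta> x\<bar> \<le> K" using Lip_b_bounded[OF \<zeta>(1)] by blast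
    have int: "integrable \<pi> \<zeta>" using K by (intro pi.integrable_const_bound[of _ K]) auto
    have int': "integrable (\<rho> t) \<zeta>" using K by (intro R.integrable_const_bound[of _ K]) auto
    have near: "(\<integral>\<^sup>+x. ennreal (f x) \<partial>M) \<le> (\<integral>\<^sup>+x. ennreal \<bar>f x - g x\<bar> \<partial>M) + (\<integral>\<^sup>+x. ennreal (g x) \<partial>M)"
      if [measurable]: "f \<in> borel_measurable M" "g \<in> borel_measurable M" and "\<And>x. 0 \<le> g x" for f g :: "'a \<Rightarrow> real" and M
    proof -
      have "(\<integral>\<^sup>+x. ennreal (f x) \<partial>M) \<le> (\<integral>\<^sup>+x. ennreal \<bar>f x - g x\<bar> + ennreal (g x) \<partial>M)"
        using that(3) by (intro nn_integral_mono) (auto simp: ennreal_plus[symmetric] simp del: ennreal_plus intro!: ennreal_leI)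
      also have "\<dots> = (\<integral>\<^sup>+x. ennreal \<bar>f x - g x\<bar> \<partial>M) + (\<integral>\<^sup>+x. ennreal (g x) \<partial>M)"
        by (rule nn_integral_add) auto
      finally show ?thesis .
    qed
    have pi_le: "(\<integral>\<^sup>+x. ennreal (\<zeta> x) \<partial>\<pi>) \<le> ennreal e' + emeasure \<pi> B"
    proof -
      have "(\<integral>\<^sup>+x. ennreal (\<zeta> x) \<partial>\<pi>) \<le> (\<integral>\<^sup>+x. ennreal \<bar>\<zeta> x - indicator B x\<bar> \<partial>\<pi>) + (\<integral>\<^sup>+x. ennreal (indicator B x) \<partial>\<pi>)"
        by (rule near) auto
      also have "\<dots> \<le> ennreal e' + emeasure \<pi> B"
        using le(1) by (intro add_mono) (simp_all add: ennreal_indicator abs_minus_commute)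
      finally show ?thesis .
    qed
    have rho_le: "(\<integral>\<^sup>+x. ennreal (\<zeta> x) \<partial>\<rho> t) \<le> ennreal C * (\<integral>\<^sup>+x. ennreal (\<zeta> x) \<partial>\<pi>)"
    proof -
      have "(\<integral>\<^sup>+x. ennreal (\<zeta> x) \<partial>\<rho> t) = ennreal (LINT x|\<rho> t. \<zeta> x)"
        using int' \<zeta> by (intro nn_integral_eq_integral) auto
      also have "\<dots> \<le> ennreal (C * (LINT x|\<pi>. \<zeta> x))" by (intro ennreal_leI integral_Lip_b_le t \<zeta>)
      also have "\<dots> = ennreal C * (\<integral>\<^sup>+x. ennreal (\<zeta> x) \<partial>\<pi>)"
        using int \<zeta> C by (simp add: nn_integral_eq_integral ennreal_mult integral_nonneg_AE)
      finally show ?thesis .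
    qed
    have "emeasure (\<rho> t) B = (\<integral>\<^sup>+x. ennreal (indicator B x) \<partial>\<rho> t)" by (simp add: ennreal_indicator)
    also have "\<dots> \<le> (\<integral>\<^sup>+x. ennreal \<bar>indicator B x - \<zeta> x\<bar> \<partial>\<rho> t) + (\<integral>\<^sup>+x. ennreal (\<zeta> x) \<partial>\<rho> t)"
      by (rule near) (auto simp: \<zeta>)
    also have "\<dots> \<le> ennreal e' + ennreal C * (ennreal e' + emeasure \<pi> B)"
      by (intro add_mono le(2) order_trans[OF rho_le] mult_left_mono pi_le) simp
    also have "\<dots> = ennreal C * emeasure \<pi> B + ennreal (e' + C * e')"
      using \<open>0 < e'\<close> C by (simp add: distrib_left ennreal_mult ac_simps)
    also have "e' + C * e' = (C + 1) * e'" by (simp add: algebra_simps)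
    also have "\<dots> = e" using C by (simp add: e'_def)
    finally show ?thesis .
  qed
  then show ?thesis by (rule ennreal_le_epsilon)
qed

text \<open>On a non-null set where the density exceeds C, \<open>\<rho> t\<close> would have more
  than C times the mass of \<open>\<pi>\<close>. Unlike the hypothesis on the curve, the bound now
  covers every t in the interval.\<close>

lemma density_le:
  assumes t: "t \<in> {0..T}"
  shows "AE x in \<pi>. density_wrt \<pi> (\<rho> t) x \<le> C"
proof -
  let ?d = "RN_deriv \<pi> (\<rho> t)"
  have dens: "density \<pi> ?d = \<rho> t"
    using rho_ac[OF t] sets_rho[OF t] by (intro pi.density_RN_deriv) auto
  have [measurable]: "?d \<in> borel_measurable borel"
    using borel_measurable_RN_deriv[of \<pi> "\<rho> t"] by (simp cong: measurable_cong_sets)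
  define B where "B = {x. ennreal C < ?d x}"
  have [measurable]: "B \<in> sets borel" unfolding B_def by measurable
  have "emeasure (\<rho> t) B = (\<integral>\<^sup>+x. ?d x * indicator B x \<partial>\<pi>)"
    by (subst dens[symmetric], subst emeasure_density) auto
  then have le: "(\<integral>\<^sup>+x. ?d x * indicator B x \<partial>\<pi>) \<le> (\<integral>\<^sup>+x. ennreal C * indicator B x \<partial>\<pi>)"
    using rho_le_pi[OF t, of B] by (simp add: nn_integral_cmult)
  have "(\<integral>\<^sup>+x. ?d x * indicator B x - ennreal C * indicator B x \<partial>\<pi>) =
      (\<integral>\<^sup>+x. ?d x * indicator B x \<partial>\<pi>) - (\<integral>\<^sup>+x. ennreal C * indicator B x \<partial>\<pi>)"
    by (rule nn_integral_diff)
      (auto simp: B_def nn_integral_cmult ennreal_mult_eq_top_iff less_imp_le split: split_indicator)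
  also have "\<dots> = 0" 
  proof (rule diff_eq_0_ennreal[OF le_less_trans[OF le] le])
    show "(\<integral>\<^sup>+x. ennreal C * indicator B x \<partial>\<pi>) < top"
      using pi.emeasure_finite[of B]
      by (simp add: nn_integral_cmult ennreal_mult_eq_top_iff less_top[symmetric])
  qed
  finally have "AE x in \<pi>. ?d x * indicator B x - ennreal C * indicator B x = 0"
    by (subst (asm) nn_integral_0_iff_AE) auto
  then show ?thesis
  proof eventually_elim
    case (elim x)
    have "x \<notin> B"
    proof
      assume "x \<in> B"
      with elim have "?d x \<le> ennreal C" by (simp add: ennreal_minus_eq_0)
      with \<open>x \<in> B\<close> show False by (simp add: B_def)
    qed
    then have "?d x \<le> ennreal C" by (simp add: B_def not_less)
    then show ?case unfolding density_wrt_def using C by (simp add: enn2real_leI)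
  qed
qed

lemma density_eq_u:
  assumes t: "t \<in> {0..T}"
  shows "AE x in \<pi>. density_wrt \<pi> (\<rho> t) x = u t x"
  using density_le[OF t] by eventually_elim (simp add: u_def)

lemma rho_eq_density:
  assumes t: "t \<in> {0..T}"
  shows "\<rho> t = density \<pi> (\<lambda>x. ennreal (u t x))"
proof -
  have "\<rho> t = density \<pi> (RN_deriv \<pi> (\<rho> t))"
    using rho_ac[OF t] sets_rho[OF t] by (intro pi.density_RN_deriv[symmetric]) auto
  also have "\<dots> = density \<pi> (\<lambda>x. ennreal (u t x))"
  proof (rule density_cong)
    have "AE x in \<pi>. RN_deriv \<pi> (\<rho> t) x \<noteq> \<infinity>"
      using finite_measure.axioms(1)[OF finite_rho[OF t]] rho_ac[OF t] sets_rho[OF t]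
      by (intro pi.RN_deriv_finite) auto
    with density_eq_u[OF t] show "AE x in \<pi>. RN_deriv \<pi> (\<rho> t) x = ennreal (u t x)"
    proof eventually_elim
      case (elim x)
      then have nt: "RN_deriv \<pi> (\<rho> t) x \<noteq> top" by simp
      have "RN_deriv \<pi> (\<rho> t) x = ennreal (density_wrt \<pi> (\<rho> t) x)"
        by (simp add: density_wrt_def ennreal_enn2real_if nt)
      with elim show ?case by simp
    qed
  qed auto
  finally show ?thesis .
qed

lemma integral_rho:
  assumes t: "t \<in> {0..T}" and [measurable]: "f \<in> borel_measurable borel"
  shows "(LINT x|\<rho> t. f x) = (LINT x|\<pi>. f x * u t x)"
proof -
  have "(LINT x|\<rho> t. f x) = (LINT x|\<pi>. u t x *\<^sub>R f x)"
    unfolding rho_eq_density[OF t] using u_nonneg by (intro integral_density) auto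
  then show ?thesis by (simp add: mult.commute)
qed

section \<open>Weak continuity in time\<close>

lemma integrable_mult_u:
  assumes h: "integrable \<pi> h"
  shows "integrable \<pi> (\<lambda>x. h x * u t x)"
proof (rule Bochner_Integration.integrable_bound)
  show "integrable \<pi> (\<lambda>x. C * h x)" using h by simp
  have [measurable]: "h \<in> borel_measurable borel" using h by (simp cong: measurable_cong_sets)
  show "(\<lambda>x. h x * u t x) \<in> borel_measurable \<pi>" by measurable
  show "AE x in \<pi>. norm (h x * u t x) \<le> norm (C * h x)"
  proof (rule AE_I2)
    fix x
    have "\<bar>h x\<bar> * u t x \<le> \<bar>h x\<bar> * C" by (intro mult_left_mono u_le) auto
    then show "norm (h x * u t x) \<le> norm (C * h x)" using u_nonneg C by (simp add: abs_mult mult.commute)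
  qed
qed

text \<open>For bounded Lipschitz h this is the continuity equation. Density of \<open>Lip_b\<close>
  in L1 together with u \<le> C makes the approximation uniform in t.\<close>

theorem weak_continuity:
  assumes h: "integrable \<pi> h"
  shows "continuous_on {0..T} (\<lambda>t. LINT x|\<pi>. h x * u t x)"
proof -
  have "\<exists>\<zeta>\<in>Lip_b. (\<integral>\<^sup>+x. ennreal \<bar>h x - \<zeta> x\<bar> \<partial>\<pi>) < ennreal (1 / real (Suc n))" for n
    using Lip_b_dense_L1[OF sets_pi pi.finite_measure_axioms h] unfolding lip_approximable_def by simp
  then obtain \<zeta> where \<zeta>: "\<And>n. \<zeta> n \<in> Lip_b"
    "\<And>n. (\<integral>\<^sup>+x. ennreal \<bar>h x - \<zeta> n x\<bar> \<partial>\<pi>) < ennreal (1 / real (Suc n))" by metis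
  have [measurable]: "\<zeta> n \<in> borel_measurable borel" for n using \<zeta>(1) by (intro borel_measurable_Lip_b)
  have \<zeta>_int: "integrable \<pi> (\<zeta> n)" for n
  proof -
    obtain K where "\<And>x. \<bar>\<zeta> n x\<bar> \<le> K" using Lip_b_bounded[OF \<zeta>(1)] by blast
    then show ?thesis by (intro pi.integrable_const_bound[of _ K]) auto
  qed
  have diff: "(LINT x|\<pi>. \<bar>h x - \<zeta> n x\<bar>) \<le> 1 / real (Suc n)" for n
  proof -
    have "ennreal (LINT x|\<pi>. \<bar>h x - \<zeta> n x\<bar>) = (\<integral>\<^sup>+x. ennreal \<bar>h x - \<zeta> n x\<bar> \<partial>\<pi>)"
      using h \<zeta>_int by (intro nn_integral_eq_integral[symmetric]) auto
    with \<zeta>(2)[of n] have "ennreal (LINT x|\<pi>. \<bar>h x - \<zeta> n x\<bar>) \<le> ennreal (1 / real (Suc n))" by simp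
    then show ?thesis by (subst (asm) ennreal_le_iff) auto
  qed
  show ?thesis
  proof (rule uniform_limit_theorem)
    show "\<forall>\<^sub>F n in sequentially. continuous_on {0..T} (\<lambda>t. LINT x|\<pi>. \<zeta> n x * u t x)"
    proof (rule always_eventually, rule allI)
      fix n
      show "continuous_on {0..T} (\<lambda>t. LINT x|\<pi>. \<zeta> n x * u t x)"
        using Lip_b_continuous_curve[OF \<zeta>(1)[of n]] by (rule continuous_on_eq) (simp add: integral_rho)
    qed
    show "uniform_limit {0..T} (\<lambda>n t. LINT x|\<pi>. \<zeta> n x * u t x) (\<lambda>t. LINT x|\<pi>. h x * u t x) sequentially"
    proof (rule uniform_limitI)
      fix e :: real assume "0 < e"
      obtain N :: nat where N: "C / e < real N" using reals_Archimedean2 by blast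
      show "\<forall>\<^sub>F n in sequentially. \<forall>t\<in>{0..T}. dist (LINT x|\<pi>. \<zeta> n x * u t x) (LINT x|\<pi>. h x * u t x) < e"
        unfolding eventually_sequentially
      proof (intro exI[of _ N] allI impI ballI)
        fix n t assume "N \<le> n"
        have "\<bar>(LINT x|\<pi>. \<zeta> n x * u t x) - (LINT x|\<pi>. h x * u t x)\<bar> = \<bar>LINT x|\<pi>. (\<zeta> n x - h x) * u t x\<bar>"
          using integrable_mult_u h \<zeta>_int by (simp add: left_diff_distrib)
        also have "\<dots> \<le> (LINT x|\<pi>. \<bar>(\<zeta> n x - h x) * u t x\<bar>)" by (rule integral_abs_bound)
        also have "\<dots> \<le> (LINT x|\<pi>. \<bar>h x - \<zeta> n x\<bar> * C)"
        proof (rule integral_mono)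
          show "integrable \<pi> (\<lambda>x. \<bar>(\<zeta> n x - h x) * u t x\<bar>)"
            using h \<zeta>_int by (intro integrable_abs integrable_mult_u) auto
          show "integrable \<pi> (\<lambda>x. \<bar>h x - \<zeta> n x\<bar> * C)" using h \<zeta>_int by auto
          show "\<bar>(\<zeta> n x - h x) * u t x\<bar> \<le> \<bar>h x - \<zeta> n x\<bar> * C" for x
            using u_nonneg[of t x] u_le[of t x] by (simp add: abs_mult abs_minus_commute mult_left_mono)
        qed
        also have "\<dots> \<le> 1 / real (Suc n) * C" using mult_right_mono[OF diff[of n], of C] C by simp
        also have "\<dots> < e"
        proof -
          have "C / e < real (Suc n)" using N \<open>N \<le> n\<close> by linarith
          then show ?thesis using \<open>0 < e\<close> by (simp add: field_simps)
        qed
        finally show "dist (LINT x|\<pi>. \<zeta> n x * u t x) (LINT x|\<pi>. h x * u t x) < e"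
          by (simp add: dist_real_def)
      qed
    qed
  qed simp
qed

text \<open>Weak continuity tested with indicators is setwise convergence, to which the lower
  semicontinuity hypothesis applies.\<close>

lemma fisher_measurable:
  "(\<lambda>t. fisher \<pi> \<kappa> \<phi> \<psi>s \<alpha> (\<rho> t)) \<in> borel_measurable (restrict_space borel {0..T})"
proof (rule seq_lsc_imp_borel_measurable)
  fix t s assume t: "t \<in> {0..T}" and s: "\<And>n. s n \<in> {0..T}" and lim: "s \<longlonglongrightarrow> t"
  have "(\<lambda>n. measure (\<rho> (s n)) B) \<longlonglongrightarrow> measure (\<rho> t) B" if B [measurable]: "B \<in> sets borel" for B
  proof -
    have eq: "measure (\<rho> r) B = (LINT x|\<pi>. indicator B x * u r x)" if r: "r \<in> {0..T}" for r
    proof -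
      have "measure (\<rho> r) B = (LINT x|\<rho> r. indicator B x)"
        using sets_rho[OF r] sets_eq_imp_space_eq[OF sets_rho[OF r]] by simp
      also have "\<dots> = (LINT x|\<pi>. indicator B x * u r x)" by (intro integral_rho[OF r]) simp
      finally show ?thesis .
    qed
    have "integrable \<pi> (indicator B :: 'a \<Rightarrow> real)" by (intro pi.integrable_const_bound[of _ 1]) auto
    from continuous_on_tendsto_compose[OF weak_continuity[OF this] lim t] s
    show ?thesis using t by (simp add: eq)
  qed
  then show "fisher \<pi> \<kappa> \<phi> \<psi>s \<alpha> (\<rho> t) \<le> liminf (\<lambda>n. fisher \<pi> \<kappa> \<phi> \<psi>s \<alpha> (\<rho> (s n)))"
    by (intro fisher_lsc[unfolded fisher_setwise_lsc_def, rule_format] rho_finite_entropy t s)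
qed simp

end

section \<open>The continuity equation with finite-energy test functions\<close>

lemma ennreal_le_add_of_minus_le: "a - b \<le> c \<Longrightarrow> a \<le> c + (b :: ennreal)"
  by (cases "b = top") (auto simp: ennreal_minus_le_iff add.commute)

lemma ennreal_minus_le_of_le_add: "a \<le> c + b \<Longrightarrow> b < top \<Longrightarrow> a - b \<le> (c :: ennreal)"
  by (auto simp: ennreal_minus_le_iff add.commute)

locale approximable_curve = bounded_curve +
  assumes approx: "\<forall>\<zeta>\<in>X2 \<pi> \<kappa>. \<exists>\<zeta>n :: nat \<Rightarrow> 'a \<Rightarrow> real. (\<forall>n. \<zeta>n n \<in> Lip_b) \<and>
    (\<lambda>n. \<integral>\<^sup>+ x. ennreal \<bar>\<zeta>n n x - \<zeta> x\<bar> \<partial>\<pi>) \<longlonglongrightarrow> 0 \<and>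
    (\<lambda>n. \<integral>\<^sup>+ z. ennreal ((grad (\<zeta>n n) z - grad \<zeta> z)\<^sup>2) \<partial>edges) \<longlonglongrightarrow> 0"
begin

abbreviation R :: "real \<Rightarrow> ennreal" where
  "R t \<equiv> dissipation \<pi> \<kappa> \<psi>s \<alpha> (\<rho> t) (j t)"

abbreviation D :: "real \<Rightarrow> ennreal" where
  "D t \<equiv> fisher \<pi> \<kappa> \<phi> \<psi>s \<alpha> (\<rho> t)"

lemma dissipation_finite: "(\<integral>\<^sup>+r\<in>{0..T}. (R r + D r) \<partial>lborel) < \<infinity>"
proof -
  have "(\<integral>\<^sup>+r\<in>{0..T}. (R r + D r) \<partial>lborel) + entropy \<pi> \<phi> (\<rho> T) \<le> entropy \<pi> \<phi> (\<rho> 0)"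
    using diss T unfolding dissipative_solution_def by auto
  then have "(\<integral>\<^sup>+r\<in>{0..T}. (R r + D r) \<partial>lborel) \<le> entropy \<pi> \<phi> (\<rho> 0)"
    by (rule order_trans[rotated]) simp
  also have "\<dots> < \<infinity>" using T by (intro entropy_finite) simp
  finally show ?thesis .
qed

lemma R_integral_finite: "(\<integral>\<^sup>+r\<in>{0..T}. R r \<partial>lborel) < \<infinity>"
  by (rule le_less_trans[OF nn_integral_mono dissipation_finite]) (auto split: split_indicator)

lemma D_integral_finite: "(\<integral>\<^sup>+r\<in>{0..T}. D r \<partial>lborel) < \<infinity>"
  by (rule le_less_trans[OF nn_integral_mono dissipation_finite]) (auto split: split_indicator)

text \<open>The dissipation may fail to be measurable in time, so that its integral is a lower integral.\<close>

definition Q :: "real \<Rightarrow> ennreal" where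
  "Q = (SOME Q. Q \<in> borel_measurable lborel \<and> Q \<le> (\<lambda>r. R r * indicator {0..T} r) \<and>
     integral\<^sup>N lborel Q = (\<integral>\<^sup>+r\<in>{0..T}. R r \<partial>lborel))"

lemma Q_props:
  "Q \<in> borel_measurable lborel \<and> Q \<le> (\<lambda>r. R r * indicator {0..T} r) \<and>
    integral\<^sup>N lborel Q = (\<integral>\<^sup>+r\<in>{0..T}. R r \<partial>lborel)"
proof -
  obtain Q' where "Q' \<in> borel_measurable lborel" "Q' \<le> (\<lambda>r. R r * indicator {0..T} r)"
    "integral\<^sup>N lborel Q' = (\<integral>\<^sup>+r\<in>{0..T}. R r \<partial>lborel)"
    by (rule measurable_lower_envelope)
  then have "\<exists>Q. Q \<in> borel_measurable lborel \<and> Q \<le> (\<lambda>r. R r * indicator {0..T} r) \<and>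
     integral\<^sup>N lborel Q = (\<integral>\<^sup>+r\<in>{0..T}. R r \<partial>lborel)" by (intro exI[of _ Q'] conjI)
  from someI_ex[OF this] show ?thesis unfolding Q_def .
qed

lemma Q_measurable [measurable]: "Q \<in> borel_measurable borel"
  and Q_le: "Q r \<le> R r * indicator {0..T} r"
  and Q_finite: "integral\<^sup>N lborel Q < \<infinity>"
  using Q_props R_integral_finite by (auto simp: le_fun_def)

text \<open>Transfers pointwise bounds by \<open>R\<close>, which cannot be integrated directly, to
  the measurable \<open>Q\<close>. It applies to whatever Young's inequality leaves below
  \<open>R\<close>.\<close>

lemma le_Q:
  assumes l: "l \<in> borel_measurable (restrict_space borel {0..T})" and le: "\<And>r. r \<in> {0..T} \<Longrightarrow> l r \<le> R r"
  shows "AE r in lborel. r \<in> {0..T} \<longrightarrow> l r \<le> Q r"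
proof -
  have "AE r in lborel. l r * indicator {0..T} r \<le> Q r"
  proof (rule lower_envelope_maximal)
    show "Q \<in> borel_measurable lborel" "Q \<le> (\<lambda>r. R r * indicator {0..T} r)"
      "integral\<^sup>N lborel Q = (\<integral>\<^sup>+r\<in>{0..T}. R r \<partial>lborel)" using Q_props by auto
    show "(\<integral>\<^sup>+r\<in>{0..T}. R r \<partial>lborel) < \<infinity>" by (rule R_integral_finite)
    show "(\<lambda>r. l r * indicator {0..T} r) \<in> borel_measurable lborel"
      using l by (subst (asm) borel_measurable_restrict_space_iff_ennreal) auto
    show "l r * indicator {0..T} r \<le> R r * indicator {0..T} r" for r
      using le by (auto split: split_indicator)
  qed
  then show ?thesis by (auto elim!: eventually_mono)
qed

lemma AE_edges_density: "t \<in> {0..T} \<Longrightarrow> AE z in edges. density_wrt \<pi> (\<rho> t) (fst z) = u t (fst z) \<and>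
    density_wrt \<pi> (\<rho> t) (snd z) = u t (snd z)"
  by (rule AE_edges_both[OF density_eq_u])

lemma young_at:
  assumes t: "t \<in> {0..T}" and f: "f \<in> borel_measurable borel"
  shows "(\<integral>\<^sup>+z. ennreal \<bar>f z\<bar> \<partial>flux_variation (j t)) \<le>
    R t + (1/2) * (\<integral>\<^sup>+z. ennreal (\<psi>s (f z) * \<alpha> (u t (fst z)) (u t (snd z))) \<partial>edges)"
proof -
  have "(\<integral>\<^sup>+z. ennreal (\<psi>s (f z) * \<alpha> (density_wrt \<pi> (\<rho> t) (fst z)) (density_wrt \<pi> (\<rho> t) (snd z))) \<partial>edges) =
      (\<integral>\<^sup>+z. ennreal (\<psi>s (f z) * \<alpha> (u t (fst z)) (u t (snd z))) \<partial>edges)"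
  proof (rule nn_integral_cong_AE)
    show "AE z in edges. ennreal (\<psi>s (f z) * \<alpha> (density_wrt \<pi> (\<rho> t) (fst z)) (density_wrt \<pi> (\<rho> t) (snd z))) =
        ennreal (\<psi>s (f z) * \<alpha> (u t (fst z)) (u t (snd z)))"
      using AE_edges_density[OF t] by eventually_elim simp
  qed
  with flux_young[OF \<psi> \<alpha> j_flux[OF t] f, of "\<rho> t"] show ?thesis by simp
qed

section \<open>Flux bounds in terms of the edge energy\<close>

text \<open>Young's inequality for \<Lambda> * f, with bounded mobility and arguments in a bounded
  range, where \<open>\<psi>s\<close> is at most quadratic. Large \<Lambda> makes the share of
  \<open>R\<close> small; the constant c depends neither on f nor on t.\<close>

lemma young_quadratic:
  fixes K \<Lambda> :: real
  assumes "0 < \<Lambda>"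
  obtains c where "0 < c" "\<And>f t. t \<in> {0..T} \<Longrightarrow> f \<in> borel_measurable borel \<Longrightarrow> AE z in edges. \<bar>f z\<bar> \<le> K \<Longrightarrow>
    ennreal \<Lambda> * (\<integral>\<^sup>+z. ennreal \<bar>f z\<bar> \<partial>flux_variation (j t)) \<le> R t + ennreal c * (\<integral>\<^sup>+z. ennreal ((f z)\<^sup>2) \<partial>edges)"
proof -
  obtain A where A: "0 < A" "\<And>u v. 0 \<le> u \<Longrightarrow> u \<le> C \<Longrightarrow> 0 \<le> v \<Longrightarrow> v \<le> C \<Longrightarrow> \<alpha> u v \<le> A"
    using mobility_bounded[OF \<alpha>] by metis
  obtain B where B: "0 < B" "\<And>\<xi>. \<bar>\<xi>\<bar> \<le> \<Lambda> * K \<Longrightarrow> \<psi>s \<xi> \<le> B * \<xi>\<^sup>2"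
    using dual_dissipation_quadratic_upper[OF \<psi>] by metis
  show ?thesis
  proof (rule that[of "B * \<Lambda>\<^sup>2 * A"])
    show "0 < B * \<Lambda>\<^sup>2 * A" using A B \<open>0 < \<Lambda>\<close> by simp
    fix f t assume t: "t \<in> {0..T}" and f [measurable]: "f \<in> borel_measurable borel"
      and K: "AE z in edges. \<bar>f z\<bar> \<le> K"
    have [measurable_cong]: "sets (flux_variation (j t)) = sets borel" using sets_j[OF t] by simp
    have "ennreal \<Lambda> * (\<integral>\<^sup>+z. ennreal \<bar>f z\<bar> \<partial>flux_variation (j t)) = (\<integral>\<^sup>+z. ennreal \<bar>\<Lambda> * f z\<bar> \<partial>flux_variation (j t))"
      using \<open>0 < \<Lambda>\<close> by (subst nn_integral_cmult[symmetric]) (auto simp: ennreal_mult abs_mult)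
    also have "\<dots> \<le> R t + (1/2) * (\<integral>\<^sup>+z. ennreal (\<psi>s (\<Lambda> * f z) * \<alpha> (u t (fst z)) (u t (snd z))) \<partial>edges)"
      by (rule young_at[OF t]) simp
    also have "\<dots> \<le> R t + 1 * (ennreal (B * \<Lambda>\<^sup>2 * A) * (\<integral>\<^sup>+z. ennreal ((f z)\<^sup>2) \<partial>edges))"
    proof (intro add_mono mult_mono order_refl)
      have "(\<integral>\<^sup>+z. ennreal (\<psi>s (\<Lambda> * f z) * \<alpha> (u t (fst z)) (u t (snd z))) \<partial>edges) \<le>
          (\<integral>\<^sup>+z. ennreal (B * \<Lambda>\<^sup>2 * A) * ennreal ((f z)\<^sup>2) \<partial>edges)"
      proof (rule nn_integral_mono_AE)
        show "AE z in edges. ennreal (\<psi>s (\<Lambda> * f z) * \<alpha> (u t (fst z)) (u t (snd z))) \<le> ennreal (B * \<Lambda>\<^sup>2 * A) * ennreal ((f z)\<^sup>2)"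
          using K
        proof eventually_elim
          case (elim z)
          have "\<psi>s (\<Lambda> * f z) \<le> B * (\<Lambda> * f z)\<^sup>2"
            using elim \<open>0 < \<Lambda>\<close> by (intro B) (simp add: abs_mult)
          then have "\<psi>s (\<Lambda> * f z) * \<alpha> (u t (fst z)) (u t (snd z)) \<le> (B * (\<Lambda> * f z)\<^sup>2) * A"
            using A B u_nonneg u_le mobility_nonneg[OF \<alpha>] by (intro mult_mono) auto
          also have "\<dots> = (B * \<Lambda>\<^sup>2 * A) * (f z)\<^sup>2" by (simp add: power_mult_distrib)
          finally show ?case using A B by (simp add: ennreal_mult[symmetric] ennreal_leI)
        qed
      qed
      also have "\<dots> = ennreal (B * \<Lambda>\<^sup>2 * A) * (\<integral>\<^sup>+z. ennreal ((f z)\<^sup>2) \<partial>edges)" by (rule nn_integral_cmult) simp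
      finally show "(\<integral>\<^sup>+z. ennreal (\<psi>s (\<Lambda> * f z) * \<alpha> (u t (fst z)) (u t (snd z))) \<partial>edges) \<le>
        ennreal (B * \<Lambda>\<^sup>2 * A) * (\<integral>\<^sup>+z. ennreal ((f z)\<^sup>2) \<partial>edges)" .
      show "(1 / 2 :: ennreal) \<le> 1" by (simp add: divide_le_posI_ennreal)
    qed auto
    finally show "ennreal \<Lambda> * (\<integral>\<^sup>+z. ennreal \<bar>f z\<bar> \<partial>flux_variation (j t)) \<le>
        R t + ennreal (B * \<Lambda>\<^sup>2 * A) * (\<integral>\<^sup>+z. ennreal ((f z)\<^sup>2) \<partial>edges)" by simp
  qed
qed

lemma variation_measurable_lborel:
  assumes "f \<in> borel_measurable borel"
  shows "(\<lambda>r. (\<integral>\<^sup>+z. f z \<partial>flux_variation (j r)) * indicator {0..T} r) \<in> borel_measurable lborel"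
  using variation_measurable[OF assms]
  by (subst (asm) borel_measurable_restrict_space_iff_ennreal) auto

definition total_flux :: "('a \<times> 'a \<Rightarrow> real) \<Rightarrow> ennreal" where
  "total_flux f = (\<integral>\<^sup>+r\<in>{0..T}. (\<integral>\<^sup>+z. ennreal \<bar>f z\<bar> \<partial>flux_variation (j r)) \<partial>lborel)"

lemma total_flux_bound:
  fixes K \<Lambda> :: real
  assumes "0 < \<Lambda>"
  obtains c where "0 < c" "\<And>f. f \<in> borel_measurable borel \<Longrightarrow> AE z in edges. \<bar>f z\<bar> \<le> K \<Longrightarrow>
    (\<integral>\<^sup>+z. ennreal ((f z)\<^sup>2) \<partial>edges) < \<infinity> \<Longrightarrow>
    ennreal \<Lambda> * total_flux f \<le> integral\<^sup>N lborel Q + ennreal c * (\<integral>\<^sup>+z. ennreal ((f z)\<^sup>2) \<partial>edges)"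
proof -
  obtain c where c: "0 < c" "\<And>f t. t \<in> {0..T} \<Longrightarrow> f \<in> borel_measurable borel \<Longrightarrow> AE z in edges. \<bar>f z\<bar> \<le> K \<Longrightarrow>
    ennreal \<Lambda> * (\<integral>\<^sup>+z. ennreal \<bar>f z\<bar> \<partial>flux_variation (j t)) \<le> R t + ennreal c * (\<integral>\<^sup>+z. ennreal ((f z)\<^sup>2) \<partial>edges)"
    using young_quadratic[OF assms] by metis
  show ?thesis
  proof (rule that[of "c * T"])
    show "0 < c * T" using c T by simp
    fix f assume f [measurable]: "f \<in> borel_measurable borel" and K: "AE z in edges. \<bar>f z\<bar> \<le> K"
      and fin: "(\<integral>\<^sup>+z. ennreal ((f z)\<^sup>2) \<partial>edges) < \<infinity>"
    define k where "k = ennreal c * (\<integral>\<^sup>+z. ennreal ((f z)\<^sup>2) \<partial>edges)"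
    have k: "k < top" using fin by (simp add: k_def ennreal_mult_less_top)
    define l where "l r = ennreal \<Lambda> * (\<integral>\<^sup>+z. ennreal \<bar>f z\<bar> \<partial>flux_variation (j r))" for r
    have l: "l \<in> borel_measurable (restrict_space borel {0..T})"
      unfolding l_def[abs_def] by (intro borel_measurable_times_ennreal variation_measurable) auto
    \<comment> \<open>Moving the constant to the left leaves a measurable minorant of
      \<open>R\<close>; finiteness of k is what permits this step.\<close>
    have "l r - k \<le> R r" if "r \<in> {0..T}" for r
      using c(2)[OF that f K] k unfolding l_def k_def by (intro ennreal_minus_le_of_le_add) auto
    then have "AE r in lborel. r \<in> {0..T} \<longrightarrow> l r - k \<le> Q r"
      using l by (intro le_Q) auto
    then have "(\<integral>\<^sup>+r\<in>{0..T}. l r \<partial>lborel) \<le> (\<integral>\<^sup>+r. Q r + k * indicator {0..T} r \<partial>lborel)"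
      by (intro nn_integral_mono_AE) (auto elim!: eventually_mono intro: ennreal_le_add_of_minus_le split: split_indicator)
    also have "\<dots> = integral\<^sup>N lborel Q + k * ennreal T"
      using T by (simp add: nn_integral_add nn_integral_cmult)
    also have "k * ennreal T = ennreal (c * T) * (\<integral>\<^sup>+z. ennreal ((f z)\<^sup>2) \<partial>edges)"
      using c T by (simp add: k_def ennreal_mult ac_simps)
    finally have "(\<integral>\<^sup>+r\<in>{0..T}. l r \<partial>lborel) \<le>
        integral\<^sup>N lborel Q + ennreal (c * T) * (\<integral>\<^sup>+z. ennreal ((f z)\<^sup>2) \<partial>edges)" .
    moreover have "(\<integral>\<^sup>+r\<in>{0..T}. l r \<partial>lborel) = ennreal \<Lambda> * total_flux f"
    proof -
      have "(\<lambda>r. (\<integral>\<^sup>+z. ennreal \<bar>f z\<bar> \<partial>flux_variation (j r)) * indicator {0..T} r) \<in> borel_measurable lborel"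
        by (rule variation_measurable_lborel) simp
      then show ?thesis
        unfolding total_flux_def l_def by (subst nn_integral_cmult[symmetric]) (auto simp: mult.assoc)
    qed
    ultimately show "ennreal \<Lambda> * total_flux f \<le>
        integral\<^sup>N lborel Q + ennreal (c * T) * (\<integral>\<^sup>+z. ennreal ((f z)\<^sup>2) \<partial>edges)" by simp
  qed
qed

lemma total_flux_finite:
  assumes "f \<in> borel_measurable borel" "AE z in edges. \<bar>f z\<bar> \<le> K" "(\<integral>\<^sup>+z. ennreal ((f z)\<^sup>2) \<partial>edges) < \<infinity>"
  shows "total_flux f < \<infinity>"
proof -
  obtain c where "ennreal 1 * total_flux f \<le> integral\<^sup>N lborel Q + ennreal c * (\<integral>\<^sup>+z. ennreal ((f z)\<^sup>2) \<partial>edges)"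
    using total_flux_bound[of 1 K] assms by (metis zero_less_one)
  also have "\<dots> < \<infinity>" using Q_finite assms(3) by (simp add: ennreal_mult_less_top)
  finally show ?thesis by simp
qed

text \<open>\<Lambda> is fixed first, large enough to make the share of the total dissipation small.
  Only then is n taken large, so that the energy term, whose constant depends on \<Lambda>, is at
  most 1.\<close>

lemma total_flux_tendsto_0:
  fixes f :: "nat \<Rightarrow> 'a \<times> 'a \<Rightarrow> real"
  assumes f: "\<And>n. f n \<in> borel_measurable borel" and K: "\<And>n. AE z in edges. \<bar>f n z\<bar> \<le> K"
    and lim: "(\<lambda>n. \<integral>\<^sup>+z. ennreal ((f n z)\<^sup>2) \<partial>edges) \<longlonglongrightarrow> 0" and \<epsilon>: "0 < \<epsilon>"
  shows "\<forall>\<^sub>F n in sequentially. total_flux (f n) \<le> ennreal \<epsilon>"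
proof -
  obtain q where q: "0 \<le> q" "integral\<^sup>N lborel Q = ennreal q"
    using Q_finite by (cases "integral\<^sup>N lborel Q") auto
  define \<Lambda> where "\<Lambda> = (q + 1) / \<epsilon>"
  have \<Lambda>: "0 < \<Lambda>" using q \<epsilon> by (simp add: \<Lambda>_def)
  obtain c where c: "0 < c" "\<And>f. f \<in> borel_measurable borel \<Longrightarrow> AE z in edges. \<bar>f z\<bar> \<le> K \<Longrightarrow>
    (\<integral>\<^sup>+z. ennreal ((f z)\<^sup>2) \<partial>edges) < \<infinity> \<Longrightarrow>
    ennreal \<Lambda> * total_flux f \<le> integral\<^sup>N lborel Q + ennreal c * (\<integral>\<^sup>+z. ennreal ((f z)\<^sup>2) \<partial>edges)"
    using total_flux_bound[OF \<Lambda>] by metis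
  have "\<forall>\<^sub>F n in sequentially. (\<integral>\<^sup>+z. ennreal ((f n z)\<^sup>2) \<partial>edges) < ennreal (1 / c)"
    using c by (intro order_tendstoD[OF lim]) simp
  then show ?thesis
  proof eventually_elim
    case (elim n)
    have "ennreal \<Lambda> * total_flux (f n) \<le> ennreal q + ennreal c * (\<integral>\<^sup>+z. ennreal ((f n z)\<^sup>2) \<partial>edges)"
      unfolding q(2)[symmetric] using elim by (intro c f K) (simp add: less_trans[OF _ ennreal_less_top])
    also have "\<dots> \<le> ennreal q + ennreal c * ennreal (1 / c)"
      using elim by (intro add_mono mult_left_mono) auto
    also have "\<dots> = ennreal (q + 1)" using c q by (simp add: ennreal_mult[symmetric])
    also have "\<dots> = ennreal \<Lambda> * ennreal \<epsilon>" using \<epsilon> \<Lambda> by (simp add: ennreal_mult[symmetric] \<Lambda>_def)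
    finally show ?case using \<Lambda> by (simp add: ennreal_mult_le_mult_iff)
  qed
qed

section \<open>Uniformly bounded Lipschitz approximation in energy\<close>

lemma X2_grad_square: "\<zeta> \<in> X2 \<pi> \<kappa> \<Longrightarrow> (\<integral>\<^sup>+z. ennreal ((grad \<zeta> z)\<^sup>2) \<partial>edges) < \<infinity>"
proof -
  have "ennreal ((grad \<zeta> z)\<^sup>2) * indicator offdiag z = ennreal ((grad \<zeta> z)\<^sup>2)" for z
    by (auto simp: grad_def offdiag_def split: split_indicator)
  moreover assume "\<zeta> \<in> X2 \<pi> \<kappa>"
  ultimately show ?thesis by (simp add: X2_def)
qed

lemma grad_bounded:
  assumes "AE x in \<pi>. \<bar>\<zeta> x\<bar> \<le> K"
  shows "AE z in edges. \<bar>grad \<zeta> z\<bar> \<le> 2 * K"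
  using AE_edges_both[OF assms] by eventually_elim (auto simp: grad_def split: prod.split)

text \<open>Truncation is a normal contraction, and normal contractions are continuous in the
  energy norm.\<close>

lemma bounded_Lip_b_approximation:
  assumes \<zeta>: "\<zeta> \<in> X2 \<pi> \<kappa>" and K: "AE x in \<pi>. \<bar>\<zeta> x\<bar> \<le> K"
  obtains \<xi> where "\<And>n :: nat. \<xi> n \<in> Lip_b" "\<And>n x. \<bar>\<xi> n x\<bar> \<le> \<bar>K\<bar>" "AE x in \<pi>. (\<lambda>n. \<xi> n x) \<longlonglongrightarrow> \<zeta> x"
    "(\<lambda>n. \<integral>\<^sup>+z. ennreal ((grad (\<xi> n) z - grad \<zeta> z)\<^sup>2) \<partial>edges) \<longlonglongrightarrow> 0"
proof -
  have [measurable]: "\<zeta> \<in> borel_measurable borel" using \<zeta> by (simp add: X2_def)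
  obtain \<zeta>n where \<zeta>n: "\<And>n. \<zeta>n n \<in> Lip_b"
    and L1: "(\<lambda>n. \<integral>\<^sup>+x. ennreal \<bar>\<zeta>n n x - \<zeta> x\<bar> \<partial>\<pi>) \<longlonglongrightarrow> 0"
    and L2: "(\<lambda>n. \<integral>\<^sup>+z. ennreal ((grad (\<zeta>n n) z - grad \<zeta> z)\<^sup>2) \<partial>edges) \<longlonglongrightarrow> 0"
    using approx \<zeta> by meson
  have [measurable]: "\<zeta>n n \<in> borel_measurable borel" for n using \<zeta>n by (intro borel_measurable_Lip_b)
  have int: "integrable \<pi> (\<lambda>x. \<zeta>n n x - \<zeta> x)" for n
  proof -
    obtain B where B: "\<And>x. \<bar>\<zeta>n n x\<bar> \<le> B" using Lip_b_bounded[OF \<zeta>n] by blast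
    have "AE x in \<pi>. norm (\<zeta>n n x - \<zeta> x) \<le> B + K"
      using K
    proof eventually_elim
      case (elim x)
      with B[of x] show ?case by simp
    qed
    then show ?thesis by (intro pi.integrable_const_bound) auto
  qed
  have "(\<lambda>n. ennreal (LINT x|\<pi>. norm (\<zeta>n n x - \<zeta> x))) \<longlonglongrightarrow> ennreal 0"
    using L1 nn_integral_eq_integral[OF integrable_norm[OF int]] by simp
  then have "(\<lambda>n. LINT x|\<pi>. norm (\<zeta>n n x - \<zeta> x)) \<longlonglongrightarrow> 0"
    by (rule tendsto_ennrealD) auto
  \<comment> \<open>The truncation is passed to the limit pointwise; L1 convergence allows this
    along a subsequence.\<close>
  from tendsto_L1_AE_subseq[OF int this] obtain m where m: "strict_mono m"
    and ae: "AE x in \<pi>. (\<lambda>n. \<zeta>n (m n) x - \<zeta> x) \<longlonglongrightarrow> 0" by blast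
  define tr where "tr r = max (- \<bar>K\<bar>) (min \<bar>K\<bar> r)" for r :: real
  have tr: "\<bar>tr r - tr s\<bar> \<le> \<bar>r - s\<bar>" "\<bar>tr r\<bar> \<le> \<bar>K\<bar>" for r s
    by (auto simp: tr_def max_def min_def)
  have tr_cont: "isCont tr r" for r unfolding tr_def[abs_def] by (intro continuous_intros)
  define \<xi> where "\<xi> n x = tr (\<zeta>n (m n) x)" for n x
  have \<xi>_Lip: "\<xi> n \<in> Lip_b" for n
    unfolding \<xi>_def[abs_def] by (rule Lip_b_contraction[OF \<zeta>n tr(1)])
  have [measurable]: "\<xi> n \<in> borel_measurable borel" for n using \<xi>_Lip by (intro borel_measurable_Lip_b)
  have \<xi>_lim: "AE x in \<pi>. (\<lambda>n. \<xi> n x) \<longlonglongrightarrow> \<zeta> x"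
    using ae K
  proof eventually_elim
    case (elim x)
    have "(\<lambda>n. \<zeta>n (m n) x) \<longlonglongrightarrow> \<zeta> x" using elim(1) by (rule LIM_zero_cancel)
    then have "(\<lambda>n. \<xi> n x) \<longlonglongrightarrow> tr (\<zeta> x)"
      unfolding \<xi>_def using tr_cont[of "\<zeta> x"] by (rule isCont_tendsto_compose[rotated])
    moreover have "tr (\<zeta> x) = \<zeta> x" using elim(2) by (auto simp: tr_def)
    ultimately show ?case by simp
  qed
  define a where "a n z = (grad (\<xi> n) z - grad \<zeta> z)\<^sup>2" for n z
  define e where "e n z = 2 * (grad (\<zeta>n (m n)) z - grad \<zeta> z)\<^sup>2" for n z
  have [measurable]: "a n \<in> borel_measurable borel" "e n \<in> borel_measurable borel" for n
    unfolding a_def e_def by measurable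
  \<comment> \<open>Truncation contracts gradients, so the error is at most |p| + 2 |q| in the
    notation below; squaring gives the constants 2 and 8.\<close>
  have a_le: "a n z \<le> e n z + 8 * (grad \<zeta> z)\<^sup>2" for n z
  proof -
    have le: "\<bar>grad (\<xi> n) z\<bar> \<le> \<bar>grad (\<zeta>n (m n)) z\<bar>"
      unfolding \<xi>_def grad_def using tr(1) by (auto split: prod.split)
    define p q where "p = grad (\<zeta>n (m n)) z - grad \<zeta> z" and "q = grad \<zeta> z"
    have "\<bar>grad (\<xi> n) z - grad \<zeta> z\<bar> \<le> \<bar>p\<bar> + 2 * \<bar>q\<bar>" using le by (simp add: p_def q_def)
    then have "\<bar>grad (\<xi> n) z - grad \<zeta> z\<bar>\<^sup>2 \<le> (\<bar>p\<bar> + 2 * \<bar>q\<bar>)\<^sup>2" by (intro power_mono) auto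
    also have "\<dots> \<le> 2 * p\<^sup>2 + 8 * q\<^sup>2"
    proof -
      have "0 \<le> (\<bar>p\<bar> - 2 * \<bar>q\<bar>)\<^sup>2" by simp
      then show ?thesis by (simp add: power2_eq_square algebra_simps)
    qed
    finally show ?thesis by (simp add: a_def e_def p_def q_def)
  qed
  have a_lim: "AE z in edges. (\<lambda>n. a n z) \<longlonglongrightarrow> 0"
    using AE_edges_both[OF \<xi>_lim]
  proof eventually_elim
    case (elim z)
    then have "(\<lambda>n. (\<xi> n (snd z) - \<xi> n (fst z) - (\<zeta> (snd z) - \<zeta> (fst z)))\<^sup>2) \<longlonglongrightarrow>
        (\<zeta> (snd z) - \<zeta> (fst z) - (\<zeta> (snd z) - \<zeta> (fst z)))\<^sup>2" by (intro tendsto_intros) auto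
    then show ?case by (simp add: a_def grad_def case_prod_beta)
  qed
  \<comment> \<open>The majorant of a n varies with n through e n, which tends to 0 in L1.
    Subtracting e n leaves a positive part with a fixed integrable majorant.\<close>
  have "(\<lambda>n. \<integral>\<^sup>+z. ennreal (a n z - e n z) \<partial>edges) \<longlonglongrightarrow> (\<integral>\<^sup>+z. 0 \<partial>edges)"
  proof (rule nn_integral_dominated_convergence[where w = "\<lambda>z. ennreal (8 * (grad \<zeta> z)\<^sup>2)"])
    show "(\<integral>\<^sup>+z. ennreal (8 * (grad \<zeta> z)\<^sup>2) \<partial>edges) < \<infinity>"
      using X2_grad_square[OF \<zeta>] by (simp add: ennreal_mult nn_integral_cmult ennreal_mult_less_top)
    show "AE z in edges. ennreal (a n z - e n z) \<le> ennreal (8 * (grad \<zeta> z)\<^sup>2)" for n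
      using a_le by (intro AE_I2 ennreal_leI) (simp add: algebra_simps)
    show "AE z in edges. (\<lambda>n. ennreal (a n z - e n z)) \<longlonglongrightarrow> 0"
      using a_lim
    proof eventually_elim
      case (elim z)
      have "(\<lambda>n. ennreal (a n z)) \<longlonglongrightarrow> 0" using tendsto_ennrealI[OF elim] by simp
      moreover have "ennreal (a n z - e n z) \<le> ennreal (a n z)" for n
        by (intro ennreal_leI) (simp add: e_def)
      ultimately show ?case
        by (rule_tac tendsto_sandwich[OF _ _ tendsto_const]) (simp_all add: always_eventually)
    qed
  qed auto
  moreover have "(\<lambda>n. \<integral>\<^sup>+z. ennreal (e n z) \<partial>edges) \<longlonglongrightarrow> 0"
  proof -
    have "(\<lambda>n. \<integral>\<^sup>+z. ennreal ((grad (\<zeta>n (m n)) z - grad \<zeta> z)\<^sup>2) \<partial>edges) \<longlonglongrightarrow> 0"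
      using LIMSEQ_subseq_LIMSEQ[OF L2 m] by (simp add: o_def)
    then have "(\<lambda>n. 2 * (\<integral>\<^sup>+z. ennreal ((grad (\<zeta>n (m n)) z - grad \<zeta> z)\<^sup>2) \<partial>edges)) \<longlonglongrightarrow> 2 * 0"
      by (intro ennreal_tendsto_cmult) auto
    then show ?thesis by (simp add: e_def ennreal_mult nn_integral_cmult)
  qed
  ultimately have sum0: "(\<lambda>n. (\<integral>\<^sup>+z. ennreal (a n z - e n z) \<partial>edges) + (\<integral>\<^sup>+z. ennreal (e n z) \<partial>edges)) \<longlonglongrightarrow> 0"
    using tendsto_add[of _ "0::ennreal" sequentially _ 0] by simp
  have "(\<lambda>n. \<integral>\<^sup>+z. ennreal (a n z) \<partial>edges) \<longlonglongrightarrow> 0"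
  proof (rule tendsto_sandwich[OF _ _ tendsto_const sum0])
    show "\<forall>\<^sub>F n in sequentially. (\<integral>\<^sup>+z. ennreal (a n z) \<partial>edges) \<le>
      (\<integral>\<^sup>+z. ennreal (a n z - e n z) \<partial>edges) + (\<integral>\<^sup>+z. ennreal (e n z) \<partial>edges)"
    proof (rule always_eventually, rule allI)
      fix n
      have "ennreal (a n z) \<le> ennreal (a n z - e n z) + ennreal (e n z)" for z
      proof (cases "e n z \<le> a n z")
        case True
        then show ?thesis by (simp add: ennreal_plus[symmetric] e_def del: ennreal_plus)
      next
        case False
        then have "ennreal (a n z) \<le> ennreal (e n z)" by (intro ennreal_leI) simp
        then show ?thesis by (rule order_trans) simp
      qed
      then have "(\<integral>\<^sup>+z. ennreal (a n z) \<partial>edges) \<le> (\<integral>\<^sup>+z. ennreal (a n z - e n z) + ennreal (e n z) \<partial>edges)"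
        by (rule nn_integral_mono)
      also have "\<dots> = (\<integral>\<^sup>+z. ennreal (a n z - e n z) \<partial>edges) + (\<integral>\<^sup>+z. ennreal (e n z) \<partial>edges)"
        by (rule nn_integral_add) auto
      finally show "(\<integral>\<^sup>+z. ennreal (a n z) \<partial>edges) \<le>
        (\<integral>\<^sup>+z. ennreal (a n z - e n z) \<partial>edges) + (\<integral>\<^sup>+z. ennreal (e n z) \<partial>edges)" .
    qed
  qed simp
  then show ?thesis
    using \<xi>_Lip \<xi>_lim tr(2) by (intro that[of \<xi>]) (auto simp: \<xi>_def a_def)
qed

section \<open>Passage to the limit in the continuity equation\<close>

lemma integrable_grad_flux:
  assumes [measurable]: "\<zeta> \<in> borel_measurable borel" and r: "r \<in> {0..T}"
    and fin: "(\<integral>\<^sup>+z. ennreal \<bar>grad \<zeta> z\<bar> \<partial>flux_variation (j r)) < \<infinity>"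
  shows "integrable (fst (j r)) (grad \<zeta>)" "integrable (snd (j r)) (grad \<zeta>)"
proof -
  have [measurable_cong]: "sets (fst (j r)) = sets borel" "sets (snd (j r)) = sets borel" using sets_j[OF r] by auto
  have "(\<integral>\<^sup>+z. ennreal \<bar>grad \<zeta> z\<bar> \<partial>fst (j r)) + (\<integral>\<^sup>+z. ennreal \<bar>grad \<zeta> z\<bar> \<partial>snd (j r)) < \<infinity>"
    using fin by (subst (asm) nn_integral_flux_variation[OF j_flux[OF r]]) auto
  then show "integrable (fst (j r)) (grad \<zeta>)" "integrable (snd (j r)) (grad \<zeta>)"
    by (auto intro!: integrableI_bounded)
qed

text \<open>\<open>flow\<close> is additive at times where both gradients are integrable; elsewhere
  default values of integrals interfere. Finite total flux makes these almost all times.\<close>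

lemma flow_diff_le:
  assumes [measurable]: "\<zeta> \<in> borel_measurable borel" "\<xi> \<in> borel_measurable borel"
    and fin: "total_flux (grad \<zeta>) < \<infinity>" "total_flux (grad \<xi>) < \<infinity>" and st: "0 \<le> s" "t \<le> T"
  shows "ennreal \<bar>(LBINT r:{s..t}. flow \<xi> r) - (LBINT r:{s..t}. flow \<zeta> r)\<bar> \<le> total_flux (\<lambda>z. grad \<xi> z - grad \<zeta> z)"
proof -
  have sub: "{s..t} \<subseteq> {0..T}" using st by auto
  have int: "set_integrable lborel {s..t} (flow \<zeta>)" "set_integrable lborel {s..t} (flow \<xi>)"
    using fin sub by (auto intro!: set_integrable_subset[OF flow_set_integrable] simp: total_flux_def)
  have ae: "AE r in lborel. r \<in> {0..T} \<longrightarrow> (\<integral>\<^sup>+z. ennreal \<bar>grad \<eta> z\<bar> \<partial>flux_variation (j r)) < \<infinity>"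
    if [measurable]: "\<eta> \<in> borel_measurable borel" and "total_flux (grad \<eta>) < \<infinity>" for \<eta>
  proof -
    have "(\<lambda>r. (\<integral>\<^sup>+z. ennreal \<bar>grad \<eta> z\<bar> \<partial>flux_variation (j r)) * indicator {0..T} r) \<in> borel_measurable lborel"
      by (rule variation_measurable_lborel) simp
    then have "AE r in lborel. (\<integral>\<^sup>+z. ennreal \<bar>grad \<eta> z\<bar> \<partial>flux_variation (j r)) * indicator {0..T} r \<noteq> \<infinity>"
      using that(2) by (intro nn_integral_PInf_AE) (auto simp: total_flux_def)
    then show ?thesis by eventually_elim (auto simp: less_top split: split_indicator_asm)
  qed
  have "ennreal \<bar>(LBINT r:{s..t}. flow \<xi> r) - (LBINT r:{s..t}. flow \<zeta> r)\<bar> =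
      ennreal \<bar>LINT r|lborel. indicator {s..t} r * (flow \<xi> r - flow \<zeta> r)\<bar>"
    using int unfolding set_lebesgue_integral_def set_integrable_def
    by (simp add: right_diff_distrib)
  also have "\<dots> \<le> (\<integral>\<^sup>+r. ennreal \<bar>indicator {s..t} r * (flow \<xi> r - flow \<zeta> r)\<bar> \<partial>lborel)"
    by (rule ennreal_abs_integral_le)
  also have "\<dots> \<le> total_flux (\<lambda>z. grad \<xi> z - grad \<zeta> z)"
    unfolding total_flux_def
  proof (rule nn_integral_mono_AE)
    show "AE r in lborel. ennreal \<bar>indicator {s..t} r * (flow \<xi> r - flow \<zeta> r)\<bar> \<le>
        (\<integral>\<^sup>+z. ennreal \<bar>grad \<xi> z - grad \<zeta> z\<bar> \<partial>flux_variation (j r)) * indicator {0..T} r"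
      using ae[OF assms(1) fin(1)] ae[OF assms(2) fin(2)]
    proof eventually_elim
      case (elim r)
      show ?case
      proof (cases "r \<in> {s..t}")
        case True
        then have r: "r \<in> {0..T}" using sub by auto
        have grad_diff: "grad (\<lambda>x. \<xi> x - \<zeta> x) z = grad \<xi> z - grad \<zeta> z" for z
          by (auto simp: grad_def split: prod.split)
        have "flow (\<lambda>x. \<xi> x - \<zeta> x) r = flow \<xi> r - flow \<zeta> r"
          using integrable_grad_flux[OF assms(1) r] integrable_grad_flux[OF assms(2) r] elim r
          by (simp add: flow_eq grad_diff)
        then show ?thesis
          using flow_le_variation[OF r, of "\<lambda>x. \<xi> x - \<zeta> x"] True r by (simp add: grad_diff)
      qed simp
    qed
  qed
  finally show ?thesis .
qed

text \<open>The approximants are uniformly bounded. This gives dominated convergence at each fixed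
  time and keeps the gradient differences in the range where the quadratic flux bound
  applies.\<close>

theorem X2_continuity:
  assumes \<zeta>: "\<zeta> \<in> X2 \<pi> \<kappa>"
  shows "grad_flux_integrable T j \<zeta>" "continuity_identity T \<rho> j \<zeta>" "total_flux (grad \<zeta>) < \<infinity>"
proof -
  have [measurable]: "\<zeta> \<in> borel_measurable borel" using \<zeta> by (simp add: X2_def)
  obtain K where K: "AE x in \<pi>. \<bar>\<zeta> x\<bar> \<le> K" using \<zeta> by (auto simp: X2_def)
  show fin: "total_flux (grad \<zeta>) < \<infinity>"
    by (rule total_flux_finite[OF _ grad_bounded[OF K] X2_grad_square[OF \<zeta>]]) simp
  have "ennreal \<bar>grad \<zeta> z\<bar> * indicator offdiag z = ennreal \<bar>grad \<zeta> z\<bar>" for z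
    by (auto simp: grad_def offdiag_def split: split_indicator)
  with fin show "grad_flux_integrable T j \<zeta>"
    by (simp add: grad_flux_integrable_def total_flux_def)
  obtain \<xi> where \<xi>: "\<And>n :: nat. \<xi> n \<in> Lip_b" "\<And>n x. \<bar>\<xi> n x\<bar> \<le> \<bar>K\<bar>" "AE x in \<pi>. (\<lambda>n. \<xi> n x) \<longlonglongrightarrow> \<zeta> x"
    "(\<lambda>n. \<integral>\<^sup>+z. ennreal ((grad (\<xi> n) z - grad \<zeta> z)\<^sup>2) \<partial>edges) \<longlonglongrightarrow> 0"
    using bounded_Lip_b_approximation[OF \<zeta> K] by blast
  have [measurable]: "\<xi> n \<in> borel_measurable borel" for n using \<xi> by (intro borel_measurable_Lip_b)
  show "continuity_identity T \<rho> j \<zeta>"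
    unfolding continuity_identity_def flow_def[symmetric]
  proof (intro allI impI)
    fix s t assume st: "0 \<le> s" "s \<le> t" "t \<le> T"
    have lhs: "(\<lambda>n. LINT x|\<rho> r. \<xi> n x) \<longlonglongrightarrow> (LINT x|\<rho> r. \<zeta> x)" if r: "r \<in> {0..T}" for r
    proof -
      have "(\<lambda>n. LINT x|\<pi>. \<xi> n x * u r x) \<longlonglongrightarrow> (LINT x|\<pi>. \<zeta> x * u r x)"
      proof (rule integral_dominated_convergence[where w = "\<lambda>_. \<bar>K\<bar> * C"])
        show "AE x in \<pi>. (\<lambda>n. \<xi> n x * u r x) \<longlonglongrightarrow> \<zeta> x * u r x"
          using \<xi>(3) by eventually_elim (intro tendsto_intros)
        show "AE x in \<pi>. norm (\<xi> n x * u r x) \<le> \<bar>K\<bar> * C" for n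
          using \<xi>(2)[of n] u_le[of r] u_nonneg[of r] by (intro AE_I2) (auto simp: abs_mult intro!: mult_mono)
      qed auto
      then show ?thesis by (simp add: integral_rho[OF r])
    qed
    have rhs: "(\<lambda>n. LBINT r:{s..t}. flow (\<xi> n) r) \<longlonglongrightarrow> (LBINT r:{s..t}. flow \<zeta> r)"
    proof (rule tendstoI)
      fix e :: real assume "0 < e"
      have bd: "AE z in edges. \<bar>grad (\<xi> n) z - grad \<zeta> z\<bar> \<le> 4 * \<bar>K\<bar>" for n
      proof -
        have "AE x in \<pi>. \<bar>\<xi> n x - \<zeta> x\<bar> \<le> 2 * \<bar>K\<bar>"
          using K
        proof eventually_elim
          case (elim x)
          with \<xi>(2)[of n x] show ?case by linarith
        qed
        from grad_bounded[OF this] show ?thesis by (simp add: grad_def case_prod_beta algebra_simps)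
      qed
      have "\<forall>\<^sub>F n in sequentially. total_flux (\<lambda>z. grad (\<xi> n) z - grad \<zeta> z) \<le> ennreal (e / 2)"
        using \<open>0 < e\<close> by (intro total_flux_tendsto_0[OF _ bd \<xi>(4)]) auto
      then show "\<forall>\<^sub>F n in sequentially. dist (LBINT r:{s..t}. flow (\<xi> n) r) (LBINT r:{s..t}. flow \<zeta> r) < e"
      proof eventually_elim
        case (elim n)
        have "total_flux (grad (\<xi> n)) < \<infinity>"
          using Lip_b_grad_integrable[OF \<xi>(1)] by (simp add: total_flux_def)
        then have "ennreal \<bar>(LBINT r:{s..t}. flow (\<xi> n) r) - (LBINT r:{s..t}. flow \<zeta> r)\<bar> \<le> ennreal (e / 2)"
          using fin st by (intro order_trans[OF flow_diff_le elim]) auto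
        then have "\<bar>(LBINT r:{s..t}. flow (\<xi> n) r) - (LBINT r:{s..t}. flow \<zeta> r)\<bar> \<le> e / 2"
          using \<open>0 < e\<close> by (subst (asm) ennreal_le_iff) auto
        then show ?case using \<open>0 < e\<close> by (simp add: dist_real_def)
      qed
    qed
    have "(LINT x|\<rho> t. \<xi> n x) - (LINT x|\<rho> s. \<xi> n x) = (LBINT r:{s..t}. flow (\<xi> n) r)" for n
      using CE \<xi>(1)[of n] st unfolding CE_def continuity_identity_def flow_def by blast
    then have "(\<lambda>n. LBINT r:{s..t}. flow (\<xi> n) r) \<longlonglongrightarrow> (LINT x|\<rho> t. \<zeta> x) - (LINT x|\<rho> s. \<zeta> x)"
      using tendsto_diff[OF lhs[of t] lhs[of s]] st by simp
    from LIMSEQ_unique[OF this rhs]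
    show "(LINT x|\<rho> t. \<zeta> x) - (LINT x|\<rho> s. \<zeta> x) = (LBINT r:{s..t}. flow \<zeta> r)" .
  qed
qed

end

section \<open>The chain rule inequality\<close>

locale convex_curve = approximable_curve +
  assumes fisher_conv: "fisher_convex \<pi> \<kappa> \<phi> \<psi>s \<alpha>"
begin

text \<open>Mixing with \<open>\<pi>\<close> keeps the density away from \<open>0\<close>, where \<open>\<phi>'\<close> may be singular and the mobility
  may vanish.\<close>

definition v :: "real \<Rightarrow> real \<Rightarrow> 'a \<Rightarrow> real" where
  "v \<delta> t x = (1 - \<delta>) * u t x + \<delta>"

definition edge_mobility :: "real \<Rightarrow> real \<Rightarrow> 'a \<times> 'a \<Rightarrow> real" where
  "edge_mobility \<delta> t z = \<alpha> (v \<delta> t (fst z)) (v \<delta> t (snd z))"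

text \<open>Entropy of the mixture as a real number; \<delta> = 0 is the entropy of the curve
  itself, see \<open>entropy_eq_ent\<close>.\<close>

definition ent :: "real \<Rightarrow> real \<Rightarrow> real" where
  "ent \<delta> t = (LINT x|\<pi>. \<phi> (v \<delta> t x))"

text \<open>The first variation of the entropy at the mixed density.\<close>

definition test :: "real \<Rightarrow> real \<Rightarrow> 'a \<Rightarrow> real" where
  "test \<delta> t x = deriv \<phi> (v \<delta> t x)"

lemma v_measurable [measurable]: "v \<delta> t \<in> borel_measurable borel"
  unfolding v_def[abs_def] by measurable

context
  fixes \<delta> :: real
  assumes \<delta>: "0 \<le> \<delta>" "\<delta> \<le> 1"
begin

lemma v_ge: "\<delta> \<le> v \<delta> t x"
  using \<delta> u_nonneg by (simp add: v_def)

lemma v_nonneg: "0 \<le> v \<delta> t x"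
  using v_ge \<delta> order_trans by blast

lemma v_le: "v \<delta> t x \<le> C + 1"
proof -
  have "(1 - \<delta>) * u t x \<le> 1 * C" using \<delta> u_nonneg u_le by (intro mult_mono) auto
  then show ?thesis using \<delta> by (simp add: v_def)
qed

lemma edge_mobility_measurable [measurable]: "edge_mobility \<delta> t \<in> borel_measurable borel"
  unfolding edge_mobility_def[abs_def]
  by (intro borel_measurable_edge_mobility[OF \<alpha>] v_measurable v_nonneg)

lemma edge_mobility_nonneg: "0 \<le> edge_mobility \<delta> t z"
  unfolding edge_mobility_def by (intro mobility_nonneg[OF \<alpha>] v_nonneg)

text \<open>Concavity along the segment from the density pair of the curve to (1, 1). It compares
  the mixed mobility with the original one and also yields a positive lower bound.\<close>

lemma edge_mobility_mix:
  "(1 - \<delta>) * \<alpha> (u t (fst z)) (u t (snd z)) + \<delta> * \<alpha> 1 1 \<le> edge_mobility \<delta> t z"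
  using mobility_concave[OF \<alpha> \<delta> u_nonneg u_nonneg, of 1 1] by (simp add: edge_mobility_def v_def)

lemma phi_v_measurable [measurable]: "(\<lambda>x. \<phi> (v \<delta> t x)) \<in> borel_measurable borel"
  by (intro borel_measurable_entropy_density[OF \<phi>] v_measurable v_nonneg)

lemma phi_v_integrable: "integrable \<pi> (\<lambda>x. \<phi> (v \<delta> t x))"
proof -
  obtain B where B: "\<And>r. 0 \<le> r \<Longrightarrow> r \<le> C + 1 \<Longrightarrow> \<phi> r \<le> B" using entropy_density_bounded[OF \<phi>] by metis
  have "norm (\<phi> (v \<delta> t x)) \<le> B" for x
    using B[OF v_nonneg v_le] entropy_density_nonneg[OF \<phi> v_nonneg] by simp
  then show ?thesis by (intro pi.integrable_const_bound[of _ B]) auto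
qed

lemma ent_nonneg: "0 \<le> ent \<delta> t"
  unfolding ent_def by (intro integral_nonneg_AE AE_I2 entropy_density_nonneg[OF \<phi>] v_nonneg)

end

section \<open>Weak continuity on edges and semicontinuity of mobility integrals\<close>

text \<open>\<open>H\<close> is the first marginal of h times the edge measure, as a density with
  respect to \<open>\<pi>\<close>. Weights that depend on one endpoint are then integrated against
  \<open>\<pi>\<close> alone.\<close>

lemma edge_marginal:
  fixes h :: "'a \<times> 'a \<Rightarrow> real"
  assumes [measurable]: "h \<in> borel_measurable borel" and nn: "\<And>z. 0 \<le> h z" and int: "integrable edges h"
  obtains H where "integrable \<pi> H" "\<And>w. w \<in> borel_measurable borel \<Longrightarrow> (\<And>x. 0 \<le> w x) \<Longrightarrow>
    (LINT z|edges. h z * w (fst z)) = (LINT x|\<pi>. H x * w x)"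
proof -
  define N where "N x = (\<integral>\<^sup>+y. ennreal (h (x, y)) \<partial>\<kappa> x)" for x
  have [measurable]: "N \<in> borel_measurable borel"
    unfolding N_def[abs_def] using borel_measurable_nn_integral_kernel[of "\<lambda>z. ennreal (h z)"] by simp
  have fin: "(\<integral>\<^sup>+x. N x \<partial>\<pi>) < \<infinity>"
    using int nn unfolding N_def
    by (subst nn_integral_edges[symmetric]) (auto simp: integrable_iff_bounded)
  then have "AE x in \<pi>. N x \<noteq> \<infinity>" by (intro nn_integral_PInf_AE) auto
  then have N: "AE x in \<pi>. N x = ennreal (enn2real (N x))" by eventually_elim (simp add: less_top)
  show ?thesis
  proof (rule that[of "\<lambda>x. enn2real (N x)"])
    have "(\<integral>\<^sup>+x. ennreal (enn2real (N x)) \<partial>\<pi>) = (\<integral>\<^sup>+x. N x \<partial>\<pi>)"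
    proof (rule nn_integral_cong_AE)
      show "AE x in \<pi>. ennreal (enn2real (N x)) = N x" using N by eventually_elim (rule sym)
    qed
    then show "integrable \<pi> (\<lambda>x. enn2real (N x))"
      using fin by (intro integrableI_nonneg) auto
    fix w :: "'a \<Rightarrow> real" assume [measurable]: "w \<in> borel_measurable borel" and w: "\<And>x. 0 \<le> w x"
    have "(\<integral>\<^sup>+z. ennreal (h z * w (fst z)) \<partial>edges) = (\<integral>\<^sup>+x. (\<integral>\<^sup>+y. ennreal (h (x, y) * w x) \<partial>\<kappa> x) \<partial>\<pi>)"
      by (subst nn_integral_edges) auto
    also have "\<dots> = (\<integral>\<^sup>+x. ennreal (enn2real (N x) * w x) \<partial>\<pi>)"
    proof (rule nn_integral_cong_AE)
      show "AE x in \<pi>. (\<integral>\<^sup>+y. ennreal (h (x, y) * w x) \<partial>\<kappa> x) = ennreal (enn2real (N x) * w x)"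
        using N
      proof eventually_elim
        case (elim x)
        have [measurable]: "(\<lambda>y. h (x, y)) \<in> borel_measurable borel"
          using measurable_compose[OF measurable_Pair_borel, of h] by simp
        have "(\<integral>\<^sup>+y. ennreal (h (x, y) * w x) \<partial>\<kappa> x) = N x * ennreal (w x)"
          unfolding N_def using nn w by (subst nn_integral_multc[symmetric]) (auto simp: ennreal_mult)
        also have "\<dots> = ennreal (enn2real (N x)) * ennreal (w x)" using elim by simp
        also have "\<dots> = ennreal (enn2real (N x) * w x)" using w by (simp add: ennreal_mult)
        finally show ?case .
      qed
    qed
    finally show "(LINT z|edges. h z * w (fst z)) = (LINT x|\<pi>. enn2real (N x) * w x)"
      using nn w by (subst (1 2) integral_eq_nn_integral) auto
  qed
qed

text \<open>The marginal reduces the first endpoint to weak continuity against \<open>\<pi>\<close>,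
  and symmetry of the edge measure handles the second. Expressions affine in the two densities are
  thereby covered.\<close>

lemma edge_weak_continuity:
  fixes h :: "'a \<times> 'a \<Rightarrow> real"
  assumes h [measurable]: "h \<in> borel_measurable borel" and nn: "\<And>z. 0 \<le> h z" and int: "integrable edges h"
  shows "continuous_on {0..T} (\<lambda>t. LINT z|edges. h z * u t (fst z))"
    and "continuous_on {0..T} (\<lambda>t. LINT z|edges. h z * u t (snd z))"
proof -
  have fst: "continuous_on {0..T} (\<lambda>t. LINT z|edges. g z * u t (fst z))"
    if g: "g \<in> borel_measurable borel" "\<And>z. 0 \<le> g z" "integrable edges g" for g :: "'a \<times> 'a \<Rightarrow> real"
  proof -
    obtain H where H: "integrable \<pi> H" "\<And>w. w \<in> borel_measurable borel \<Longrightarrow> (\<And>x. 0 \<le> w x) \<Longrightarrow>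
      (LINT z|edges. g z * w (fst z)) = (LINT x|\<pi>. H x * w x)"
      using edge_marginal[OF g] by metis
    have "(LINT z|edges. g z * u t (fst z)) = (LINT x|\<pi>. H x * u t x)" for t
      by (intro H(2) u_measurable u_nonneg)
    then show ?thesis using weak_continuity[OF H(1)] by simp
  qed
  show "continuous_on {0..T} (\<lambda>t. LINT z|edges. h z * u t (fst z))" by (rule fst[OF h nn int])
  have swap_meas: "(\<lambda>z. h (snd z, fst z)) \<in> borel_measurable borel" by measurable
  have swap: "(LINT z|edges. f (snd z, fst z)) = (LINT z|edges. f z)"
    if [measurable]: "f \<in> borel_measurable borel" for f :: "'a \<times> 'a \<Rightarrow> real"
  proof -
    have "(LINT z|edges. f z) = (LINT z|distr edges borel (\<lambda>(x, y). (y, x)). f z)" by (simp add: distr_edges_swap)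
    also have "\<dots> = (LINT z|edges. f (snd z, fst z))"
      by (subst integral_distr) (auto simp: case_prod_beta)
    finally show ?thesis ..
  qed
  have "integrable edges (\<lambda>z. h (snd z, fst z))"
  proof (rule integrableI_nonneg)
    have "(\<integral>\<^sup>+z. ennreal (h (snd z, fst z)) \<partial>edges) = (\<integral>\<^sup>+z. ennreal (h z) \<partial>edges)"
      by (rule nn_integral_edges_swap) simp
    then show "(\<integral>\<^sup>+z. ennreal (h (snd z, fst z)) \<partial>edges) < \<infinity>"
      using int nn by (simp add: integrable_iff_bounded)
  qed (use swap_meas nn in auto)
  from fst[OF swap_meas nn this]
  have "continuous_on {0..T} (\<lambda>t. LINT z|edges. h (snd z, fst z) * u t (fst z))" .
  moreover have "(LINT z|edges. h (snd z, fst z) * u t (fst z)) = (LINT z|edges. h z * u t (snd z))" for t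
    using swap[of "\<lambda>z. h z * u t (snd z)"] by simp
  ultimately show "continuous_on {0..T} (\<lambda>t. LINT z|edges. h z * u t (snd z))" by simp
qed

lemma edge_integrable_mult_bounded:
  fixes h w :: "'a \<times> 'a \<Rightarrow> real"
  assumes "integrable edges h" and [measurable]: "w \<in> borel_measurable borel" and "\<And>z. \<bar>w z\<bar> \<le> B"
  shows "integrable edges (\<lambda>z. h z * w z)"
proof (rule Bochner_Integration.integrable_bound)
  show "integrable edges (\<lambda>z. h z * B)" using assms(1) by simp
  have [measurable]: "h \<in> borel_measurable borel" using assms(1) by (simp cong: measurable_cong_sets)
  show "(\<lambda>z. h z * w z) \<in> borel_measurable edges" by measurable
  show "AE z in edges. norm (h z * w z) \<le> norm (h z * B)"
  proof (rule AE_I2)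
    fix z
    have "\<bar>w z\<bar> \<le> \<bar>B\<bar>" using assms(3)[of z] by linarith
    then show "norm (h z * w z) \<le> norm (h z * B)" by (simp add: abs_mult mult_left_mono)
  qed
qed

context
  fixes \<delta> :: real
  assumes \<delta>: "0 < \<delta>" "\<delta> < 1"
begin

private lemma \<delta>': "0 \<le> \<delta>" "\<delta> \<le> 1" using \<delta> by auto

lemma edge_mobility_bounded: obtains A where "0 < A" "\<And>t z. edge_mobility \<delta> t z \<le> A"
proof -
  obtain A where "0 < A" "\<And>u v. 0 \<le> u \<Longrightarrow> u \<le> C + 1 \<Longrightarrow> 0 \<le> v \<Longrightarrow> v \<le> C + 1 \<Longrightarrow> \<alpha> u v \<le> A"
    using mobility_bounded[OF \<alpha>] by metis
  then show ?thesis
    using v_nonneg[OF \<delta>'] v_le[OF \<delta>'] by (intro that[of A]) (auto simp: edge_mobility_def)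
qed

lemma edge_mobility_lower: "\<delta> * \<alpha> 1 1 \<le> edge_mobility \<delta> t z"
proof -
  have "0 \<le> (1 - \<delta>) * \<alpha> (u t (fst z)) (u t (snd z))"
    using \<delta> by (intro mult_nonneg_nonneg mobility_nonneg[OF \<alpha>] u_nonneg) auto
  with edge_mobility_mix[OF \<delta>', of t z] show ?thesis by linarith
qed

text \<open>The density converges only weakly in time; concavity of the mobility gives this one-sided bound.\<close>

lemma edge_mobility_integral_usc:
  assumes g [measurable]: "g \<in> borel_measurable borel" and nn: "\<And>z. 0 \<le> g z" and int: "integrable edges g"
    and s: "s \<in> {0..T}" and e: "0 < e"
  shows "\<forall>\<^sub>F r in at s within {0..T}. (LINT z|edges. g z * edge_mobility \<delta> r z) \<le>
    (LINT z|edges. g z * edge_mobility \<delta> s z) + e"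
proof -
  obtain A where A: "0 < A" "\<And>t z. edge_mobility \<delta> t z \<le> A" using edge_mobility_bounded by blast
  have [measurable]: "edge_mobility \<delta> t \<in> borel_measurable borel" for t by (rule edge_mobility_measurable[OF \<delta>'])
  define G where "G = (LINT z|edges. g z)"
  have G: "0 \<le> G" unfolding G_def using nn by simp
  \<comment> \<open>Keeps the total error e' * G below e / 2; G + 1 avoids division by 0.\<close>
  define e' where "e' = e / (2 * (G + 1))"
  have e': "0 < e'" using e G by (simp add: e'_def)
  obtain N :: nat and B a b c where B: "\<And>i. i < N \<Longrightarrow> B i \<in> sets borel" "disjoint_family_on B {..<N}"
    and cover: "{0..C + 1} \<times> {0..C + 1} \<subseteq> (\<Union>i<N. B i)"
    and maj: "\<And>i u v. i < N \<Longrightarrow> 0 \<le> u \<Longrightarrow> 0 \<le> v \<Longrightarrow> \<alpha> u v \<le> c i + a i * u + b i * v"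
    and near: "\<And>i u v. i < N \<Longrightarrow> (u, v) \<in> B i \<Longrightarrow> 0 \<le> u \<Longrightarrow> 0 \<le> v \<Longrightarrow> c i + a i * u + b i * v \<le> \<alpha> u v + e'"
  proof (rule mobility_piecewise_affine_majorant[OF \<alpha> e', of "C + 1"])
    fix N :: nat and B :: "nat \<Rightarrow> (real \<times> real) set" and a b c :: "nat \<Rightarrow> real"
    assume "\<And>i. i < N \<Longrightarrow> B i \<in> sets borel" "disjoint_family_on B {..<N}"
      "{0..C + 1} \<times> {0..C + 1} \<subseteq> (\<Union>i<N. B i)"
      "\<And>i u v. i < N \<Longrightarrow> 0 \<le> u \<Longrightarrow> 0 \<le> v \<Longrightarrow> \<alpha> u v \<le> c i + a i * u + b i * v"
      "\<And>i u v. i < N \<Longrightarrow> (u, v) \<in> B i \<Longrightarrow> 0 \<le> u \<Longrightarrow> 0 \<le> v \<Longrightarrow> c i + a i * u + b i * v \<le> \<alpha> u v + e'"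
    then show thesis by (rule that)
  qed
  define p where "p z = (v \<delta> s (fst z), v \<delta> s (snd z))" for z
  have [measurable]: "p \<in> borel_measurable borel" unfolding p_def[abs_def] by measurable
  \<comment> \<open>The weight g is split by the cell containing the density pair at the fixed time
    s. Each affine majorant then carries a weight independent of r, so F below is continuous in r,
    lies above the mobility integral for all r, and is close to it at r = s.\<close>
  define h where "h i z = indicator (B i) (p z) * g z" for i z
  have h_meas [measurable]: "h i \<in> borel_measurable borel" if "i < N" for i
  proof -
    have [measurable]: "B i \<in> sets borel" by (rule B(1)[OF that])
    show ?thesis unfolding h_def[abs_def] by measurable
  qed
  have h_nn: "0 \<le> h i z" for i z using nn by (simp add: h_def)
  have h_int: "integrable edges (h i)" if "i < N" for i
  proof (rule Bochner_Integration.integrable_bound[OF int])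
    show "h i \<in> borel_measurable edges" using h_meas[OF that] by (simp cong: measurable_cong_sets)
    show "AE z in edges. norm (h i z) \<le> norm (g z)" by (auto simp: h_def split: split_indicator)
  qed
  have sum_h: "(\<Sum>i<N. h i z) = g z" for z
  proof -
    have "p z \<in> (\<Union>i<N. B i)"
      using v_nonneg[OF \<delta>', of s] v_le[OF \<delta>', of s] by (intro subsetD[OF cover]) (auto simp: p_def)
    moreover have "(indicator (\<Union>i<N. B i) (p z) :: real) = (\<Sum>i<N. indicator (B i) (p z))"
      by (rule indicator_UN_disjoint) (use B(2) in auto)
    ultimately have "(\<Sum>i<N. indicator (B i) (p z)) = (1 :: real)" by simp
    then show ?thesis by (simp add: h_def sum_distrib_right[symmetric])
  qed
  define F where "F r = (\<Sum>i<N. LINT z|edges. h i z * (c i + a i * v \<delta> r (fst z) + b i * v \<delta> r (snd z)))" for r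
  have affine_int: "integrable edges (\<lambda>z. h i z * (c i + a i * v \<delta> r (fst z) + b i * v \<delta> r (snd z)))" if "i < N" for i r
  proof (rule edge_integrable_mult_bounded[OF h_int[OF that]])
    fix z
    have "\<bar>a i * v \<delta> r (fst z)\<bar> \<le> \<bar>a i\<bar> * (C + 1)" "\<bar>b i * v \<delta> r (snd z)\<bar> \<le> \<bar>b i\<bar> * (C + 1)"
      using v_nonneg[OF \<delta>'] v_le[OF \<delta>'] by (auto simp: abs_mult intro!: mult_left_mono)
    then show "\<bar>c i + a i * v \<delta> r (fst z) + b i * v \<delta> r (snd z)\<bar> \<le> \<bar>c i\<bar> + \<bar>a i\<bar> * (C + 1) + \<bar>b i\<bar> * (C + 1)"
      by linarith
  qed measurable
  have mob_int: "integrable edges (\<lambda>z. k z * edge_mobility \<delta> r z)" if "integrable edges k" for k r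
  proof (rule edge_integrable_mult_bounded[OF that])
    show "\<bar>edge_mobility \<delta> r z\<bar> \<le> A" for z using A(2) edge_mobility_nonneg[OF \<delta>'] by simp
  qed measurable
  have upper: "(LINT z|edges. g z * edge_mobility \<delta> r z) \<le> F r" for r
  proof -
    have "(LINT z|edges. g z * edge_mobility \<delta> r z) = (LINT z|edges. (\<Sum>i<N. h i z * edge_mobility \<delta> r z))"
      by (simp add: sum_h sum_distrib_right[symmetric])
    also have "\<dots> = (\<Sum>i<N. LINT z|edges. h i z * edge_mobility \<delta> r z)"
      using mob_int h_int by (intro Bochner_Integration.integral_sum) auto
    also have "\<dots> \<le> F r"
      unfolding F_def
    proof (intro sum_mono integral_mono)
      fix i z assume i: "i \<in> {..<N}"
      show "h i z * edge_mobility \<delta> r z \<le> h i z * (c i + a i * v \<delta> r (fst z) + b i * v \<delta> r (snd z))"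
        unfolding edge_mobility_def using i h_nn v_nonneg[OF \<delta>'] by (intro mult_left_mono maj) auto
    qed (use mob_int h_int affine_int in auto)
    finally show ?thesis .
  qed
  have lower: "F s \<le> (LINT z|edges. g z * edge_mobility \<delta> s z) + e' * G"
  proof -
    have "F s \<le> (\<Sum>i<N. LINT z|edges. h i z * edge_mobility \<delta> s z + e' * h i z)"
      unfolding F_def
    proof (intro sum_mono integral_mono)
      fix i z assume i: "i \<in> {..<N}"
      show "h i z * (c i + a i * v \<delta> s (fst z) + b i * v \<delta> s (snd z)) \<le> h i z * edge_mobility \<delta> s z + e' * h i z"
      proof (cases "p z \<in> B i")
        case True
        then have "c i + a i * v \<delta> s (fst z) + b i * v \<delta> s (snd z) \<le> edge_mobility \<delta> s z + e'"
          unfolding edge_mobility_def using i v_nonneg[OF \<delta>'] by (intro near) (auto simp: p_def)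
        from mult_left_mono[OF this h_nn[of i z]] show ?thesis by (simp add: algebra_simps)
      qed (simp add: h_def)
    qed (use mob_int h_int affine_int in auto)
    also have "\<dots> = (\<Sum>i<N. (LINT z|edges. h i z * edge_mobility \<delta> s z) + e' * (LINT z|edges. h i z))"
      using mob_int h_int by (intro sum.cong) auto
    also have "\<dots> = (LINT z|edges. (\<Sum>i<N. h i z * edge_mobility \<delta> s z)) + e' * (LINT z|edges. (\<Sum>i<N. h i z))"
      using mob_int h_int
      by (subst (1 2) Bochner_Integration.integral_sum) (auto simp: sum.distrib sum_distrib_left)
    also have "\<dots> = (LINT z|edges. g z * edge_mobility \<delta> s z) + e' * G"
      by (simp add: sum_h sum_distrib_right[symmetric] G_def)
    finally show ?thesis .
  qed
  have "continuous_on {0..T} F"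
  proof -
    have eq: "(LINT z|edges. h i z * (c i + a i * v \<delta> r (fst z) + b i * v \<delta> r (snd z))) =
      (c i + a i * \<delta> + b i * \<delta>) * (LINT z|edges. h i z) + (a i * (1 - \<delta>)) * (LINT z|edges. h i z * u r (fst z))
       + (b i * (1 - \<delta>)) * (LINT z|edges. h i z * u r (snd z))" if "i < N" for i r
    proof -
      have "integrable edges (\<lambda>z. h i z * u r (fst z))" "integrable edges (\<lambda>z. h i z * u r (snd z))"
        using u_nonneg u_le by (auto intro!: edge_integrable_mult_bounded[OF h_int[OF that], of _ C])
      then have "(c i + a i * \<delta> + b i * \<delta>) * (LINT z|edges. h i z) + (a i * (1 - \<delta>)) * (LINT z|edges. h i z * u r (fst z))
       + (b i * (1 - \<delta>)) * (LINT z|edges. h i z * u r (snd z)) =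
        (LINT z|edges. (c i + a i * \<delta> + b i * \<delta>) * h i z + (a i * (1 - \<delta>)) * (h i z * u r (fst z))
       + (b i * (1 - \<delta>)) * (h i z * u r (snd z)))"
        using h_int[OF that] by simp
      also have "\<dots> = (LINT z|edges. h i z * (c i + a i * v \<delta> r (fst z) + b i * v \<delta> r (snd z)))"
        by (intro Bochner_Integration.integral_cong) (auto simp: v_def algebra_simps)
      finally show ?thesis ..
    qed
    have "continuous_on {0..T} (\<lambda>r. \<Sum>i<N. (c i + a i * \<delta> + b i * \<delta>) * (LINT z|edges. h i z) + (a i * (1 - \<delta>)) * (LINT z|edges. h i z * u r (fst z))
       + (b i * (1 - \<delta>)) * (LINT z|edges. h i z * u r (snd z)))"
      using h_meas h_nn h_int by (intro continuous_intros edge_weak_continuity) auto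
    then show ?thesis unfolding F_def[abs_def] by (simp add: eq)
  qed
  then have "(F \<longlongrightarrow> F s) (at s within {0..T})" using s by (simp add: continuous_on_def)
  then have "\<forall>\<^sub>F r in at s within {0..T}. F r < F s + e / 2" using e by (intro order_tendstoD) auto
  then show ?thesis
  proof eventually_elim
    case (elim r)
    have "e' * G \<le> e / 2"
    proof -
      have "e' * G = (e / 2) * (G / (G + 1))" by (simp add: e'_def)
      also have "\<dots> \<le> (e / 2) * 1" using e G by (intro mult_left_mono) auto
      finally show ?thesis by simp
    qed
    with upper[of r] lower elim show ?case by linarith
  qed
qed

section \<open>The test functions and the mixed entropy\<close>

lemma test_measurable [measurable]: "test \<delta> s \<in> borel_measurable borel"
  unfolding test_def[abs_def]
  using borel_measurable_deriv_entropy_density[OF \<phi> v_measurable \<delta>(1)] v_ge[OF \<delta>'] by simp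

lemma test_bounded: obtains K where "0 < K" "\<And>s x. \<bar>test \<delta> s x\<bar> \<le> K"
proof -
  obtain K where "0 < K" "\<And>r. \<delta> \<le> r \<Longrightarrow> r \<le> C + 1 \<Longrightarrow> \<bar>deriv \<phi> r\<bar> \<le> K"
    using deriv_entropy_density_bounded[OF \<phi> \<delta>(1)] by metis
  then show ?thesis
    using v_ge[OF \<delta>'] v_le[OF \<delta>'] by (intro that[of K]) (auto simp: test_def)
qed

lemma test_integrable: "integrable \<pi> (test \<delta> s)"
proof -
  obtain K where "0 < K" "\<And>s x. \<bar>test \<delta> s x\<bar> \<le> K" using test_bounded by blast
  then show ?thesis by (intro pi.integrable_const_bound[of _ K]) auto
qed

text \<open>The tangent inequality of \<phi> at the mixed density, integrated. Mixing shrinks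
  differences of densities by the factor 1 - \<delta>.\<close>

lemma ent_tangent:
  "(1 - \<delta>) * ((LINT x|\<pi>. test \<delta> s x * u r x) - (LINT x|\<pi>. test \<delta> s x * u s x)) \<le> ent \<delta> r - ent \<delta> s"
proof -
  have int: "integrable \<pi> (\<lambda>x. test \<delta> s x * u t x)" for t by (rule integrable_mult_u[OF test_integrable])
  have "(1 - \<delta>) * ((LINT x|\<pi>. test \<delta> s x * u r x) - (LINT x|\<pi>. test \<delta> s x * u s x)) =
      (LINT x|\<pi>. (1 - \<delta>) * (test \<delta> s x * u r x - test \<delta> s x * u s x))"
    using int by simp
  also have "\<dots> \<le> (LINT x|\<pi>. \<phi> (v \<delta> r x) - \<phi> (v \<delta> s x))"
  proof (rule integral_mono)
    fix x
    have "0 < v \<delta> s x" using v_ge[OF \<delta>', of s x] \<delta> by linarith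
    from entropy_density_tangent[OF \<phi> this v_nonneg[OF \<delta>', of r x]]
    have "deriv \<phi> (v \<delta> s x) * (v \<delta> r x - v \<delta> s x) \<le> \<phi> (v \<delta> r x) - \<phi> (v \<delta> s x)" by simp
    moreover have "v \<delta> r x - v \<delta> s x = (1 - \<delta>) * (u r x - u s x)" by (simp add: v_def algebra_simps)
    ultimately show "(1 - \<delta>) * (test \<delta> s x * u r x - test \<delta> s x * u s x) \<le> \<phi> (v \<delta> r x) - \<phi> (v \<delta> s x)"
      by (simp add: test_def algebra_simps)
  qed (use int phi_v_integrable[OF \<delta>'] in auto)
  also have "\<dots> = ent \<delta> r - ent \<delta> s"
    unfolding ent_def using phi_v_integrable[OF \<delta>'] by simp
  finally show ?thesis .
qed

text \<open>The integrated tangent lies below the entropy, touches it at s, and is continuous in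
  time because it is affine in the density.\<close>

lemma ent_lsc_at:
  assumes s: "s \<in> {0..T}"
  obtains \<eta> where "(\<eta> \<longlongrightarrow> 0) (at s within {0..T})" "\<And>r. ent \<delta> s + \<eta> r \<le> ent \<delta> r"
    "continuous_on {0..T} \<eta>" "\<eta> s = 0"
proof -
  define \<eta> where "\<eta> r = (1 - \<delta>) * ((LINT x|\<pi>. test \<delta> s x * u r x) - (LINT x|\<pi>. test \<delta> s x * u s x))" for r
  have cont: "continuous_on {0..T} \<eta>"
    unfolding \<eta>_def[abs_def] by (intro continuous_intros weak_continuity test_integrable)
  have "\<eta> s = 0" by (simp add: \<eta>_def)
  moreover have "(\<eta> \<longlongrightarrow> \<eta> s) (at s within {0..T})" using cont s by (simp add: continuous_on_def)
  moreover have "ent \<delta> s + \<eta> r \<le> ent \<delta> r" for r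
    using ent_tangent[of s r] by (simp add: \<eta>_def)
  ultimately show ?thesis using cont by (intro that[of \<eta>]) auto
qed

lemma ent_measurable: "ent \<delta> \<in> borel_measurable (restrict_space borel {0..T})"
proof -
  have "(\<lambda>t. ennreal (ent \<delta> t)) \<in> borel_measurable (restrict_space borel {0..T})"
  proof (rule seq_lsc_imp_borel_measurable)
    fix t s assume t: "t \<in> {0..T}" and s: "\<And>n. s n \<in> {0..T}" and lim: "s \<longlonglongrightarrow> t"
    obtain \<eta> where \<eta>: "\<And>r. ent \<delta> t + \<eta> r \<le> ent \<delta> r" "continuous_on {0..T} \<eta>" "\<eta> t = 0"
      using ent_lsc_at[OF t] by metis
    have "(\<lambda>n. \<eta> (s n)) \<longlonglongrightarrow> \<eta> t"
      by (rule continuous_on_tendsto_compose[OF \<eta>(2) lim t]) (rule always_eventually, use s in blast)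
    then have "(\<lambda>n. ent \<delta> t + \<eta> (s n)) \<longlonglongrightarrow> ent \<delta> t + 0" using \<eta>(3) by (intro tendsto_intros) simp
    then have "(\<lambda>n. ennreal (ent \<delta> t + \<eta> (s n))) \<longlonglongrightarrow> ennreal (ent \<delta> t)" using tendsto_ennrealI by fastforce
    then have "ennreal (ent \<delta> t) = liminf (\<lambda>n. ennreal (ent \<delta> t + \<eta> (s n)))"
      by (intro lim_imp_Liminf[symmetric]) auto
    also have "\<dots> \<le> liminf (\<lambda>n. ennreal (ent \<delta> (s n)))"
      by (intro Liminf_mono always_eventually allI ennreal_leI \<eta>(1))
    finally show "ennreal (ent \<delta> t) \<le> liminf (\<lambda>n. ennreal (ent \<delta> (s n)))" .
  qed simp
  then have "(\<lambda>t. enn2real (ennreal (ent \<delta> t))) \<in> borel_measurable (restrict_space borel {0..T})"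
    by measurable
  then show ?thesis using ent_nonneg[OF \<delta>'] by simp
qed

section \<open>Fisher information of the mixture\<close>

lemma density_mixture:
  assumes t: "t \<in> {0..T}"
  defines "m \<equiv> measure_add (scale_measure (ennreal (1 - \<delta>)) (\<rho> t)) (scale_measure (ennreal \<delta>) \<pi>)"
  shows "AE x in \<pi>. density_wrt \<pi> m x = v \<delta> t x"
proof -
  have "density \<pi> (\<lambda>x. ennreal (v \<delta> t x)) = m"
  proof (rule measure_eqI)
    show "sets (density \<pi> (\<lambda>x. ennreal (v \<delta> t x))) = sets m"
      using sets_rho[OF t] by (simp add: m_def)
    fix B assume "B \<in> sets (density \<pi> (\<lambda>x. ennreal (v \<delta> t x)))"
    then have B [measurable]: "B \<in> sets borel" by simp
    have "emeasure (density \<pi> (\<lambda>x. ennreal (v \<delta> t x))) B = (\<integral>\<^sup>+x. ennreal (v \<delta> t x) * indicator B x \<partial>\<pi>)"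
      by (rule emeasure_density) auto
    also have "\<dots> = (\<integral>\<^sup>+x. ennreal (1 - \<delta>) * (ennreal (u t x) * indicator B x) + ennreal \<delta> * indicator B x \<partial>\<pi>)"
      using \<delta> u_nonneg by (intro nn_integral_cong) (auto simp: v_def ennreal_mult ennreal_plus split: split_indicator)
    also have "\<dots> = ennreal (1 - \<delta>) * emeasure (\<rho> t) B + ennreal \<delta> * emeasure \<pi> B"
      by (subst nn_integral_add) (auto simp: nn_integral_cmult rho_eq_density[OF t] emeasure_density)
    also have "\<dots> = emeasure m B"
      unfolding m_def using sets_rho[OF t] B by (subst emeasure_measure_add) auto
    finally show "emeasure (density \<pi> (\<lambda>x. ennreal (v \<delta> t x))) B = emeasure m B" .
  qed
  then have "AE x in \<pi>. ennreal (v \<delta> t x) = RN_deriv \<pi> m x"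
    by (intro pi.RN_deriv_unique) auto
  then show ?thesis
    by eventually_elim (metis density_wrt_def enn2real_ennreal v_nonneg[OF \<delta>'])
qed

lemma density_pi: "AE x in \<pi>. density_wrt \<pi> \<pi> x = 1"
proof -
  have "density \<pi> (\<lambda>_. 1) = \<pi>" by (rule density_1)
  then have "AE x in \<pi>. 1 = RN_deriv \<pi> \<pi> x" by (intro pi.RN_deriv_unique) auto
  then show ?thesis by eventually_elim (metis density_wrt_def enn2real_1)
qed

lemma pi_finite_entropy: "\<pi> \<in> finite_entropy_measures \<pi> \<phi>"
proof -
  have "(\<integral>\<^sup>+x. ennreal (\<phi> (density_wrt \<pi> \<pi> x)) \<partial>\<pi>) = (\<integral>\<^sup>+x. ennreal (\<phi> 1) \<partial>\<pi>)"
  proof (rule nn_integral_cong_AE)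
    show "AE x in \<pi>. ennreal (\<phi> (density_wrt \<pi> \<pi> x)) = ennreal (\<phi> 1)"
      using density_pi by eventually_elim simp
  qed
  also have "\<dots> < \<infinity>" using pi.emeasure_finite[of UNIV] by (auto simp: ennreal_mult_eq_top_iff less_top[symmetric])
  finally show ?thesis
    using pi_borel by (simp add: finite_entropy_measures_def entropy_def absolutely_continuous_def)
qed

lemma fisher_pi: "fisher \<pi> \<kappa> \<phi> \<psi>s \<alpha> \<pi> = 0"
proof -
  have "(\<integral>\<^sup>+ (x, y). lsc_envelope_on ({0..} \<times> {0..}) (D_plus \<phi> \<psi>s \<alpha>)
      (density_wrt \<pi> \<pi> x, density_wrt \<pi> \<pi> y) \<partial>edges) = (\<integral>\<^sup>+z. 0 \<partial>edges)"
  proof (rule nn_integral_cong_AE)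
    show "AE z in edges. (case z of (x, y) \<Rightarrow> lsc_envelope_on ({0..} \<times> {0..}) (D_plus \<phi> \<psi>s \<alpha>)
      (density_wrt \<pi> \<pi> x, density_wrt \<pi> \<pi> y)) = 0"
      using AE_edges_both[OF density_pi]
      by eventually_elim (simp add: case_prod_beta lsc_envelope_D_plus_one[OF \<psi> \<alpha>])
  qed
  then show ?thesis by (simp add: fisher_def)
qed

text \<open>The mixture is a convex combination with \<pi>, whose Fisher information is 0, so
  convexity bounds its Fisher information by (1 - \<delta>) * \<open>D t\<close>. As the mixed
  densities are positive, the envelope lies above the explicit formula.\<close>

lemma fisher_test_bound:
  assumes t: "t \<in> {0..T}"
  shows "(1/2) * (\<integral>\<^sup>+z. ennreal (\<psi>s (grad (test \<delta> t) z) * edge_mobility \<delta> t z) \<partial>edges) \<le> D t"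
proof -
  define m where "m = measure_add (scale_measure (ennreal (1 - \<delta>)) (\<rho> t)) (scale_measure (ennreal \<delta>) \<pi>)"
  have "(1/2) * (\<integral>\<^sup>+z. ennreal (\<psi>s (grad (test \<delta> t) z) * edge_mobility \<delta> t z) \<partial>edges) \<le> fisher \<pi> \<kappa> \<phi> \<psi>s \<alpha> m"
    unfolding fisher_def
  proof (intro mult_left_mono nn_integral_mono_AE)
    show "AE z in edges. ennreal (\<psi>s (grad (test \<delta> t) z) * edge_mobility \<delta> t z) \<le>
       (case z of (x, y) \<Rightarrow> lsc_envelope_on ({0..} \<times> {0..}) (D_plus \<phi> \<psi>s \<alpha>) (density_wrt \<pi> m x, density_wrt \<pi> m y))"
      using AE_edges_both[OF density_mixture[OF t]]
    proof eventually_elim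
      case (elim z)
      have "0 < v \<delta> t (fst z)" "0 < v \<delta> t (snd z)"
        using v_ge[OF \<delta>', of t "fst z"] v_ge[OF \<delta>', of t "snd z"] \<delta> by linarith+
      from lsc_envelope_D_plus_ge[OF \<phi> \<psi> \<alpha> this] elim show ?case
        by (simp add: m_def case_prod_beta grad_def test_def edge_mobility_def)
    qed
  qed simp
  also have "\<dots> \<le> ennreal (1 - \<delta>) * D t + ennreal \<delta> * fisher \<pi> \<kappa> \<phi> \<psi>s \<alpha> \<pi>"
    unfolding m_def using fisher_conv rho_finite_entropy[OF t] pi_finite_entropy \<delta>
    unfolding fisher_convex_def by auto
  also have "\<dots> = ennreal (1 - \<delta>) * D t" by (simp add: fisher_pi)
  also have "\<dots> \<le> 1 * D t"
  proof (rule mult_right_mono)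
    show "ennreal (1 - \<delta>) \<le> 1" using \<delta> by simp
  qed simp
  finally show ?thesis by simp
qed

lemma grad_test_bounded: obtains K where "0 < K" "\<And>s z. \<bar>grad (test \<delta> s) z\<bar> \<le> K"
proof -
  obtain K where K: "0 < K" "\<And>s x. \<bar>test \<delta> s x\<bar> \<le> K" using test_bounded by blast
  have "\<bar>grad (test \<delta> s) z\<bar> \<le> 2 * K" for s z
    using K(2)[of s "fst z"] K(2)[of s "snd z"] by (simp add: grad_def case_prod_beta)
  with K(1) show ?thesis by (intro that[of "2 * K"]) auto
qed

lemma psi_grad_test_measurable [measurable]: "(\<lambda>z. \<psi>s (grad (test \<delta> s) z)) \<in> borel_measurable borel"
  using borel_measurable_dual_dissipation[OF \<psi>] by measurable

text \<open>The mobility is at least \<delta> * \<alpha> 1 1, so the weight can be divided out of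
  the finite Fisher integral. The gradient has bounded range, so the quadratic lower bound for
  \<open>\<psi>s\<close> then gives square integrability.\<close>

lemma psi_grad_test_integrable:
  assumes s: "s \<in> {0..T}" and fin: "D s < \<infinity>"
  shows "integrable edges (\<lambda>z. \<psi>s (grad (test \<delta> s) z))"
    and "(LINT z|edges. \<psi>s (grad (test \<delta> s) z) * edge_mobility \<delta> s z) / 2 \<le> enn2real (D s)"
    and "test \<delta> s \<in> X2 \<pi> \<kappa>"
proof -
  have [measurable]: "edge_mobility \<delta> t \<in> borel_measurable borel" for t by (rule edge_mobility_measurable[OF \<delta>'])
  define l where "l = \<delta> * \<alpha> 1 1"
  have l: "0 < l" using \<delta> mobility_one_pos[OF \<alpha>] by (simp add: l_def)
  let ?I = "\<integral>\<^sup>+z. ennreal (\<psi>s (grad (test \<delta> s) z) * edge_mobility \<delta> s z) \<partial>edges"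
  have "?I = 2 * ((1/2) * ?I)" using ennreal_half_mult_2[of ?I] by (simp add: mult.left_commute)
  also have "\<dots> \<le> 2 * D s" by (intro mult_left_mono fisher_test_bound[OF s]) simp
  also have "\<dots> < \<infinity>" using fin by (simp add: ennreal_mult_less_top)
  finally have I: "?I < \<infinity>" .
  have nn: "0 \<le> \<psi>s (grad (test \<delta> s) z) * edge_mobility \<delta> s z" for z
    using dual_dissipation_nonneg[OF \<psi>] edge_mobility_nonneg[OF \<delta>'] by simp
  have intm: "integrable edges (\<lambda>z. \<psi>s (grad (test \<delta> s) z) * edge_mobility \<delta> s z)"
    using I nn by (intro integrableI_nonneg) auto
  show int: "integrable edges (\<lambda>z. \<psi>s (grad (test \<delta> s) z))"
  proof (rule Bochner_Integration.integrable_bound)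
    show "integrable edges (\<lambda>z. (1 / l) * (\<psi>s (grad (test \<delta> s) z) * edge_mobility \<delta> s z))" using intm by simp
    show "AE z in edges. norm (\<psi>s (grad (test \<delta> s) z)) \<le> norm ((1 / l) * (\<psi>s (grad (test \<delta> s) z) * edge_mobility \<delta> s z))"
    proof (rule AE_I2)
      fix z
      have "l * \<psi>s (grad (test \<delta> s) z) \<le> \<psi>s (grad (test \<delta> s) z) * edge_mobility \<delta> s z"
        using mult_left_mono[OF edge_mobility_lower[of s z] dual_dissipation_nonneg[OF \<psi>, of "grad (test \<delta> s) z"]]
        by (simp add: l_def mult.commute)
      then have "\<psi>s (grad (test \<delta> s) z) \<le> (1 / l) * (\<psi>s (grad (test \<delta> s) z) * edge_mobility \<delta> s z)"
        using l by (simp add: field_simps)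
      moreover have "0 \<le> (1 / l) * (\<psi>s (grad (test \<delta> s) z) * edge_mobility \<delta> s z)" using l nn[of z] by simp
      ultimately show "norm (\<psi>s (grad (test \<delta> s) z)) \<le> norm ((1 / l) * (\<psi>s (grad (test \<delta> s) z) * edge_mobility \<delta> s z))"
        using dual_dissipation_nonneg[OF \<psi>] by (simp only: real_norm_def abs_of_nonneg)
    qed
  qed measurable
  have "ennreal ((LINT z|edges. \<psi>s (grad (test \<delta> s) z) * edge_mobility \<delta> s z) / 2) = (1/2) * ?I"
    using nn_integral_eq_integral[OF intm] nn by (simp add: ennreal_half integral_nonneg_AE)
  also have "\<dots> \<le> D s" by (rule fisher_test_bound[OF s])
  finally have "ennreal ((LINT z|edges. \<psi>s (grad (test \<delta> s) z) * edge_mobility \<delta> s z) / 2) \<le> D s" .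
  then show "(LINT z|edges. \<psi>s (grad (test \<delta> s) z) * edge_mobility \<delta> s z) / 2 \<le> enn2real (D s)"
    using fin nn by (cases "D s") (auto simp: ennreal_le_iff)
  obtain K where K: "0 < K" "\<And>s z. \<bar>grad (test \<delta> s) z\<bar> \<le> K" using grad_test_bounded by blast
  obtain c where c: "0 < c" "\<And>\<xi>. \<bar>\<xi>\<bar> \<le> K \<Longrightarrow> c * \<xi>\<^sup>2 \<le> \<psi>s \<xi>"
    using dual_dissipation_quadratic_lower[OF \<psi>] by metis
  have "integrable edges (\<lambda>z. (grad (test \<delta> s) z)\<^sup>2)"
  proof (rule Bochner_Integration.integrable_bound)
    show "integrable edges (\<lambda>z. (1 / c) * \<psi>s (grad (test \<delta> s) z))" using int by simp
    show "AE z in edges. norm ((grad (test \<delta> s) z)\<^sup>2) \<le> norm ((1 / c) * \<psi>s (grad (test \<delta> s) z))"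
    proof (rule AE_I2)
      fix z
      have "(grad (test \<delta> s) z)\<^sup>2 \<le> (1 / c) * \<psi>s (grad (test \<delta> s) z)"
        using c(2)[OF K(2)[of s z]] c(1) by (simp add: field_simps)
      then show "norm ((grad (test \<delta> s) z)\<^sup>2) \<le> norm ((1 / c) * \<psi>s (grad (test \<delta> s) z))"
        using c(1) dual_dissipation_nonneg[OF \<psi>] by simp
    qed
  qed measurable
  then have sq: "(\<integral>\<^sup>+z. ennreal ((grad (test \<delta> s) z)\<^sup>2) \<partial>edges) < \<infinity>"
    by (simp add: integrable_iff_bounded)
  obtain K' where "0 < K'" "\<And>s x. \<bar>test \<delta> s x\<bar> \<le> K'" using test_bounded by blast
  then have "\<exists>C. AE x in \<pi>. \<bar>test \<delta> s x\<bar> \<le> C" by (intro exI[of _ K']) simp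
  moreover have "ennreal ((grad (test \<delta> s) z)\<^sup>2) * indicator offdiag z = ennreal ((grad (test \<delta> s) z)\<^sup>2)" for z
    by (auto simp: grad_def offdiag_def split: split_indicator)
  ultimately show "test \<delta> s \<in> X2 \<pi> \<kappa>" using sq by (simp add: X2_def)
qed

end

section \<open>Real-valued representatives in time\<close>

definition Qr :: "real \<Rightarrow> real" where
  "Qr r = enn2real (Q r)"

text \<open>Cut off outside the time interval, where nothing is known about the curve.\<close>

definition Dr :: "real \<Rightarrow> real" where
  "Dr r = enn2real (D r * indicator {0..T} r)"

lemma AE_Q: "AE r in lborel. Q r = ennreal (Qr r)"
proof -
  have "AE r in lborel. Q r \<noteq> \<infinity>" using Q_finite by (intro nn_integral_PInf_AE) auto
  then show ?thesis by eventually_elim (simp add: Qr_def less_top)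
qed

lemma D_measurable: "(\<lambda>r. D r * indicator {0..T} r) \<in> borel_measurable lborel"
  using fisher_measurable by (subst (asm) borel_measurable_restrict_space_iff_ennreal) auto

lemma AE_D: "AE r in lborel. D r * indicator {0..T} r = ennreal (Dr r)"
proof -
  have "AE r in lborel. D r * indicator {0..T} r \<noteq> \<infinity>"
    using D_integral_finite D_measurable by (intro nn_integral_PInf_AE) auto
  then show ?thesis by eventually_elim (simp add: Dr_def less_top)
qed

lemma Qr_nonneg: "0 \<le> Qr r" and Dr_nonneg: "0 \<le> Dr r"
  by (simp_all add: Qr_def Dr_def)

lemma Qr_integrable: "integrable lborel Qr"
proof (rule integrableI_nonneg)
  have "(\<integral>\<^sup>+r. ennreal (Qr r) \<partial>lborel) = integral\<^sup>N lborel Q"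
  proof (rule nn_integral_cong_AE)
    show "AE r in lborel. ennreal (Qr r) = Q r" using AE_Q by eventually_elim simp
  qed
  with Q_finite show "(\<integral>\<^sup>+r. ennreal (Qr r) \<partial>lborel) < \<infinity>" by simp
  show "Qr \<in> borel_measurable lborel" unfolding Qr_def[abs_def] by measurable
qed (simp add: Qr_nonneg)

lemma Dr_integrable: "integrable lborel Dr"
proof (rule integrableI_nonneg)
  have "(\<integral>\<^sup>+r. ennreal (Dr r) \<partial>lborel) = (\<integral>\<^sup>+r\<in>{0..T}. D r \<partial>lborel)"
  proof (rule nn_integral_cong_AE)
    show "AE r in lborel. ennreal (Dr r) = D r * indicator {0..T} r" using AE_D by eventually_elim simp
  qed
  with D_integral_finite show "(\<integral>\<^sup>+r. ennreal (Dr r) \<partial>lborel) < \<infinity>" by simp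
  show "Dr \<in> borel_measurable lborel" unfolding Dr_def[abs_def] using D_measurable by measurable
qed (simp add: Dr_nonneg)

lemma Qr_set_integrable: "S \<in> sets borel \<Longrightarrow> set_integrable lborel S Qr"
  using Qr_integrable unfolding set_integrable_def by (intro integrable_mult_indicator) auto

lemma Dr_set_integrable: "S \<in> sets borel \<Longrightarrow> set_integrable lborel S Dr"
  using Dr_integrable unfolding set_integrable_def by (intro integrable_mult_indicator) auto

text \<open>Entropy decrease is bounded by an integral of \<open>Qr\<close> plus a mobility term.
  Adding this primitive to the entropy cancels the former in every increment.\<close>

definition \<Phi> :: "real \<Rightarrow> real" where
  "\<Phi> t = (LBINT r:{0..t}. Qr r)"

lemma \<Phi>_diff:
  assumes "0 \<le> s" "s \<le> t"
  shows "\<Phi> t - \<Phi> s = (LBINT r:{s..t}. Qr r)"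
proof -
  have "\<Phi> t = (LBINT r:{0..s} \<union> {s..t}. Qr r)"
    using assms by (simp add: \<Phi>_def ivl_disj_un_two_touch(4))
  also have "\<dots> = \<Phi> s + (LBINT r:{s..t}. Qr r)"
    unfolding \<Phi>_def
  proof (rule set_integral_Un_AE)
    show "AE r in lborel. \<not> (r \<in> {0..s} \<and> r \<in> {s..t})"
      using AE_lborel_singleton[of s] by eventually_elim auto
  qed (use Qr_set_integrable in auto)
  finally show ?thesis by simp
qed

lemma LBINT_Qr_nonneg: "0 \<le> (LBINT r:S. Qr r)"
  unfolding set_lebesgue_integral_def by (intro integral_nonneg_AE AE_I2) (simp add: Qr_nonneg)

lemma \<Phi>_mono: "0 \<le> s \<Longrightarrow> s \<le> t \<Longrightarrow> \<Phi> s \<le> \<Phi> t"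
  using \<Phi>_diff[of s t] LBINT_Qr_nonneg[of "{s..t}"] by simp

lemma \<Phi>_continuous: "continuous_on {0..T} \<Phi>"
  unfolding \<Phi>_def[abs_def] by (intro continuous_on_indefinite_LBINT Qr_set_integrable) simp

context
  fixes \<delta> :: real
  assumes \<delta>: "0 < \<delta>" "\<delta> < 1"
begin

private lemma \<delta>_bounds: "0 \<le> \<delta>" "\<delta> \<le> 1" using \<delta> by auto

section \<open>The chain rule inequality for the mixture\<close>

text \<open>The factor 1 - \<delta> comes from the entropy side. On the mobility of the curve it
  gives a bound by the mixed mobility; on \<open>R r\<close> it is estimated by 1.\<close>

lemma flow_test_bound:
  assumes s: "s \<in> {0..T}" and fin: "D s < \<infinity>" and r: "r \<in> {0..T}"
    and c: "(LINT z|edges. \<psi>s (grad (test \<delta> s) z) * edge_mobility \<delta> r z) / 2 \<le> c"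
  shows "ennreal ((1 - \<delta>) * \<bar>flow (test \<delta> s) r\<bar>) \<le> R r + ennreal c"
proof -
  have [measurable]: "test \<delta> s \<in> borel_measurable borel" "edge_mobility \<delta> r \<in> borel_measurable borel"
    "\<psi>s \<in> borel_measurable borel"
    using test_measurable[OF \<delta>] edge_mobility_measurable[OF \<delta>_bounds] borel_measurable_dual_dissipation[OF \<psi>] by auto
  have [measurable]: "(\<lambda>z. \<alpha> (u r (fst z)) (u r (snd z))) \<in> borel_measurable (borel :: ('a \<times> 'a) measure)"
    by (intro borel_measurable_edge_mobility[OF \<alpha>] u_measurable u_nonneg)
  let ?p = "\<lambda>z. \<psi>s (grad (test \<delta> s) z)"
  let ?I = "\<integral>\<^sup>+z. ennreal (?p z * \<alpha> (u r (fst z)) (u r (snd z))) \<partial>edges"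
  obtain A where A: "0 < A" "\<And>t z. edge_mobility \<delta> t z \<le> A" using edge_mobility_bounded[OF \<delta>] by blast
  have int: "integrable edges (\<lambda>z. ?p z * edge_mobility \<delta> r z)"
  proof (rule edge_integrable_mult_bounded[OF psi_grad_test_integrable(1)[OF \<delta> s fin]])
    show "\<bar>edge_mobility \<delta> r z\<bar> \<le> A" for z using A(2)[of r z] edge_mobility_nonneg[OF \<delta>_bounds, of r z] by simp
  qed measurable
  have nn: "0 \<le> ?p z" for z by (rule dual_dissipation_nonneg[OF \<psi>])
  have "ennreal (1 - \<delta>) * ?I = (\<integral>\<^sup>+z. ennreal (1 - \<delta>) * ennreal (?p z * \<alpha> (u r (fst z)) (u r (snd z))) \<partial>edges)"
    by (rule nn_integral_cmult[symmetric]) measurable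
  also have "\<dots> \<le> (\<integral>\<^sup>+z. ennreal (?p z * edge_mobility \<delta> r z) \<partial>edges)"
  proof (rule nn_integral_mono)
    fix z
    have "0 \<le> \<delta> * \<alpha> 1 1" using \<delta> mobility_one_pos[OF \<alpha>] by simp
    with edge_mobility_mix[OF \<delta>_bounds, of r z]
    have "(1 - \<delta>) * \<alpha> (u r (fst z)) (u r (snd z)) \<le> edge_mobility \<delta> r z" by linarith
    from mult_left_mono[OF this nn[of z]]
    have "(1 - \<delta>) * (?p z * \<alpha> (u r (fst z)) (u r (snd z))) \<le> ?p z * edge_mobility \<delta> r z"
      by (simp add: mult.left_commute)
    then show "ennreal (1 - \<delta>) * ennreal (?p z * \<alpha> (u r (fst z)) (u r (snd z))) \<le> ennreal (?p z * edge_mobility \<delta> r z)"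
      using \<delta> nn[of z] mobility_nonneg[OF \<alpha> u_nonneg u_nonneg]
      by (subst ennreal_mult[symmetric]) (auto intro: ennreal_leI)
  qed
  also have "\<dots> = ennreal (LINT z|edges. ?p z * edge_mobility \<delta> r z)"
    using int nn edge_mobility_nonneg[OF \<delta>_bounds] by (intro nn_integral_eq_integral) auto
  finally have I: "ennreal (1 - \<delta>) * ?I \<le> ennreal (LINT z|edges. ?p z * edge_mobility \<delta> r z)" .
  have Z: "0 \<le> (LINT z|edges. ?p z * edge_mobility \<delta> r z)"
    using nn edge_mobility_nonneg[OF \<delta>_bounds] by (intro integral_nonneg_AE AE_I2) auto
  have "ennreal ((1 - \<delta>) * \<bar>flow (test \<delta> s) r\<bar>) = ennreal (1 - \<delta>) * ennreal \<bar>flow (test \<delta> s) r\<bar>"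
    using \<delta> by (intro ennreal_mult) auto
  also have "\<dots> \<le> ennreal (1 - \<delta>) * (R r + (1/2) * ?I)"
    by (intro mult_left_mono order_trans[OF flow_le_variation[OF r] young_at[OF r]]) auto
  also have "\<dots> = ennreal (1 - \<delta>) * R r + (1/2) * (ennreal (1 - \<delta>) * ?I)"
    by (simp add: distrib_left mult.left_commute)
  also have "\<dots> \<le> 1 * R r + ennreal c"
  proof (rule add_mono)
    show "ennreal (1 - \<delta>) * R r \<le> 1 * R r"
    proof (rule mult_right_mono)
      show "ennreal (1 - \<delta>) \<le> 1" using \<delta> by simp
    qed simp
    have "(1/2) * (ennreal (1 - \<delta>) * ?I) \<le> (1/2) * ennreal (LINT z|edges. ?p z * edge_mobility \<delta> r z)"
      by (intro mult_left_mono I) simp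
    also have "\<dots> \<le> ennreal c" unfolding ennreal_half[OF Z] by (intro ennreal_leI c)
    finally show "(1/2) * (ennreal (1 - \<delta>) * ?I) \<le> ennreal c" .
  qed
  finally show ?thesis by simp
qed

text \<open>Combines the tangent inequality, the continuity equation tested with
  \<open>test \<delta> s\<close>, and the flux bound. The constant c stays open because two values
  are used: a crude one up to the end of the interval and a sharp one just after s.\<close>

lemma ent_decrease:
  assumes s: "0 \<le> s" "s \<le> b" "b \<le> T" and fin: "D s < \<infinity>" and c0: "0 \<le> c"
    and c: "\<And>r. r \<in> {s..b} \<Longrightarrow> (LINT z|edges. \<psi>s (grad (test \<delta> s) z) * edge_mobility \<delta> r z) / 2 \<le> c"
  shows "ent \<delta> s - ent \<delta> b \<le> (LBINT r:{s..b}. Qr r) + c * (b - s)"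
proof -
  have sT: "s \<in> {0..T}" and bT: "b \<in> {0..T}" using s by auto
  let ?\<zeta> = "test \<delta> s"
  have [measurable]: "?\<zeta> \<in> borel_measurable borel" by (rule test_measurable[OF \<delta>])
  have X2: "?\<zeta> \<in> X2 \<pi> \<kappa>" by (rule psi_grad_test_integrable(3)[OF \<delta> sT fin])
  have flow_int: "set_integrable lborel {s..b} (flow ?\<zeta>)"
    using X2_continuity(3)[OF X2] s
    by (intro set_integrable_subset[OF flow_set_integrable]) (auto simp: total_flux_def)
  \<comment> \<open>Cut off to the interval and lowered by c, the flux bound becomes a measurable
    minorant of \<open>R\<close>, so \<open>le_Q\<close> applies.\<close>
  define l where "l r = ennreal ((1 - \<delta>) * \<bar>flow ?\<zeta> r\<bar>) * indicator {s..b} r - ennreal c" for r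
  have "flow ?\<zeta> \<in> borel_measurable (restrict_space borel {0..T})" by (rule flow_measurable) measurable
  moreover have "{s..b} \<in> sets (restrict_space borel {0..T})"
    using s by (subst sets_restrict_space_iff) auto
  ultimately have "l \<in> borel_measurable (restrict_space borel {0..T})"
    unfolding l_def[abs_def] by measurable
  moreover have "l r \<le> R r" if "r \<in> {0..T}" for r
  proof (cases "r \<in> {s..b}")
    case True
    with flow_test_bound[OF sT fin that c[OF True]] show ?thesis
      by (auto simp: l_def intro!: ennreal_minus_le_of_le_add)
  qed (simp add: l_def)
  ultimately have "AE r in lborel. r \<in> {0..T} \<longrightarrow> l r \<le> Q r" by (rule le_Q)
  with AE_Q have ae: "AE r in lborel. r \<in> {s..b} \<longrightarrow> (1 - \<delta>) * \<bar>flow ?\<zeta> r\<bar> \<le> Qr r + c"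
  proof eventually_elim
    case (elim r)
    show ?case
    proof
      assume r: "r \<in> {s..b}"
      with s elim have "ennreal ((1 - \<delta>) * \<bar>flow ?\<zeta> r\<bar>) - ennreal c \<le> ennreal (Qr r)" by (simp add: l_def)
      from ennreal_le_add_of_minus_le[OF this]
      have "ennreal ((1 - \<delta>) * \<bar>flow ?\<zeta> r\<bar>) \<le> ennreal (Qr r + c)" using Qr_nonneg c0 by simp
      then show "(1 - \<delta>) * \<bar>flow ?\<zeta> r\<bar> \<le> Qr r + c"
        using Qr_nonneg[of r] c0 by (subst (asm) ennreal_le_iff) auto
    qed
  qed
  have "- ((LBINT r:{s..b}. Qr r) + c * (b - s)) = (LINT r|lborel. - (indicator {s..b} r * Qr r + c * indicator {s..b} r))"
    using Qr_set_integrable[of "{s..b}"] s unfolding set_lebesgue_integral_def set_integrable_def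
    by (subst Bochner_Integration.integral_minus, subst Bochner_Integration.integral_add) auto
  also have "\<dots> \<le> (LINT r|lborel. (1 - \<delta>) * (indicator {s..b} r * flow ?\<zeta> r))"
  proof (rule integral_mono_AE)
    show "integrable lborel (\<lambda>r. - (indicator {s..b} r * Qr r + c * indicator {s..b} r))"
      using Qr_set_integrable[of "{s..b}"] s unfolding set_integrable_def by auto
    show "integrable lborel (\<lambda>r. (1 - \<delta>) * (indicator {s..b} r * flow ?\<zeta> r))"
      using flow_int unfolding set_integrable_def by auto
    show "AE r in lborel. - (indicator {s..b} r * Qr r + c * indicator {s..b} r) \<le> (1 - \<delta>) * (indicator {s..b} r * flow ?\<zeta> r)"
      using ae
    proof eventually_elim
      case (elim r)
      show ?case
      proof (cases "r \<in> {s..b}")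
        case True
        with elim have "(1 - \<delta>) * \<bar>flow ?\<zeta> r\<bar> \<le> Qr r + c" by blast
        moreover have "(1 - \<delta>) * - flow ?\<zeta> r \<le> (1 - \<delta>) * \<bar>flow ?\<zeta> r\<bar>" using \<delta> by (intro mult_left_mono) auto
        ultimately show ?thesis using True by simp
      qed simp
    qed
  qed
  also have "\<dots> = (1 - \<delta>) * (LBINT r:{s..b}. flow ?\<zeta> r)"
    by (simp add: set_lebesgue_integral_def)
  also have "(LBINT r:{s..b}. flow ?\<zeta> r) = (LINT x|\<rho> b. ?\<zeta> x) - (LINT x|\<rho> s. ?\<zeta> x)"
    using X2_continuity(2)[OF X2] s unfolding continuity_identity_def flow_def by simp
  also have "\<dots> = (LINT x|\<pi>. ?\<zeta> x * u b x) - (LINT x|\<pi>. ?\<zeta> x * u s x)"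
    by (simp add: integral_rho[OF sT] integral_rho[OF bT])
  also have "(1 - \<delta>) * \<dots> \<le> ent \<delta> b - ent \<delta> s" by (rule ent_tangent[OF \<delta>])
  finally show ?thesis by simp
qed

text \<open>The one-sided calculus lemma is applied to entropy plus primitive, with
  \<open>Dr\<close> as the bound on the rate of decrease. The crude use of
  \<open>ent_decrease\<close> gives its linear bound, the sharp use its derivative bound.\<close>

lemma chain_rule_mixed:
  assumes ab: "0 \<le> a" "a < b" "b \<le> T"
  shows "ent \<delta> a - ent \<delta> b \<le> (LBINT r:{a..b}. Qr r) + (LBINT r:{a..b}. Dr r)"
proof -
  have [measurable]: "edge_mobility \<delta> t \<in> borel_measurable borel" for t by (rule edge_mobility_measurable[OF \<delta>_bounds])
  have sub: "{a..b} \<subseteq> {0..T}" using ab by auto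
  obtain A where A: "0 < A" "\<And>t z. edge_mobility \<delta> t z \<le> A" using edge_mobility_bounded[OF \<delta>] by blast
  define l where "l = \<delta> * \<alpha> 1 1"
  have l: "0 < l" using \<delta> mobility_one_pos[OF \<alpha>] by (simp add: l_def)
  \<comment> \<open>A / l bounds the ratio of the mobilities at two different times; the maximum
    with 1 meets the requirement of the calculus lemma.\<close>
  define B where "B = max 1 (A / l)"
  define W where "W s = indicator {0..T} s * (ent \<delta> s + \<Phi> s)" for s
  have W: "W s = ent \<delta> s + \<Phi> s" if "s \<in> {0..T}" for s using that by (simp add: W_def)
  have W_diff: "W r - W s = ent \<delta> r - ent \<delta> s + (LBINT r:{s..r}. Qr r)" if "s \<in> {a..b}" "r \<in> {s..b}" for s r
    using that ab \<Phi>_diff[of s r] by (simp add: W)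
  have m_nonneg: "0 \<le> \<psi>s (grad (test \<delta> s) z) * edge_mobility \<delta> r z" for s r z
    using dual_dissipation_nonneg[OF \<psi>] edge_mobility_nonneg[OF \<delta>_bounds] by simp
  have m_int: "integrable edges (\<lambda>z. \<psi>s (grad (test \<delta> s) z) * edge_mobility \<delta> r z)"
    if "s \<in> {0..T}" "D s < \<infinity>" for s r
  proof (rule edge_integrable_mult_bounded[OF psi_grad_test_integrable(1)[OF \<delta> that]])
    show "\<bar>edge_mobility \<delta> r z\<bar> \<le> A" for z using A(2)[of r z] edge_mobility_nonneg[OF \<delta>_bounds, of r z] by simp
  qed measurable
  have Dr_eq: "Dr s = enn2real (D s)" if "s \<in> {0..T}" for s using that by (simp add: Dr_def)
  have D_fin: "AE s in lborel. s \<in> {0..T} \<longrightarrow> D s < \<infinity>"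
    using AE_D by eventually_elim (auto split: split_indicator_asm)
  obtain K where K: "0 \<le> K" "\<And>r. 0 \<le> r \<Longrightarrow> r \<le> C + 1 \<Longrightarrow> \<phi> r \<le> K" using entropy_density_bounded[OF \<phi>] by blast
  have ent_le: "ent \<delta> s \<le> K * measure \<pi> UNIV" for s
  proof -
    have "ent \<delta> s \<le> (LINT x|\<pi>. K)"
      unfolding ent_def using phi_v_integrable[OF \<delta>_bounds] K v_nonneg[OF \<delta>_bounds] v_le[OF \<delta>_bounds] by (intro integral_mono) auto
    then show ?thesis by (simp add: mult.commute)
  qed
  have "W a - W b \<le> (LINT s|lborel. indicator {a..b} s * Dr s)"
  proof (rule decrease_le_integral_of_lower_derivative[of a b B W "\<Phi> T + K * measure \<pi> UNIV" Dr])
    show "a < b" by fact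
    show "1 \<le> B" by (simp add: B_def)
    have "continuous_on {0..T} \<Phi>" by (rule \<Phi>_continuous)
    then have "\<Phi> \<in> borel_measurable (restrict_space borel {0..T})" by (rule borel_measurable_continuous_on_restrict)
    with ent_measurable[OF \<delta>] have "(\<lambda>s. ent \<delta> s + \<Phi> s) \<in> borel_measurable (restrict_space borel {0..T})" by measurable
    then show "W \<in> borel_measurable borel"
      unfolding W_def[abs_def] by (subst (asm) borel_measurable_restrict_space_iff) auto
    show "\<bar>W s\<bar> \<le> \<Phi> T + K * measure \<pi> UNIV" for s
    proof (cases "s \<in> {0..T}")
      case True
      then have "0 \<le> \<Phi> s" "\<Phi> s \<le> \<Phi> T" using \<Phi>_mono[of s T] LBINT_Qr_nonneg[of "{0..s}"] by (auto simp: \<Phi>_def)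
      with ent_le[of s] ent_nonneg[OF \<delta>_bounds, of s] True show ?thesis by (simp add: W)
    next
      case False
      have "0 \<le> \<Phi> T" using LBINT_Qr_nonneg by (simp add: \<Phi>_def)
      with False K show ?thesis by (simp add: W_def)
    qed
    show "integrable lborel Dr" by (rule Dr_integrable)
    show "0 \<le> Dr s" for s by (rule Dr_nonneg)
    show "AE s in lborel. s \<in> {a..b} \<longrightarrow> (\<forall>r\<in>{s..b}. - (B * Dr s * (r - s)) \<le> W r - W s)"
      using D_fin
    proof eventually_elim
      case (elim s)
      show ?case
      proof (intro impI ballI)
        fix r assume s: "s \<in> {a..b}" and r: "r \<in> {s..b}"
        have sT: "s \<in> {0..T}" and fin: "D s < \<infinity>" using s sub elim by auto
        have bound: "(LINT z|edges. \<psi>s (grad (test \<delta> s) z) * edge_mobility \<delta> r' z) / 2 \<le> B * Dr s" for r'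
        proof -
          have "(LINT z|edges. \<psi>s (grad (test \<delta> s) z) * edge_mobility \<delta> r' z) \<le>
              (LINT z|edges. (A / l) * (\<psi>s (grad (test \<delta> s) z) * edge_mobility \<delta> s z))"
          proof (rule integral_mono)
            fix z
            have "edge_mobility \<delta> r' z \<le> (A / l) * l" using A(2) l by simp
            also have "\<dots> \<le> (A / l) * edge_mobility \<delta> s z"
              using A(1) l edge_mobility_lower[OF \<delta>, of s z] by (intro mult_left_mono) (auto simp: l_def)
            finally have "\<psi>s (grad (test \<delta> s) z) * edge_mobility \<delta> r' z \<le>
                \<psi>s (grad (test \<delta> s) z) * ((A / l) * edge_mobility \<delta> s z)"
              by (intro mult_left_mono dual_dissipation_nonneg[OF \<psi>])
            then show "\<psi>s (grad (test \<delta> s) z) * edge_mobility \<delta> r' z \<le>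
                (A / l) * (\<psi>s (grad (test \<delta> s) z) * edge_mobility \<delta> s z)" by (simp add: mult.left_commute)
          qed (use m_int[OF sT fin] in auto)
          also have "\<dots> = (A / l) * (LINT z|edges. \<psi>s (grad (test \<delta> s) z) * edge_mobility \<delta> s z)" by simp
          finally have "(LINT z|edges. \<psi>s (grad (test \<delta> s) z) * edge_mobility \<delta> r' z) / 2 \<le>
            (A / l) * ((LINT z|edges. \<psi>s (grad (test \<delta> s) z) * edge_mobility \<delta> s z) / 2)" by simp
          also have "\<dots> \<le> B * Dr s"
          proof (rule mult_mono)
            show "(LINT z|edges. \<psi>s (grad (test \<delta> s) z) * edge_mobility \<delta> s z) / 2 \<le> Dr s"
              unfolding Dr_eq[OF sT] by (rule psi_grad_test_integrable(2)[OF \<delta> sT fin])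
            show "0 \<le> (LINT z|edges. \<psi>s (grad (test \<delta> s) z) * edge_mobility \<delta> s z) / 2"
              using m_nonneg by simp
          qed (auto simp: B_def)
          finally show ?thesis .
        qed
        have "ent \<delta> s - ent \<delta> r \<le> (LBINT r:{s..r}. Qr r) + B * Dr s * (r - s)"
          using s r ab fin bound Dr_nonneg[of s] by (intro ent_decrease) (auto simp: B_def)
        then show "- (B * Dr s * (r - s)) \<le> W r - W s" using W_diff[OF s r] by simp
      qed
    qed
    show "AE s in lborel. s \<in> {a..<b} \<longrightarrow> (\<forall>\<epsilon>>0. \<forall>\<^sub>F r in at_right s. - ((Dr s + \<epsilon>) * (r - s)) \<le> W r - W s)"
      using D_fin
    proof eventually_elim
      case (elim s)
      show ?case
      proof (intro impI allI)
        fix \<epsilon> :: real assume s: "s \<in> {a..<b}" and \<epsilon>: "0 < \<epsilon>"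
        have sT: "s \<in> {0..T}" and fin: "D s < \<infinity>" using s sub elim by auto
        let ?m = "\<lambda>r. LINT z|edges. \<psi>s (grad (test \<delta> s) z) * edge_mobility \<delta> r z"
        have ms: "?m s / 2 \<le> Dr s"
          unfolding Dr_eq[OF sT] by (rule psi_grad_test_integrable(2)[OF \<delta> sT fin])
        \<comment> \<open>The mobility integral is halved when compared with \<open>Dr s\<close>,
          hence 2 * \<epsilon>.\<close>
        have "\<forall>\<^sub>F r in at s within {0..T}. ?m r \<le> ?m s + 2 * \<epsilon>"
          using \<epsilon> psi_grad_test_measurable[OF \<delta>] dual_dissipation_nonneg[OF \<psi>]
          by (intro edge_mobility_integral_usc[OF \<delta> _ _ psi_grad_test_integrable(1)[OF \<delta> sT fin] sT]) auto
        then obtain d where d: "0 < d" "\<And>r. r \<in> {0..T} \<Longrightarrow> r \<noteq> s \<Longrightarrow> dist r s < d \<Longrightarrow> ?m r \<le> ?m s + 2 * \<epsilon>"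
          by (auto simp: eventually_at)
        have bound: "?m r / 2 \<le> Dr s + \<epsilon>" if "s \<le> r" "r < s + d" "r \<le> b" for r
        proof (cases "r = s")
          case True
          with ms \<epsilon> show ?thesis by simp
        next
          case False
          then have "?m r \<le> ?m s + 2 * \<epsilon>" using that sT ab by (intro d(2)) (auto simp: dist_real_def)
          with ms show ?thesis by simp
        qed
        have "- ((Dr s + \<epsilon>) * (r - s)) \<le> W r - W s" if r: "s < r" "r < min b (s + d)" for r
        proof -
          have "ent \<delta> s - ent \<delta> r \<le> (LBINT r:{s..r}. Qr r) + (Dr s + \<epsilon>) * (r - s)"
            using s r ab fin bound Dr_nonneg[of s] \<epsilon> by (intro ent_decrease) auto
          then show ?thesis using W_diff[of s r] s r by simp
        qed
        moreover have "s < min b (s + d)" using s d by simp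
        ultimately show "\<forall>\<^sub>F r in at_right s. - ((Dr s + \<epsilon>) * (r - s)) \<le> W r - W s"
          unfolding eventually_at_right_field by blast
      qed
    qed
    fix \<epsilon> :: real assume \<epsilon>: "0 < \<epsilon>"
    have aT: "a \<in> {0..T}" using ab by auto
    \<comment> \<open>The entropy is lower semicontinuous at a, and the primitive does not decrease
      to the right.\<close>
    obtain \<eta> where \<eta>: "(\<eta> \<longlongrightarrow> 0) (at a within {0..T})" "\<And>r. ent \<delta> a + \<eta> r \<le> ent \<delta> r"
      using ent_lsc_at[OF \<delta> aT] by blast
    have "(\<eta> \<longlongrightarrow> 0) (at a within {a..b})" by (rule tendsto_within_subset[OF \<eta>(1) sub])
    then have "(\<eta> \<longlongrightarrow> 0) (at_right a)" using ab by (simp add: at_within_Icc_at_right)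
    then have "\<forall>\<^sub>F r in at_right a. - \<epsilon> < \<eta> r" using \<epsilon> by (intro order_tendstoD) auto
    moreover have "\<forall>\<^sub>F r in at_right a. r \<in> {a<..<b}" using ab by (auto simp: eventually_at_right_field intro!: exI[of _ b])
    ultimately show "\<forall>\<^sub>F r in at_right a. W a - \<epsilon> \<le> W r"
    proof eventually_elim
      case (elim r)
      then have "\<Phi> a \<le> \<Phi> r" "r \<in> {0..T}" using ab \<Phi>_mono[of a r] by auto
      with \<eta>(2)[of r] elim aT show ?case by (simp add: W)
    qed
  qed
  then show ?thesis
    using W_diff[of a b] ab by (simp add: set_lebesgue_integral_def)
qed

end

section \<open>Removal of the mixture and the energy identity\<close>

text \<open>The shift by two keeps every parameter at most 1/2, hence strictly between 0 and 1 as
  the mixed chain rule requires.\<close>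

lemma ent_limit:
  "(\<lambda>n. ent (1 / real (Suc (Suc n))) t) \<longlonglongrightarrow> ent 0 t"
  unfolding ent_def
proof -
  have d: "0 \<le> 1 / real (Suc (Suc n))" "1 / real (Suc (Suc n)) \<le> 1" for n by auto
  obtain K where K: "0 \<le> K" "\<And>r. 0 \<le> r \<Longrightarrow> r \<le> C + 1 \<Longrightarrow> \<phi> r \<le> K" using entropy_density_bounded[OF \<phi>] by blast
  have d_lim: "(\<lambda>n. 1 / real (Suc (Suc n))) \<longlonglongrightarrow> 0"
    using LIMSEQ_Suc[OF LIMSEQ_Suc[OF lim_1_over_n]] by simp
  show "(\<lambda>n. LINT x|\<pi>. \<phi> (v (1 / real (Suc (Suc n))) t x)) \<longlonglongrightarrow> (LINT x|\<pi>. \<phi> (v 0 t x))"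
  proof (rule integral_dominated_convergence[where w = "\<lambda>_. K"])
    show "AE x in \<pi>. norm (\<phi> (v (1 / real (Suc (Suc n))) t x)) \<le> K" for n
      using K(2)[OF v_nonneg[OF d] v_le[OF d]] entropy_density_nonneg[OF \<phi> v_nonneg[OF d]]
      by (intro AE_I2) simp
    show "AE x in \<pi>. (\<lambda>n. \<phi> (v (1 / real (Suc (Suc n))) t x)) \<longlonglongrightarrow> \<phi> (v 0 t x)"
    proof (rule AE_I2)
      fix x
      have "continuous_on {0..} \<phi>" using \<phi> by (simp add: entropy_density_def)
      moreover have "(\<lambda>n. v (1 / real (Suc (Suc n))) t x) \<longlonglongrightarrow> (1 - 0) * u t x + 0"
        unfolding v_def by (intro tendsto_intros d_lim)
      then have "(\<lambda>n. v (1 / real (Suc (Suc n))) t x) \<longlonglongrightarrow> v 0 t x" by (simp add: v_def)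
      moreover have "v 0 t x \<in> {0..}" using v_nonneg[of 0] by simp
      moreover have "\<forall>\<^sub>F n in sequentially. v (1 / real (Suc (Suc n))) t x \<in> {0..}"
        using v_nonneg[OF d] by (intro always_eventually) simp
      ultimately show "(\<lambda>n. \<phi> (v (1 / real (Suc (Suc n))) t x)) \<longlonglongrightarrow> \<phi> (v 0 t x)"
        by (rule continuous_on_tendsto_compose)
    qed
  qed (use phi_v_measurable[OF d] phi_v_measurable[of 0] in auto)
qed

lemma entropy_eq_ent:
  assumes t: "t \<in> {0..T}"
  shows "entropy \<pi> \<phi> (\<rho> t) = ennreal (ent 0 t)"
proof -
  have "entropy \<pi> \<phi> (\<rho> t) = (\<integral>\<^sup>+x. ennreal (\<phi> (density_wrt \<pi> (\<rho> t) x)) \<partial>\<pi>)"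
    using rho_ac[OF t] by (simp add: entropy_def)
  also have "\<dots> = (\<integral>\<^sup>+x. ennreal (\<phi> (v 0 t x)) \<partial>\<pi>)"
  proof (rule nn_integral_cong_AE)
    show "AE x in \<pi>. ennreal (\<phi> (density_wrt \<pi> (\<rho> t) x)) = ennreal (\<phi> (v 0 t x))"
      using density_eq_u[OF t] by eventually_elim (simp add: v_def)
  qed
  also have "\<dots> = ennreal (ent 0 t)"
    unfolding ent_def using phi_v_integrable[of 0] entropy_density_nonneg[OF \<phi> v_nonneg[of 0]]
    by (intro nn_integral_eq_integral) auto
  finally show ?thesis .
qed

text \<open>The right side of the mixed inequality does not depend on \<delta>, so only the
  entropies pass to the limit. Since \<open>Q\<close> lies below \<open>R\<close>, superadditivity
  then bounds the integrals of \<open>Q\<close> and \<open>D\<close> by the lower integral of their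
  sum with \<open>R\<close>.\<close>

theorem chain_rule_inequality:
  assumes ab: "0 \<le> a" "a \<le> b" "b \<le> T"
  shows "entropy \<pi> \<phi> (\<rho> a) \<le> (\<integral>\<^sup>+r\<in>{a..b}. (R r + D r) \<partial>lborel) + entropy \<pi> \<phi> (\<rho> b)"
proof (cases "a = b")
  case True
  then show ?thesis by simp
next
  case False
  then have "a < b" using ab by simp
  let ?X = "(LBINT r:{a..b}. Qr r) + (LBINT r:{a..b}. Dr r)"
  have "ent 0 a - ent 0 b \<le> ?X"
  proof (rule LIMSEQ_le_const2)
    show "(\<lambda>n. ent (1 / real (Suc (Suc n))) a - ent (1 / real (Suc (Suc n))) b) \<longlonglongrightarrow> ent 0 a - ent 0 b"
      by (intro tendsto_diff ent_limit)
    show "\<exists>N. \<forall>n\<ge>N. ent (1 / real (Suc (Suc n))) a - ent (1 / real (Suc (Suc n))) b \<le> ?X"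
      using chain_rule_mixed[OF _ _ ab(1) \<open>a < b\<close> ab(3)] by auto
  qed
  then have le: "ent 0 a \<le> ?X + ent 0 b" by simp
  have D0: "0 \<le> (LBINT r:{a..b}. Dr r)"
    unfolding set_lebesgue_integral_def by (intro integral_nonneg_AE AE_I2) (simp add: Dr_nonneg)
  have "ennreal (LBINT r:{a..b}. Qr r) = (\<integral>\<^sup>+r. ennreal (indicator {a..b} r * Qr r) \<partial>lborel)"
    using Qr_set_integrable[of "{a..b}"] Qr_nonneg unfolding set_lebesgue_integral_def set_integrable_def
    by (subst nn_integral_eq_integral) auto
  also have "\<dots> = (\<integral>\<^sup>+r. Q r * indicator {a..b} r \<partial>lborel)"
  proof (rule nn_integral_cong_AE)
    show "AE r in lborel. ennreal (indicator {a..b} r * Qr r) = Q r * indicator {a..b} r"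
      using AE_Q by eventually_elim (auto split: split_indicator)
  qed
  finally have Q_eq: "ennreal (LBINT r:{a..b}. Qr r) = (\<integral>\<^sup>+r. Q r * indicator {a..b} r \<partial>lborel)" .
  have "ennreal (LBINT r:{a..b}. Dr r) = (\<integral>\<^sup>+r. ennreal (indicator {a..b} r * Dr r) \<partial>lborel)"
    using Dr_set_integrable[of "{a..b}"] Dr_nonneg unfolding set_lebesgue_integral_def set_integrable_def
    by (subst nn_integral_eq_integral) auto
  also have "\<dots> = (\<integral>\<^sup>+r. D r * indicator {a..b} r \<partial>lborel)"
  proof (rule nn_integral_cong_AE)
    show "AE r in lborel. ennreal (indicator {a..b} r * Dr r) = D r * indicator {a..b} r"
      using AE_D
    proof eventually_elim
      case (elim r)
      with ab show ?case by (auto split: split_indicator split_indicator_asm)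
    qed
  qed
  finally have D_eq: "ennreal (LBINT r:{a..b}. Dr r) = (\<integral>\<^sup>+r. D r * indicator {a..b} r \<partial>lborel)" .
  have "entropy \<pi> \<phi> (\<rho> a) = ennreal (ent 0 a)" using ab by (intro entropy_eq_ent) auto
  also have "\<dots> \<le> ennreal (?X + ent 0 b)" by (rule ennreal_leI[OF le])
  also have "\<dots> = ennreal (LBINT r:{a..b}. Qr r) + ennreal (LBINT r:{a..b}. Dr r) + ennreal (ent 0 b)"
    using LBINT_Qr_nonneg D0 ent_nonneg[of 0] by simp
  also have "\<dots> \<le> (\<integral>\<^sup>+r\<in>{a..b}. (R r + D r) \<partial>lborel) + ennreal (ent 0 b)"
    unfolding Q_eq D_eq
  proof (rule add_right_mono, rule nn_integral_superadditive)
    fix r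
    show "Q r * indicator {a..b} r + D r * indicator {a..b} r \<le> (R r + D r) * indicator {a..b} r"
      using Q_le[of r] ab by (auto split: split_indicator split_indicator_asm simp: add_right_mono)
  qed
  also have "ennreal (ent 0 b) = entropy \<pi> \<phi> (\<rho> b)" using ab by (intro entropy_eq_ent[symmetric]) auto
  finally show ?thesis .
qed

text \<open>The dissipation inequality starts at time 0. The chain rule on the interval from 0 to s
  allows the part before s to be subtracted, which its finiteness permits; the chain rule from s to
  t is the opposite inequality.\<close>

theorem energy_identity:
  assumes st: "0 \<le> s" "s \<le> t" "t \<le> T"
  shows "(\<integral>\<^sup>+r\<in>{s..t}. (R r + D r) \<partial>lborel) + entropy \<pi> \<phi> (\<rho> t) = entropy \<pi> \<phi> (\<rho> s)"
proof (rule antisym)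
  show "entropy \<pi> \<phi> (\<rho> s) \<le> (\<integral>\<^sup>+r\<in>{s..t}. (R r + D r) \<partial>lborel) + entropy \<pi> \<phi> (\<rho> t)"
    by (rule chain_rule_inequality[OF st])
  let ?F = "\<lambda>a b. \<integral>\<^sup>+r\<in>{a..b}. (R r + D r) \<partial>lborel"
  \<comment> \<open>Dropping the null set {s} makes the two indicators disjoint, so that
    superadditivity applies pointwise.\<close>
  have "?F 0 s + ?F s t = ?F 0 s + (\<integral>\<^sup>+r\<in>{s<..t}. (R r + D r) \<partial>lborel)"
  proof (rule arg_cong[where f = "\<lambda>x. ?F 0 s + x"], rule nn_integral_cong_AE)
    show "AE r in lborel. (R r + D r) * indicator {s..t} r = (R r + D r) * indicator {s<..t} r"
      using AE_lborel_singleton[of s] by eventually_elim (auto split: split_indicator)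
  qed
  also have "\<dots> \<le> ?F 0 t"
    using st by (intro nn_integral_superadditive) (auto split: split_indicator)
  finally have F: "?F 0 s + ?F s t \<le> ?F 0 t" .
  have "?F 0 s + (?F s t + entropy \<pi> \<phi> (\<rho> t)) \<le> ?F 0 t + entropy \<pi> \<phi> (\<rho> t)"
    using add_right_mono[OF F] by (simp add: add.assoc)
  also have "\<dots> \<le> entropy \<pi> \<phi> (\<rho> 0)"
    using diss st unfolding dissipative_solution_def by auto
  also have "\<dots> \<le> ?F 0 s + entropy \<pi> \<phi> (\<rho> s)"
    using st by (intro chain_rule_inequality) auto
  finally have "?F 0 s + (?F s t + entropy \<pi> \<phi> (\<rho> t)) \<le> ?F 0 s + entropy \<pi> \<phi> (\<rho> s)" .
  moreover have "?F 0 s \<noteq> top"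
  proof -
    have "?F 0 s \<le> ?F 0 T" using st by (intro nn_integral_mono) (auto split: split_indicator)
    with dissipation_finite show ?thesis by (auto simp: less_top top_unique)
  qed
  ultimately show "?F s t + entropy \<pi> \<phi> (\<rho> t) \<le> entropy \<pi> \<phi> (\<rho> s)"
    by (simp add: ennreal_add_left_cancel_le)
qed

lemma in_RCE: "(\<rho>, j) \<in> RCE \<pi> \<kappa> \<phi> \<psi>s \<alpha> T"
proof -
  have "(SUP t\<in>{0..T}. entropy \<pi> \<phi> (\<rho> t)) \<le> entropy \<pi> \<phi> (\<rho> 0)"
    by (intro SUP_least entropy_le)
  also have "\<dots> < \<infinity>" using T by (intro entropy_finite) simp
  finally have "(\<rho>, j) \<in> ACE \<pi> \<kappa> \<phi> \<psi>s \<alpha> T"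
    using CE dissipation_finite by (simp add: ACE_def)
  moreover have "bounded_density \<pi> T \<rho>" unfolding bounded_density_def using bounded by blast
  ultimately show ?thesis using X2_continuity(1,2) by (simp add: RCE_def)
qed

end

theorem corollary4p14:
  fixes \<pi> :: "'a::{metric_space, second_countable_topology} measure"
    and \<kappa> :: "'a \<Rightarrow> 'a measure"
    and \<phi> \<psi>s :: "real \<Rightarrow> real"
    and \<alpha> :: "real \<Rightarrow> real \<Rightarrow> real"
    and T :: real
    and \<rho> :: "real \<Rightarrow> 'a measure"
    and j :: "real \<Rightarrow> ('a \<times> 'a) flux"
  assumes "T > 0"
    and "\<pi> \<in> finite_borel_measures"
    and "jump_kernel \<pi> \<kappa>"
    and "entropy_density \<phi>"
    and "dual_dissipation_density \<psi>s"
    and "mobility \<alpha>"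
    and "fisher_setwise_lsc \<pi> \<kappa> \<phi> \<psi>s \<alpha>"
    and "\<forall>\<zeta>\<in>X2 \<pi> \<kappa>. \<exists>\<zeta>n :: nat \<Rightarrow> 'a \<Rightarrow> real. (\<forall>n. \<zeta>n n \<in> Lip_b) \<and>
           (\<lambda>n. \<integral>\<^sup>+ x. ennreal \<bar>\<zeta>n n x - \<zeta> x\<bar> \<partial>\<pi>) \<longlonglongrightarrow> 0 \<and>
           (\<lambda>n. \<integral>\<^sup>+ z. ennreal ((grad (\<zeta>n n) z - grad \<zeta> z)\<^sup>2) \<partial>edge_measure \<pi> \<kappa>) \<longlonglongrightarrow> 0"
    and "fisher_convex \<pi> \<kappa> \<phi> \<psi>s \<alpha>"
    and "dissipative_solution \<pi> \<kappa> \<phi> \<psi>s \<alpha> T \<rho> j"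
    and "bounded_density \<pi> T \<rho>"
  shows "reflecting_solution \<pi> \<kappa> \<phi> \<psi>s \<alpha> T \<rho> j"
proof -
  obtain C0 where C0: "AE t in lborel. t \<in> {0<..<T} \<longrightarrow> (AE x in \<pi>. density_wrt \<pi> (\<rho> t) x \<le> C0)"
    using assms(11) by (auto simp: bounded_density_def)
  \<comment> \<open>The locale asks for a positive bound.\<close>
  have bounded: "AE t in lborel. t \<in> {0<..<T} \<longrightarrow> (AE x in \<pi>. density_wrt \<pi> (\<rho> t) x \<le> max 1 C0)"
    using C0 by eventually_elim (auto elim!: eventually_mono)
  interpret convex_curve \<pi> \<kappa> \<phi> \<psi>s \<alpha> T "max 1 C0" \<rho> j
    by unfold_locales (use assms bounded in auto)
  have "entropy \<pi> \<phi> (\<rho> 0) < \<infinity>" using assms(1) by (intro entropy_finite) simp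
  then show ?thesis
    unfolding reflecting_solution_def using in_RCE energy_identity by blast
qed

end
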